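(* Let $\mu,\nu \in X_*\cap cl(\mathcal C)$ be any dominant cocharacters, and let $J\subseteq S_{\rm aff}$. Then $$\mathrm{Adm}^J(\mu+\nu)=\mathrm{Adm}^J(\mu)\,\mathrm{Adm}^J(\nu),$$ where the right-hand side is the set of products $xy\in \widetilde W$ with $x\in\mathrm{Adm}^J(\mu)$, $y\in\mathrm{Adm}^J(\nu)$.
   Context: Let $(X^*,X_*,R,R^\vee,\Pi)$ be a based reduced root system (root datum) with perfect pairing $\langle\,,\rangle: X^*\times X_*\to\mathbb Z$, simple roots $\Pi$, positive roots $R_+$. Put $V=X_*\otimes\mathbb R$. An affine root is $\tilde\alpha=\alpha+k$ with $\alpha\in R$, $k\in\mathbb Z$; its reflection is $s_{\tilde\alpha}(x)=x-(\langle\alpha,x\rangle+k)\alpha^\vee$, with fixed hyperplane $H_{\tilde\alpha}\subset V$. $W$ is the finite Weyl group, $W_{\rm aff}$ the group generated by all $s_{\tilde\alpha}$, and $\widetilde W=X_*\rtimes W$ the extended affine Weyl group acting on $V$; $t_\lambda\in\widetilde W$ denotes translation by $\lambda\in X_*$. Alcoves are the connected components of $V$ minus all affine root hyperplanes. $cl(\cdot)$ denotes closure. The dominant chamber is $\mathcal C=\{x\in V: \langle\alpha,x\rangle>0\ \forall\alpha\in\Pi\}$, and the base alcove is $\bar{\bf a}=\{x\in V: -1<\langle\alpha,x\rangle<0\ \forall \alpha\in R_+\}$. $S_{\rm aff}$ is the set of reflections in the walls of $\bar{\bf a}$; $(W_{\rm aff},S_{\rm aff})$ is a Coxeter system. $\Omega$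 is the stabilizer of $\bar{\bf a}$ in $\widetilde W$, so $\widetilde W=W_{\rm aff}\rtimes\Omega$. The Bruhat order on $\widetilde W$: for $u,u'\in W_{\rm aff}$, $\tau,\tau'\in\Omega$, $u\tau\le u'\tau'$ iff $\tau=\tau'$ and $u\le u'$ in $W_{\rm aff}$. For $\mu\in X_*$, $\tau_\mu\in\Omega$ is defined by $t_\mu\in W_{\rm aff}\tau_\mu$. For $J\subseteq S_{\rm aff}$, $W_J\subseteq W_{\rm aff}$ is the subgroup generated by $J$. For $\mu$ dominant: $\mathrm{Adm}(\mu)=\{x\in W_{\rm aff}\tau_\mu : x\le t_\lambda \text{ for some }\lambda\in W\mu\}$ and $\mathrm{Adm}^J(\mu)=W_J\,\mathrm{Adm}(\mu)\,W_J$. *)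

theory Defs
  imports
    "HOL-Analysis.Analysis"
    "HOL-Algebra.Bij"
    "HOL-Algebra.Generated_Groups"
begin

section \<open>Abelian groups as integer modules\<close>

definition zmul :: "int \<Rightarrow> 'a::ab_group_add \<Rightarrow> 'a" where
  "zmul k x = (((+) x) ^^ nat k) 0 - (((+) x) ^^ nat (- k)) 0"

lemma funpow_plus_add:
  fixes x :: "'a::ab_group_add"
  shows "(((+) x) ^^ (m + n)) 0 = (((+) x) ^^ m) 0 + (((+) x) ^^ n) 0"
  by (induction m) (auto simp: add.assoc)

lemma zmul_diff_nat:
  fixes x :: "'a::ab_group_add"
  shows "zmul (int m - int n) x = (((+) x) ^^ m) 0 - (((+) x) ^^ n) 0"
proof (cases "n \<le> m")
  case True
  then obtain d where "m = d + n" by (metis add.commute le_Suc_ex)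
  then show ?thesis by (simp add: zmul_def funpow_plus_add)
next
  case False
  then obtain d where "n = d + m" by (metis add.commute le_Suc_ex nle_le)
  then show ?thesis by (simp add: zmul_def funpow_plus_add)
qed

lemma zmul_add_left: "zmul (a + b) x = zmul a x + zmul b x"
proof -
  obtain m n where a: "a = int m - int n" by (meson int_diff_cases)
  obtain p q where b: "b = int p - int q" by (meson int_diff_cases)
  have "a + b = int (m + p) - int (n + q)" using a b by simp
  then show ?thesis
    unfolding a b using zmul_diff_nat[of "m + p" "n + q" x]
    by (simp add: zmul_diff_nat funpow_plus_add algebra_simps)
qed

lemma zmul_1: "zmul 1 x = x"
  by (simp add: zmul_def)

lemma zmul_0: "zmul 0 x = 0"
  by (simp add: zmul_def)

lemma zmul_minus: "zmul (- a) x = - zmul a x"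
  by (simp add: zmul_def)

lemma zmul_add_right: "zmul a (x + y) = zmul a x + zmul a y"
proof (induction a rule: int_induct[where k = 0])
  case base
  show ?case by (simp add: zmul_0)
next
  case (step1 i)
  then show ?case by (simp add: zmul_add_left zmul_1 algebra_simps)
next
  case (step2 i)
  have pred: "zmul (i - 1) z = zmul i z - z" for z :: 'a
    using zmul_add_left[of i "-1" z] by (simp add: zmul_minus zmul_1)
  show ?case unfolding pred step2 by simp
qed

lemma zmul_zmul: "zmul a (zmul b x) = zmul (a * b) x"
proof (induction a rule: int_induct[where k = 0])
  case base
  show ?case by (simp add: zmul_0)
next
  case (step1 i)
  then show ?case by (simp add: zmul_add_left zmul_1 distrib_right)
next
  case (step2 i)
  have "zmul (i - 1) z = zmul i z - z" for z :: 'a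
    using zmul_add_left[of i "-1" z] by (simp add: zmul_minus zmul_1)
  moreover have "zmul ((i - 1) * b) x = zmul (i * b) x - zmul b x"
    using zmul_add_left[of "i * b" "- b" x] by (simp add: zmul_minus left_diff_distrib)
  ultimately show ?case using step2 by simp
qed

interpretation int_module: module zmul
  by unfold_locales (simp_all add: zmul_add_left zmul_add_right zmul_zmul zmul_1)

definition is_zbasis :: "'a::ab_group_add set \<Rightarrow> bool" where
  "is_zbasis B \<longleftrightarrow> finite B \<and> int_module.independent B \<and> int_module.span B = UNIV"


section \<open>Length and Bruhat order for a group generated by a set of involutions\<close>

definition word_length :: "('g, 'm) monoid_scheme \<Rightarrow> 'g set \<Rightarrow> 'g \<Rightarrow> nat" where
  "word_length G S w =
     (LEAST n. \<exists>ss. set ss \<subseteq> S \<and> length ss = n \<and> foldr (mult G) ss \<one>\<^bsub>G\<^esub> = w)"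

text \<open>The Bruhat order is the reflexive-transitive closure of the relations
  \<open>u < u t\<close>, where \<open>t\<close> is a conjugate of an element of \<open>S\<close> and \<open>u t\<close> is longer than \<open>u\<close>.\<close>

definition coxeter_reflections :: "('g, 'm) monoid_scheme \<Rightarrow> 'g set \<Rightarrow> 'g set" where
  "coxeter_reflections G S = {w \<otimes>\<^bsub>G\<^esub> s \<otimes>\<^bsub>G\<^esub> inv\<^bsub>G\<^esub> w | w s. w \<in> generate G S \<and> s \<in> S}"

definition bruhat_le :: "('g, 'm) monoid_scheme \<Rightarrow> 'g set \<Rightarrow> 'g \<Rightarrow> 'g \<Rightarrow> bool" where
  "bruhat_le G S =
     (\<lambda>u v. u \<in> generate G S \<and>
        (\<exists>t \<in> coxeter_reflections G S. v = u \<otimes>\<^bsub>G\<^esub> t) \<and>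
        word_length G S u < word_length G S v)\<^sup>*\<^sup>*"


section \<open>Based reduced root data\<close>

text \<open>The types \<open>'c\<close> and \<open>'d\<close> are the groups \<open>X\<^sup>*\<close> and \<open>X\<^sub>*\<close>.  The coroot bijection is a total
  function of which only the values on \<open>R\<close> matter; \<open>R\<^sup>\<or>\<close> is \<open>coroot ` R\<close>.\<close>

locale root_datum =
  fixes pairing :: "'c::ab_group_add \<Rightarrow> 'd::ab_group_add \<Rightarrow> int"
    and R :: "'c set"
    and coroot :: "'c \<Rightarrow> 'd"
  assumes free_X_upper: "\<exists>B :: 'c set. is_zbasis B"
    and free_X_lower: "\<exists>B :: 'd set. is_zbasis B"
    and additive_left: "Modules.additive (\<lambda>\<xi>. pairing \<xi> \<eta>)"
    and additive_right: "Modules.additive (pairing \<xi>)"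
    and perfect_left: "bij_betw pairing UNIV {f. Modules.additive f}"
    and perfect_right: "bij_betw (\<lambda>\<eta> \<xi>. pairing \<xi> \<eta>) UNIV {f. Modules.additive f}"
    and finite_R: "finite R"
    and coroot_inj: "inj_on coroot R"
    and pairing_coroot: "\<alpha> \<in> R \<Longrightarrow> pairing \<alpha> (coroot \<alpha>) = 2"
    and reflect_root: "\<alpha> \<in> R \<Longrightarrow> \<beta> \<in> R \<Longrightarrow> \<beta> - zmul (pairing \<beta> (coroot \<alpha>)) \<alpha> \<in> R"
    and reflect_coroot:
      "\<alpha> \<in> R \<Longrightarrow> \<beta> \<in> R \<Longrightarrow>
         coroot \<beta> - zmul (pairing \<alpha> (coroot \<beta>)) (coroot \<alpha>) \<in> coroot ` R"

locale based_reduced_root_datum = root_datum pairing R coroot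
  for pairing :: "'c::ab_group_add \<Rightarrow> 'd::ab_group_add \<Rightarrow> int"
    and R :: "'c set"
    and coroot :: "'c \<Rightarrow> 'd" +
  fixes \<Delta> :: "'c set"
  assumes reduced:
      "\<alpha> \<in> R \<Longrightarrow> \<beta> \<in> R \<Longrightarrow> zmul m \<alpha> = zmul n \<beta> \<Longrightarrow> n \<noteq> 0 \<Longrightarrow> \<beta> = \<alpha> \<or> \<beta> = - \<alpha>"
    and simple_subset: "\<Delta> \<subseteq> R"
    and simple_independent: "int_module.independent \<Delta>"
    and simple_base:
      "\<alpha> \<in> R \<Longrightarrow> \<exists>f :: 'c \<Rightarrow> nat.
         \<alpha> = (\<Sum>\<beta>\<in>\<Delta>. zmul (int (f \<beta>)) \<beta>) \<or> \<alpha> = - (\<Sum>\<beta>\<in>\<Delta>. zmul (int (f \<beta>)) \<beta>)"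
begin

definition positive_roots :: "'c set" where
  "positive_roots = {\<alpha> \<in> R. \<exists>f :: 'c \<Rightarrow> nat. \<alpha> = (\<Sum>\<beta>\<in>\<Delta>. zmul (int (f \<beta>)) \<beta>)}"

end


section \<open>The extended affine Weyl group and admissible sets\<close>

text \<open>The real vector space \<open>V = X\<^sub>* \<otimes> \<real>\<close> is a type \<open>'v\<close> together with the canonical map
  \<open>\<iota> : X\<^sub>* \<rightarrow> V\<close>, an additive map that takes a \<open>\<int>\<close>-basis of \<open>X\<^sub>*\<close> to an \<open>\<real>\<close>-basis of \<open>V\<close>.
  The norm serves only to provide the usual topology of the finite-dimensional space \<open>V\<close>;
  unlike \<open>euclidean_space\<close>, the class allows \<open>V = 0\<close>.\<close>

locale affine_root_datum = based_reduced_root_datum pairing R coroot \<Delta>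
  for pairing :: "'c::ab_group_add \<Rightarrow> 'd::ab_group_add \<Rightarrow> int"
    and R :: "'c set"
    and coroot :: "'c \<Rightarrow> 'd"
    and \<Delta> :: "'c set" +
  fixes \<iota> :: "'d \<Rightarrow> 'v::real_normed_vector"
  assumes additive_\<iota>: "Modules.additive \<iota>"
    and extends_scalars:
      "\<exists>B. is_zbasis B \<and> inj_on \<iota> B \<and> independent (\<iota> ` B) \<and> span (\<iota> ` B) = UNIV"
begin

text \<open>The \<open>\<real>\<close>-linear extension of the pairing to \<open>V\<close>; the lemmas below show that it is well defined.\<close>

definition pairing_V :: "'c \<Rightarrow> 'v \<Rightarrow> real" where
  "pairing_V \<xi> = (THE f. linear f \<and> (\<forall>\<eta>. f (\<iota> \<eta>) = of_int (pairing \<xi> \<eta>)))"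

text \<open>Affine transformations of \<open>V\<close> are elements of the group of all bijections of \<open>V\<close>.  The
  semidirect product of \<open>X\<^sub>*\<close> with \<open>W\<close> acts faithfully on \<open>V\<close>; \<open>W_ext\<close> is its image.\<close>

abbreviation Bij_V :: "('v \<Rightarrow> 'v) monoid" where
  "Bij_V \<equiv> BijGroup UNIV"

definition translation :: "'v \<Rightarrow> 'v \<Rightarrow> 'v" where
  "translation v = (\<lambda>x. v + x)"

definition affine_reflection :: "'c \<Rightarrow> int \<Rightarrow> 'v \<Rightarrow> 'v" where
  "affine_reflection \<alpha> k = (\<lambda>x. x - (pairing_V \<alpha> x + of_int k) *\<^sub>R \<iota> (coroot \<alpha>))"

definition affine_hyperplane :: "'c \<Rightarrow> int \<Rightarrow> 'v set" where
  "affine_hyperplane \<alpha> k = {x. pairing_V \<alpha> x + of_int k = 0}"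

definition W :: "('v \<Rightarrow> 'v) set" where
  "W = generate Bij_V {affine_reflection \<alpha> 0 | \<alpha>. \<alpha> \<in> R}"

definition W_aff :: "('v \<Rightarrow> 'v) set" where
  "W_aff = generate Bij_V {affine_reflection \<alpha> k | \<alpha> k. \<alpha> \<in> R}"

definition W_ext :: "('v \<Rightarrow> 'v) set" where
  "W_ext = {translation (\<iota> \<eta>) \<circ> w | \<eta> w. w \<in> W}"

definition dominant_chamber :: "'v set" where
  "dominant_chamber = {x. \<forall>\<alpha>\<in>\<Delta>. 0 < pairing_V \<alpha> x}"

definition base_alcove :: "'v set" where
  "base_alcove = {x. \<forall>\<alpha>\<in>positive_roots. - 1 < pairing_V \<alpha> x \<and> pairing_V \<alpha> x < 0}"

text \<open>A wall of the base alcove is an affine root hyperplane spanned by the part of it that lies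
  in the closure of the alcove.\<close>

definition S_aff :: "('v \<Rightarrow> 'v) set" where
  "S_aff = {affine_reflection \<alpha> k | \<alpha> k. \<alpha> \<in> R \<and>
     affine hull (affine_hyperplane \<alpha> k \<inter> closure base_alcove) = affine_hyperplane \<alpha> k}"

definition \<Omega> :: "('v \<Rightarrow> 'v) set" where
  "\<Omega> = {w \<in> W_ext. w ` base_alcove = base_alcove}"

definition bruhat_ext :: "('v \<Rightarrow> 'v) \<Rightarrow> ('v \<Rightarrow> 'v) \<Rightarrow> bool" where
  "bruhat_ext x y \<longleftrightarrow>
     (\<exists>u\<in>W_aff. \<exists>u'\<in>W_aff. \<exists>\<tau>\<in>\<Omega>. \<exists>\<tau>'\<in>\<Omega>.
        x = u \<circ> \<tau> \<and> y = u' \<circ> \<tau>' \<and> \<tau> = \<tau>' \<and> bruhat_le Bij_V S_aff u u')"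

definition \<tau> :: "'d \<Rightarrow> 'v \<Rightarrow> 'v" where
  "\<tau> \<mu> = (THE \<sigma>. \<sigma> \<in> \<Omega> \<and> translation (\<iota> \<mu>) \<in> W_aff #>\<^bsub>Bij_V\<^esub> \<sigma>)"

definition Adm :: "'d \<Rightarrow> ('v \<Rightarrow> 'v) set" where
  "Adm \<mu> = {x \<in> W_aff #>\<^bsub>Bij_V\<^esub> \<tau> \<mu>.
     \<exists>w\<in>W. bruhat_ext x (translation (w (\<iota> \<mu>)))}"

definition Adm_J :: "('v \<Rightarrow> 'v) set \<Rightarrow> 'd \<Rightarrow> ('v \<Rightarrow> 'v) set" where
  "Adm_J J \<mu> = generate Bij_V J <#>\<^bsub>Bij_V\<^esub> Adm \<mu> <#>\<^bsub>Bij_V\<^esub> generate Bij_V J"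

lemma pairing_V_ex: "\<exists>f :: 'v \<Rightarrow> real. linear f \<and> (\<forall>\<eta>. f (\<iota> \<eta>) = of_int (pairing \<xi> \<eta>))"
proof -
  obtain B where B: "is_zbasis B" "inj_on \<iota> B" "independent (\<iota> ` B)"
    using extends_scalars by blast
  obtain f :: "'v \<Rightarrow> real" where f: "linear f"
      and fB: "\<forall>v\<in>\<iota> ` B. f v = of_int (pairing \<xi> (inv_into B \<iota> v))"
    using linear_independent_extend[OF B(3),
        of "\<lambda>v. real_of_int (pairing \<xi> (inv_into B \<iota> v))"] by blast
  have add_f: "f (x + y) = f x + f y" for x y by (rule linear_add[OF f])
  interpret i: Modules.additive \<iota> by (rule additive_\<iota>)
  interpret p: Modules.additive "pairing \<xi>" by (rule additive_right)
  define D where "D = {\<eta>. f (\<iota> \<eta>) = of_int (pairing \<xi> \<eta>)}"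
  have D0: "0 \<in> D" by (simp add: D_def i.zero p.zero linear_0[OF f])
  have Dadd: "x + y \<in> D" if "x \<in> D" "y \<in> D" for x y
    using that by (simp add: D_def i.add p.add add_f)
  have Dneg: "- x \<in> D" if "x \<in> D" for x
    using that by (simp add: D_def i.minus p.minus linear_neg[OF f])
  have Dpow: "(((+) x) ^^ n) 0 \<in> D" if "x \<in> D" for x n
    using that by (induction n) (auto intro: D0 Dadd)
  have Dz: "zmul k x \<in> D" if "x \<in> D" for k x
    unfolding zmul_def using Dadd[OF Dpow[OF that] Dneg[OF Dpow[OF that]]]
    by simp
  have "int_module.subspace D"
    by (rule int_module.subspaceI) (auto intro: D0 Dadd Dz)
  moreover have "B \<subseteq> D" using fB B(2) by (auto simp: D_def)
  ultimately have "int_module.span B \<subseteq> D" by (rule int_module.span_minimal[rotated])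
  then have "D = UNIV" using B(1) by (auto simp: is_zbasis_def)
  then show ?thesis using f by (auto simp: D_def)
qed

lemma pairing_V:
  shows "linear (pairing_V \<xi>)" and "pairing_V \<xi> (\<iota> \<eta>) = of_int (pairing \<xi> \<eta>)"
proof -
  obtain B where B: "span (\<iota> ` B) = UNIV"
    using extends_scalars by blast
  have uniq: "f = g"
    if "linear f \<and> (\<forall>\<eta>. f (\<iota> \<eta>) = of_int (pairing \<xi> \<eta>))"
      and "linear g \<and> (\<forall>\<eta>. g (\<iota> \<eta>) = of_int (pairing \<xi> \<eta>))" for f g :: "'v \<Rightarrow> real"
  proof
    fix x
    show "f x = g x"
      by (rule linear_eq_on_span[of f g "\<iota> ` B"]) (use that B in auto)
  qed
  have "\<exists>!f :: 'v \<Rightarrow> real. linear f \<and> (\<forall>\<eta>. f (\<iota> \<eta>) = of_int (pairing \<xi> \<eta>))"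
    using pairing_V_ex[of \<xi>] uniq by blast
  from theI'[OF this] show "linear (pairing_V \<xi>)"
    and "pairing_V \<xi> (\<iota> \<eta>) = of_int (pairing \<xi> \<eta>)"
    unfolding pairing_V_def by auto
qed

end

end

theory Submission
  imports Defs
begin

text \<open>
  Fix a base point \<open>p\<close> in the base alcove.  For a regular vector \<open>v\<close> let \<open>\<le>\<^sub>v\<close> be the order on the
  extended affine Weyl group generated by the relations \<open>x \<le>\<^sub>v s x\<close>, where \<open>s\<close> is the reflection in
  an affine root \<open>f = \<alpha> + k\<close> with \<open>\<alpha>(v) > 0 > f(x p)\<close>.  An element \<open>x\<close> lies in \<open>Adm(\<mu>)\<close> if and only
  if for every regular \<open>v\<close> there is a \<open>\<lambda> \<in> W\<mu>\<close> with \<open>x \<le>\<^sub>v t\<^sub>\<lambda>\<close>.  In one direction, this condition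
  passes to smaller elements in the Bruhat order.  In the other, choose \<open>v\<close> close to \<open>x p - p\<close>; a
  translation \<open>t\<^sub>\<eta>\<close> far in direction \<open>v\<close> turns \<open>x \<le>\<^sub>v t\<^sub>\<lambda>\<close> into the Bruhat relation
  \<open>t\<^sub>\<eta> x \<le> t\<^sub>\<eta> t\<^sub>\<lambda>\<close>, and \<open>t\<^sub>\<eta>\<close> can be cancelled because the length of \<open>t\<^sub>\<eta> x\<close> is the sum of
  the lengths of \<open>t\<^sub>\<eta>\<close> and \<open>x\<close>.

  Left multiplication by \<open>x\<close> carries \<open>\<le>\<^sub>v\<close> to \<open>\<le>\<^bsub>xv\<^esub>\<close> (with the linear part of \<open>x\<close> acting on \<open>v\<close>), so
  the criterion gives \<open>Adm(\<mu>) Adm(\<nu>) \<subseteq> Adm(\<mu> + \<nu>)\<close>.  The reverse inclusion holds because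
  \<open>x \<le> u u'\<close> implies that \<open>x\<close> is a product of elements below \<open>u\<close> and \<open>u'\<close>.  Finally, for \<open>x \<in> Adm(\<mu>)\<close> and a
  simple reflection \<open>s\<close>, one of \<open>x s\<close> and \<open>s x s\<close> lies in \<open>Adm(\<mu>)\<close>; hence
  \<open>Adm(\<mu>) W\<^sub>J \<subseteq> W\<^sub>J Adm(\<mu>)\<close>.
\<close>

text \<open>The Bruhat order is not compatible with multiplication, which blocks a direct proof that
  products of admissible elements are admissible. The orders attached to regular \<open>v\<close>
  repair this: the chamber of comparison is moved from \<open>p\<close> to infinity in direction
  \<open>- v\<close>, so translations preserve the order and a linear part merely changes
  \<open>v\<close>. The criterion has to range over all regular \<open>v\<close> because the
  hypothesis on the right factor is applied at a direction that depends on the left factor. For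
  fixed \<open>v\<close> the translations t_\<lambda> with \<lambda> in W\<mu> have a greatest one,
  t_{w\<mu>}, and \<open>w\<close> depends on \<open>v\<close> alone; hence the bounds for \<mu> and
  \<nu> multiply to t_{w(\<mu>+\<nu>)}, a translation from the correct orbit. Dominance of both
  cocharacters enters there. The combinatorics is done for the whole extended group at once. Roots
  are functions, so that sides of hyperplanes become signs, and the elements of length zero form the
  base case of the inductions instead of being split off beforehand.\<close>

unbundle no m_inv_syntax


section \<open>Groups of bijections\<close>

lemma carrier_BijGroup_UNIV [simp]: "carrier (BijGroup UNIV) = {f. bij f}"
  by (auto simp: BijGroup_def Bij_def extensional_def)

lemma one_BijGroup_UNIV [simp]: "\<one>\<^bsub>BijGroup UNIV\<^esub> = id"
  by (auto simp: BijGroup_def)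

lemma mult_BijGroup_UNIV: "bij f \<Longrightarrow> bij g \<Longrightarrow> f \<otimes>\<^bsub>BijGroup UNIV\<^esub> g = f \<circ> g"
  by (auto simp: BijGroup_def Bij_def extensional_def compose_def)

lemma inv_BijGroup_UNIV: "bij f \<Longrightarrow> m_inv (BijGroup UNIV) f = inv f"
  by (auto simp: inv_BijGroup Bij_def extensional_def)

lemma set_mult_BijGroup_UNIV:
  assumes "\<And>f. f \<in> A \<Longrightarrow> bij f" and "\<And>f. f \<in> B \<Longrightarrow> bij f"
  shows "A <#>\<^bsub>BijGroup UNIV\<^esub> B = {f \<circ> g | f g. f \<in> A \<and> g \<in> B}"
  using assms by (auto simp: set_mult_def mult_BijGroup_UNIV)

lemma r_coset_BijGroup_UNIV:
  assumes "\<And>f. f \<in> A \<Longrightarrow> bij f" and "bij g"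
  shows "A #>\<^bsub>BijGroup UNIV\<^esub> g = (\<lambda>f. f \<circ> g) ` A"
  using assms by (auto simp: r_coset_def mult_BijGroup_UNIV)

lemma bij_generate_BijGroup:
  assumes "\<And>f. f \<in> A \<Longrightarrow> bij f" and "f \<in> generate (BijGroup UNIV) A"
  shows "bij f"
  using group.generate_in_carrier[OF group_BijGroup _ assms(2)] assms(1) by auto

lemma generate_BijGroup_subset:
  assumes "\<And>f. f \<in> A \<Longrightarrow> bij f" and "id \<in> H"
    and "\<And>f. f \<in> A \<Longrightarrow> f \<in> H" and "\<And>f. f \<in> A \<Longrightarrow> inv f \<in> H"
    and "\<And>f g. f \<in> H \<Longrightarrow> g \<in> H \<Longrightarrow> f \<circ> g \<in> H"
  shows "generate (BijGroup UNIV) A \<subseteq> H"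
proof
  fix f assume "f \<in> generate (BijGroup UNIV) A"
  then have "f \<in> H \<and> bij f"
  proof (induction rule: generate.induct)
    case (inv h)
    then show ?case using assms(1,4) by (simp add: inv_BijGroup_UNIV bij_imp_bij_inv)
  qed (use assms in \<open>auto simp: mult_BijGroup_UNIV bij_comp simp del: comp_apply id_apply\<close>)
  then show "f \<in> H" by simp
qed

lemma generate_BijGroup_comp:
  assumes "\<And>f. f \<in> A \<Longrightarrow> bij f"
    and "f \<in> generate (BijGroup UNIV) A" and "g \<in> generate (BijGroup UNIV) A"
  shows "f \<circ> g \<in> generate (BijGroup UNIV) A"
  using generate.eng[OF assms(2,3)] bij_generate_BijGroup[OF assms(1)] assms(2,3)
  by (simp add: mult_BijGroup_UNIV)

lemma generate_BijGroup_inv: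
  assumes "\<And>f. f \<in> A \<Longrightarrow> bij f" and "f \<in> generate (BijGroup UNIV) A"
  shows "inv f \<in> generate (BijGroup UNIV) A"
  using group.generate_m_inv_closed[OF group_BijGroup _ assms(2)] assms(1)
    bij_generate_BijGroup[OF assms]
  by (auto simp: inv_BijGroup_UNIV)

definition compose_list :: "('a \<Rightarrow> 'a) list \<Rightarrow> 'a \<Rightarrow> 'a" where
  "compose_list fs = foldr (\<circ>) fs id"

lemma compose_list_simps [simp]:
  "compose_list [] = id"
  "compose_list (f # fs) = f \<circ> compose_list fs"
  by (simp_all add: compose_list_def)

lemma compose_list_append: "compose_list (xs @ ys) = compose_list xs \<circ> compose_list ys"
  by (induction xs) (auto simp: comp_assoc)

lemma bij_compose_list: "(\<And>f. f \<in> set fs \<Longrightarrow> bij f) \<Longrightarrow> bij (compose_list fs)"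
  by (induction fs) (auto intro!: bij_comp simp del: comp_apply id_apply)

lemma foldr_mult_BijGroup:
  "(\<And>f. f \<in> set fs \<Longrightarrow> bij f) \<Longrightarrow> foldr (mult (BijGroup UNIV)) fs id = compose_list fs"
  by (induction fs) (simp_all add: mult_BijGroup_UNIV bij_compose_list)


section \<open>Groups generated by reflections in walls\<close>

text \<open>A root is a real function on \<open>V\<close> whose zero set is a reflecting hyperplane and whose sign
  tells its two sides.  The chamber of \<open>x \<in> G\<close> is represented by the point \<open>x p\<close>, and \<open>S\<close>
  consists of the roots that define the walls of the chamber of \<open>p\<close> and are positive on it.\<close>

locale reflection_system =
  fixes G :: "('v \<Rightarrow> 'v) set"
    and \<Phi> :: "('v \<Rightarrow> real) set"
    and refl :: "('v \<Rightarrow> real) \<Rightarrow> 'v \<Rightarrow> 'v"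
    and S :: "('v \<Rightarrow> real) set"
    and p :: 'v
  assumes G_bij: "g \<in> G \<Longrightarrow> bij g"
    and G_id: "id \<in> G"
    and G_comp: "g \<in> G \<Longrightarrow> h \<in> G \<Longrightarrow> g \<circ> h \<in> G"
    and G_inv: "g \<in> G \<Longrightarrow> inv g \<in> G"
    and root_comp: "f \<in> \<Phi> \<Longrightarrow> g \<in> G \<Longrightarrow> f \<circ> g \<in> \<Phi>"
    and root_uminus: "f \<in> \<Phi> \<Longrightarrow> - f \<in> \<Phi>"
    and refl_G: "f \<in> \<Phi> \<Longrightarrow> refl f \<in> G"
    and refl_refl: "f \<in> \<Phi> \<Longrightarrow> refl f \<circ> refl f = id"
    and refl_uminus: "f \<in> \<Phi> \<Longrightarrow> refl (- f) = refl f"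
    and refl_flip: "f \<in> \<Phi> \<Longrightarrow> f (refl f x) = - f x"
    and refl_conj: "f \<in> \<Phi> \<Longrightarrow> g \<in> G \<Longrightarrow> g \<circ> refl (f \<circ> g) = refl f \<circ> g"
    and root_nonzero: "f \<in> \<Phi> \<Longrightarrow> f p \<noteq> 0"
    and finite_separating: "g \<in> G \<Longrightarrow> finite {f \<in> \<Phi>. 0 < f p \<and> f (g p) < 0}"
    and S_root: "f \<in> S \<Longrightarrow> f \<in> \<Phi>"
    and S_pos: "f \<in> S \<Longrightarrow> 0 < f p"
    and S_wall: "s \<in> S \<Longrightarrow> f \<in> \<Phi> \<Longrightarrow> f p * f (refl s p) < 0 \<Longrightarrow> f = s \<or> f = - s"
    and S_separating: "g \<in> G \<Longrightarrow> f \<in> \<Phi> \<Longrightarrow> 0 < f p \<Longrightarrow> f (g p) < 0 \<Longrightarrow> \<exists>s\<in>S. s (g p) < 0"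
begin

text \<open>The sign condition says that \<open>p\<close> and \<open>x p\<close> lie on the same
  side of the hyperplane of \<open>f\<close>, so that the reflection takes the chamber of
  \<open>x\<close> away from that of \<open>p\<close>. Reflections act from the left here, whereas
  \<open>bruhat_le\<close> multiplies on the right; \<open>bruhat_le_iff\<close> reconciles the
  two.\<close>

definition up :: "('v \<Rightarrow> 'v) \<Rightarrow> ('v \<Rightarrow> 'v) \<Rightarrow> bool" where
  "up x y \<longleftrightarrow> x \<in> G \<and> (\<exists>f\<in>\<Phi>. y = refl f \<circ> x \<and> 0 < f p * f (x p))"

definition le :: "('v \<Rightarrow> 'v) \<Rightarrow> ('v \<Rightarrow> 'v) \<Rightarrow> bool" where
  "le = up\<^sup>*\<^sup>*"

definition stab :: "('v \<Rightarrow> 'v) set" where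
  "stab = {g \<in> G. \<forall>f\<in>\<Phi>. 0 < f p \<longrightarrow> 0 < f (g p)}"

section \<open>Signs of roots on chambers, and descent through walls\<close>

lemma root_G_nonzero: "f \<in> \<Phi> \<Longrightarrow> g \<in> G \<Longrightarrow> f (g p) \<noteq> 0"
  using root_nonzero[OF root_comp] by simp

lemma refl_refl_apply: "f \<in> \<Phi> \<Longrightarrow> refl f (refl f x) = x"
  using refl_refl by (metis comp_apply id_apply)

lemma refl_refl_comp: "f \<in> \<Phi> \<Longrightarrow> refl f \<circ> (refl f \<circ> x) = x"
  by (rule ext) (simp add: refl_refl_apply)

lemma inv_refl: "f \<in> \<Phi> \<Longrightarrow> inv (refl f) = refl f"
  by (rule inv_equality) (simp_all add: refl_refl_apply)

lemma refl_comp_eq: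
  assumes "f \<in> \<Phi>" "g \<in> G"
  shows "refl f = g \<circ> refl (f \<circ> g) \<circ> inv g"
  using refl_conj[OF assms] G_bij[OF assms(2)]
  by (metis bij_is_surj comp_assoc comp_id surj_iff)

lemma stab_sign:
  assumes "g \<in> stab" "f \<in> \<Phi>"
  shows "0 < f (g p) \<longleftrightarrow> 0 < f p"
proof (cases "0 < f p")
  case True
  then show ?thesis using assms by (auto simp: stab_def)
next
  case False
  then have "0 < (- f) p" using root_nonzero[OF assms(2)] by simp
  then have "0 < (- f) (g p)" using assms(1) root_uminus[OF assms(2)] unfolding stab_def by blast
  then show ?thesis using False by simp
qed

lemma stab_mult_pos:
  assumes "g \<in> stab" "f \<in> \<Phi>" "h \<in> \<Phi>"
  shows "0 < f p * h (g p) \<longleftrightarrow> 0 < f p * h p"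
proof -
  have "g \<in> G" using assms(1) by (simp add: stab_def)
  then have "h (g p) \<noteq> 0" "h p \<noteq> 0" using root_nonzero root_G_nonzero assms(3) by auto
  then show ?thesis using stab_sign[OF assms(1,3)]
    by (auto simp: zero_less_mult_iff)
qed

lemma stab_comp_pos:
  assumes "g \<in> stab" "f \<in> \<Phi>" "x \<in> G"
  shows "0 < f p * f (x (g p)) \<longleftrightarrow> 0 < f p * f (x p)"
  using stab_mult_pos[OF assms(1,2) root_comp[OF assms(2,3)]] by simp

lemma wall_sign:
  assumes "s \<in> S" "f \<in> \<Phi>" "f \<noteq> s" "f \<noteq> - s"
  shows "0 < f p * f (refl s p)"
  using S_wall[OF assms(1,2)] assms root_G_nonzero[OF assms(2) refl_G[OF S_root[OF assms(1)]]]
    root_nonzero[OF assms(2)]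
  by (metis linorder_neqE_linordered_idom mult_eq_0_iff)

lemma wall_sign_cases:
  assumes "s \<in> S" "f \<in> \<Phi>"
  obtains "f = s" | "f = - s" | "0 < f p * f (refl s p)"
  using wall_sign assms by blast

text \<open>Apart from \<open>s\<close>, no root that is positive at \<open>p\<close> changes sign
  between \<open>p\<close> and \<open>refl s p\<close>. Hence composition with \<open>refl s\<close>
  injects the roots separating \<open>p\<close> from the reflected chamber into those separating
  \<open>p\<close> from \<open>g p\<close>, and it misses \<open>s\<close>.\<close>

lemma descent_decreases:
  assumes g: "g \<in> G" and s: "s \<in> S" "s (g p) < 0"
  shows "card {f \<in> \<Phi>. 0 < f p \<and> f ((refl s \<circ> g) p) < 0} < card {f \<in> \<Phi>. 0 < f p \<and> f (g p) < 0}"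
    (is "card ?A < card ?B")
proof -
  note sr = S_root[OF s(1)]
  have inj: "inj_on (\<lambda>f. f \<circ> refl s) ?A"
    by (rule inj_onI) (metis (no_types, lifting) comp_assoc comp_id refl_refl[OF sr])
  have sub: "(\<lambda>f. f \<circ> refl s) ` ?A \<subseteq> ?B - {s}"
  proof clarify
    fix f assume f: "f \<in> \<Phi>" "0 < f p" "f ((refl s \<circ> g) p) < 0"
    have fs: "f \<noteq> s" using f(3) s(2) refl_flip[OF sr] by auto
    have fms: "f \<noteq> - s" using f(2) S_pos[OF s(1)] by auto
    have "0 < f (refl s p)" using wall_sign[OF s(1) f(1) fs fms] f(2)
      by (simp add: zero_less_mult_iff)
    moreover have "f \<circ> refl s \<noteq> s"
    proof
      assume "f \<circ> refl s = s"
      then have "f = s \<circ> refl s" by (metis comp_assoc comp_id refl_refl[OF sr])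
      then have "f p = - s p" using refl_flip[OF sr] by simp
      then show False using f(2) S_pos[OF s(1)] by simp
    qed
    ultimately show "f \<circ> refl s \<in> ?B - {s}"
      using f root_comp[OF f(1) refl_G[OF sr]] by simp
  qed
  have fin: "finite ?B" by (rule finite_separating[OF g])
  have "card ?A \<le> card (?B - {s})"
    by (rule card_inj_on_le[OF inj sub]) (simp add: fin)
  also have "\<dots> < card ?B"
    by (rule card_Diff1_less[OF fin]) (use s sr S_pos in auto)
  finally show ?thesis .
qed

text \<open>Induction on the number of hyperplanes between \<open>p\<close> and \<open>g p\<close>,
  valid in all of \<open>G\<close>; when no wall separates the two points,
  \<open>S_separating\<close> puts \<open>g\<close> into \<open>stab\<close>.\<close>

lemma descent_induct [consumes 1, case_names stab simple]:
  assumes "g \<in> G"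
    and stab: "\<And>g. g \<in> stab \<Longrightarrow> P g"
    and simple: "\<And>s g. s \<in> S \<Longrightarrow> g \<in> G \<Longrightarrow> 0 < s (g p) \<Longrightarrow> P g \<Longrightarrow> P (refl s \<circ> g)"
  shows "P g"
  using assms(1)
proof (induction "card {f \<in> \<Phi>. 0 < f p \<and> f (g p) < 0}" arbitrary: g rule: less_induct)
  case less
  show ?case
  proof (cases "\<exists>s\<in>S. s (g p) < 0")
    case False
    then have "g \<in> stab"
      using S_separating less.prems root_G_nonzero[OF _ less.prems]
      unfolding stab_def mem_Collect_eq by (meson linorder_neqE_linordered_idom)
    then show ?thesis by (rule stab)
  next
    case True
    then obtain s where s: "s \<in> S" "s (g p) < 0" by blast
    note sr = S_root[OF s(1)]
    have sg: "refl s \<circ> g \<in> G" using G_comp refl_G sr less.prems by blast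
    have "P (refl s \<circ> (refl s \<circ> g))"
      by (rule simple[OF s(1) sg]) (use less.hyps[OF descent_decreases[OF less.prems s] sg] s
          refl_flip[OF sr] in auto)
    then show ?thesis by (simp add: refl_refl_comp[OF sr])
  qed
qed


subsection \<open>Words in the simple reflections\<close>

definition words :: "('v \<Rightarrow> 'v) set" where
  "words = {compose_list ss | ss. set ss \<subseteq> refl ` S}"

lemma simple_bij: "r \<in> refl ` S \<Longrightarrow> bij r"
  using G_bij refl_G S_root by blast

lemma word_G: "set ss \<subseteq> refl ` S \<Longrightarrow> compose_list ss \<in> G"
  by (induction ss) (auto simp: G_id intro: G_comp refl_G S_root simp del: comp_apply id_apply)

lemma words_G: "w \<in> words \<Longrightarrow> w \<in> G"
  by (auto simp: words_def word_G)

lemma words_comp: "v \<in> words \<Longrightarrow> w \<in> words \<Longrightarrow> v \<circ> w \<in> words"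
  unfolding words_def by clarify (metis (no_types, lifting) Un_least compose_list_append set_append)

lemma simple_words: "s \<in> S \<Longrightarrow> refl s \<in> words"
  by (auto simp: words_def intro!: exI[of _ "[refl s]"])

lemma id_words: "id \<in> words"
  by (auto simp: words_def intro!: exI[of _ "[]"])

lemma generate_simple: "generate (BijGroup UNIV) (refl ` S) = words"
proof
  show "generate (BijGroup UNIV) (refl ` S) \<subseteq> words"
    by (rule generate_BijGroup_subset)
      (use simple_bij simple_words id_words words_comp inv_refl S_root in auto)
  have "set ss \<subseteq> refl ` S \<Longrightarrow> compose_list ss \<in> generate (BijGroup UNIV) (refl ` S)" for ss
  proof (induction ss)
    case Nil
    show ?case using generate.one[of "BijGroup UNIV" "refl ` S"] by (simp del: id_apply)
  next
    case (Cons r ss)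
    then have "r \<in> generate (BijGroup UNIV) (refl ` S)"
      "compose_list ss \<in> generate (BijGroup UNIV) (refl ` S)"
      by (auto simp: subset_iff intro: generate.incl)
    from generate_BijGroup_comp[OF simple_bij this]
    show ?case by (simp del: comp_apply)
  qed
  then show "words \<subseteq> generate (BijGroup UNIV) (refl ` S)"
    by (auto simp: words_def)
qed

lemma words_inv: "w \<in> words \<Longrightarrow> inv w \<in> words"
  using generate_BijGroup_inv[of "refl ` S" w, OF simple_bij] by (simp add: generate_simple)

lemma refl_conj_simple:
  assumes "s \<in> S" "f \<in> \<Phi>"
  shows "refl f = refl s \<circ> refl (f \<circ> refl s) \<circ> refl s"
  using refl_comp_eq[OF assms(2) refl_G[OF S_root[OF assms(1)]]] inv_refl[OF S_root[OF assms(1)]]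
  by simp

lemma simple_transport_neg:
  assumes "s \<in> S" "f \<in> \<Phi>" "f \<noteq> s" "f \<noteq> - s" "f p * f (refl s x) < 0"
  shows "(f \<circ> refl s) p * (f \<circ> refl s) x < 0"
  using wall_sign[OF assms(1-4)] assms(5)
  by (auto simp: zero_less_mult_iff mult_less_0_iff)

text \<open>Deletion condition: a gallery whose ends lie on different sides of the hyperplane of
  \<open>f\<close> must cross it. Peeling off letters replaces \<open>f\<close> by
  \<open>f \<circ> refl s\<close>; the crossing is the letter whose wall root is the transported
  \<open>f\<close> up to sign, and this letter is dropped.\<close>

lemma deletion:
  assumes "set ss \<subseteq> refl ` S" "f \<in> \<Phi>" "f p * f (compose_list ss p) < 0"
  shows "\<exists>ss'. set ss' \<subseteq> refl ` S \<and> Suc (length ss') = length ss \<and>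
      compose_list ss' = refl f \<circ> compose_list ss"
  using assms
proof (induction ss arbitrary: f)
  case Nil
  then show ?case by (simp add: mult_less_0_iff)
next
  case (Cons r ss)
  then obtain s where s: "s \<in> S" "r = refl s" by auto
  note sr = S_root[OF s(1)]
  show ?case
  proof (cases "f = s \<or> f = - s")
    case True
    then have "refl f = refl s" using refl_uminus[OF sr] by auto
    then have "compose_list ss = refl f \<circ> compose_list (r # ss)"
      using refl_refl_comp[OF sr, of "compose_list ss"] s(2) by simp
    then show ?thesis using Cons.prems(1) by (intro exI[of _ ss]) (simp del: comp_apply)
  next
    case False
    let ?h = "f \<circ> refl s"
    have "f p * f (refl s (compose_list ss p)) < 0"
      using Cons.prems(3) s(2) by (simp del: id_apply)
    then have "?h p * ?h (compose_list ss p) < 0"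
      using simple_transport_neg[OF s(1) Cons.prems(2)] False by blast
    then obtain ss' where ss': "set ss' \<subseteq> refl ` S" "Suc (length ss') = length ss"
        "compose_list ss' = refl ?h \<circ> compose_list ss"
      using Cons.IH[OF _ root_comp[OF Cons.prems(2) refl_G[OF sr]]] Cons.prems(1)
      by (metis insert_subset list.simps(15))
    have "compose_list (r # ss') = refl f \<circ> compose_list (r # ss)"
      using ss'(3) refl_conj[OF Cons.prems(2) refl_G[OF sr]] s(2)
      by (simp flip: comp_assoc)
    then show ?thesis using ss' Cons.prems(1) by (intro exI[of _ "r # ss'"]) simp
  qed
qed

text \<open>The same walk along the gallery: the letter at the crossing is the required simple
  reflection, and the prefix before it is the conjugating word.\<close>

lemma separating_root_conj:
  assumes "set ss \<subseteq> refl ` S" "f \<in> \<Phi>" "f p * f (compose_list ss p) < 0"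
  shows "\<exists>w\<in>words. \<exists>s\<in>S. refl f = w \<circ> refl s \<circ> inv w"
  using assms
proof (induction ss arbitrary: f)
  case Nil
  then show ?case by (simp add: mult_less_0_iff)
next
  case (Cons r ss)
  then obtain s where s: "s \<in> S" "r = refl s" by auto
  note sr = S_root[OF s(1)]
  show ?case
  proof (cases "f = s \<or> f = - s")
    case True
    then have "refl f = refl s" using refl_uminus[OF sr] by auto
    then show ?thesis using s(1) id_words by (intro bexI[of _ id] bexI[of _ s]) (auto simp: inv_id)
  next
    case False
    let ?h = "f \<circ> refl s"
    have "f p * f (refl s (compose_list ss p)) < 0"
      using Cons.prems(3) s(2) by (simp del: id_apply)
    then have "?h p * ?h (compose_list ss p) < 0"
      using simple_transport_neg[OF s(1) Cons.prems(2)] False by blast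
    then obtain w s' where w: "w \<in> words" "s' \<in> S" "refl ?h = w \<circ> refl s' \<circ> inv w"
      using Cons.IH[OF _ root_comp[OF Cons.prems(2) refl_G[OF sr]]] Cons.prems(1)
      by (metis insert_subset list.simps(15))
    have "inv (refl s \<circ> w) = inv w \<circ> refl s"
      using o_inv_distrib[of "refl s" w] G_bij refl_G[OF sr] words_G[OF w(1)] inv_refl[OF sr] by simp
    then have "refl f = (refl s \<circ> w) \<circ> refl s' \<circ> inv (refl s \<circ> w)"
      using refl_conj_simple[OF s(1) Cons.prems(2)] w(3) by (simp add: comp_assoc)
    then show ?thesis using w words_comp simple_words[OF s(1)] by blast
  qed
qed

text \<open>Existence half of the semidirect decomposition: peeling off descents ends at an element
  of \<open>stab\<close>.\<close>

lemma word_stab_decomposition: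
  assumes "g \<in> G"
  obtains w \<sigma> where "w \<in> words" "\<sigma> \<in> stab" "g = w \<circ> \<sigma>"
  using assms
proof (induction arbitrary: thesis rule: descent_induct)
  case (stab g)
  show ?case by (rule stab(2)[OF id_words stab(1)]) simp
next
  case (simple s g)
  obtain w \<sigma> where "w \<in> words" "\<sigma> \<in> stab" "g = w \<circ> \<sigma>" by (rule simple(4))
  then show ?case
    using simple(5) words_comp simple_words[OF simple(1)] comp_assoc[of "refl s" w \<sigma>] by metis
qed

text \<open>The reflection of \<open>f\<close> itself moves \<open>p\<close> across the hyperplane
  of \<open>f\<close>. Writing it as a word times an element of \<open>stab\<close> produces a
  gallery that crosses this hyperplane.\<close>

lemma root_conj:
  assumes f: "f \<in> \<Phi>"
  shows "\<exists>w\<in>words. \<exists>s\<in>S. refl f = w \<circ> refl s \<circ> inv w"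
proof -
  obtain w \<sigma> where w: "w \<in> words" "\<sigma> \<in> stab" "refl f = w \<circ> \<sigma>"
    using word_stab_decomposition[OF refl_G[OF f]] by blast
  have "f p * f (refl f p) < 0" using root_nonzero[OF f] refl_flip[OF f]
    by (auto simp: neq_iff zero_less_mult_iff mult_less_0_iff)
  \<comment> \<open>The factor \<open>\<sigma>\<close> does not affect on which side of any
    hyperplane a chamber lies, so \<open>w\<close> alone already crosses.\<close>
  then have "\<not> 0 < f p * f (w p)"
    using stab_comp_pos[OF w(2) f words_G[OF w(1)]] w(3) by simp
  then have "f p * f (w p) < 0"
    using root_nonzero[OF f] root_G_nonzero[OF f words_G[OF w(1)]]
    by (metis linorder_neqE_linordered_idom mult_eq_0_iff)
  then show ?thesis using separating_root_conj[OF _ f] w(1) by (auto simp: words_def)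
qed

lemma refl_words: "f \<in> \<Phi> \<Longrightarrow> refl f \<in> words"
  using root_conj words_comp words_inv simple_words by (metis (no_types, lifting))

lemma generate_refl: "generate (BijGroup UNIV) (refl ` \<Phi>) = words"
proof
  show "generate (BijGroup UNIV) (refl ` \<Phi>) \<subseteq> words"
    by (rule generate_BijGroup_subset)
      (use G_bij refl_G id_words refl_words inv_refl words_comp in auto)
  show "words \<subseteq> generate (BijGroup UNIV) (refl ` \<Phi>)"
    unfolding generate_simple[symmetric]
    by (rule group.mono_generate[OF group_BijGroup]) (use S_root in auto)
qed

section \<open>Length and its behaviour under reflections\<close>

abbreviation len :: "('v \<Rightarrow> 'v) \<Rightarrow> nat" where
  "len \<equiv> word_length (BijGroup UNIV) (refl ` S)"

lemma len_eq: "len w = (LEAST n. \<exists>ss. set ss \<subseteq> refl ` S \<and> length ss = n \<and> compose_list ss = w)"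
proof -
  have "foldr (mult (BijGroup UNIV)) ss id = compose_list ss" if "set ss \<subseteq> refl ` S" for ss
    using foldr_mult_BijGroup simple_bij that by blast
  then show ?thesis unfolding word_length_def one_BijGroup_UNIV by (metis (no_types, lifting))
qed

lemma reduced_word:
  assumes "w \<in> words"
  obtains ss where "set ss \<subseteq> refl ` S" "length ss = len w" "compose_list ss = w"
  using assms LeastI_ex[of "\<lambda>n. \<exists>ss. set ss \<subseteq> refl ` S \<and> length ss = n \<and> compose_list ss = w"]
  unfolding len_eq[symmetric] words_def by blast

lemma len_le: "set ss \<subseteq> refl ` S \<Longrightarrow> len (compose_list ss) \<le> length ss"
  unfolding len_eq by (rule Least_le) blast

lemma len_refl_less:
  assumes "w \<in> words" "f \<in> \<Phi>" "f p * f (w p) < 0"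
  shows "len (refl f \<circ> w) < len w"
proof -
  obtain ss where ss: "set ss \<subseteq> refl ` S" "length ss = len w" "compose_list ss = w"
    using reduced_word[OF assms(1)] .
  obtain ss' where "set ss' \<subseteq> refl ` S" "Suc (length ss') = length ss"
      "compose_list ss' = refl f \<circ> w"
    using deletion[OF ss(1) assms(2)] ss(3) assms(3) by auto
  then show ?thesis using len_le[of ss'] ss(2) by simp
qed

lemma len_less_refl:
  assumes "w \<in> words" "f \<in> \<Phi>" "0 < f p * f (w p)"
  shows "len w < len (refl f \<circ> w)"
proof -
  have "f p * f ((refl f \<circ> w) p) < 0" using assms(3) refl_flip[OF assms(2)] by simp
  from len_refl_less[OF words_comp[OF refl_words[OF assms(2)] assms(1)] assms(2) this]
  show ?thesis by (simp only: refl_refl_comp[OF assms(2)])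
qed

text \<open>Simple transitivity on chambers. If a reduced word begins with \<open>refl s\<close> and
  its product fixes the chamber of \<open>p\<close>, then the remaining word has its chamber on the
  negative side of \<open>s\<close>, so prepending \<open>refl s\<close> should have shortened
  it.\<close>

lemma words_stab_id:
  assumes "w \<in> words" "w \<in> stab"
  shows "w = id"
proof -
  obtain ss where ss: "set ss \<subseteq> refl ` S" "length ss = len w" "compose_list ss = w"
    using reduced_word[OF assms(1)] .
  show ?thesis
  proof (cases ss)
    case Nil
    then show ?thesis using ss by simp
  next
    case (Cons r ss')
    then obtain s where s: "s \<in> S" "r = refl s" using ss(1) by auto
    note sr = S_root[OF s(1)]
    let ?w = "compose_list ss'"
    have w: "w = refl s \<circ> ?w" using ss(3) Cons s(2) by simp
    have ww: "?w \<in> words" using ss(1) Cons by (auto simp: words_def)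
    have "0 < s (w p)" using stab_sign[OF assms(2) sr] S_pos[OF s(1)] by simp
    then have "s p * s (?w p) < 0" using w refl_flip[OF sr] S_pos[OF s(1)]
      by (simp add: mult_less_0_iff)
    from len_refl_less[OF ww sr this] have "len w < len ?w" unfolding w .
    also have "len ?w \<le> length ss'" using len_le ss(1) Cons by simp
    finally show ?thesis using ss(2) Cons by simp
  qed
qed

section \<open>The stabilizer of the chamber and uniqueness of the decomposition\<close>

lemma stab_inv:
  assumes "\<sigma> \<in> stab"
  shows "inv \<sigma> \<in> stab"
proof -
  have G: "\<sigma> \<in> G" using assms by (simp add: stab_def)
  have "0 < f (inv \<sigma> p)" if "f \<in> \<Phi>" "0 < f p" for f
    using stab_sign[OF assms root_comp[OF that(1) G_inv[OF G]]] that(2)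
      inv_f_f[OF bij_is_inj[OF G_bij[OF G]]] by simp
  then show ?thesis using G_inv[OF G] by (auto simp: stab_def)
qed

lemma stab_comp:
  assumes "\<sigma> \<in> stab" "\<rho> \<in> stab"
  shows "\<sigma> \<circ> \<rho> \<in> stab"
proof -
  have G: "\<sigma> \<in> G" "\<rho> \<in> G" using assms by (auto simp: stab_def)
  have "0 < f (\<sigma> (\<rho> p))" if "f \<in> \<Phi>" "0 < f p" for f
    using stab_sign[OF assms(2) root_comp[OF that(1) G(1)]] stab_sign[OF assms(1) that(1)] that(2)
    by simp
  then show ?thesis using G_comp[OF G] by (auto simp: stab_def)
qed

lemma decomposition_unique:
  assumes "v \<in> words" "w \<in> words" "\<sigma> \<in> stab" "\<rho> \<in> stab" "v \<circ> \<sigma> = w \<circ> \<rho>"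
  shows "\<sigma> = \<rho>"
proof -
  have bij: "bij v" "bij w" "bij \<sigma>" "bij \<rho>"
    using assms words_G G_bij by (auto simp: stab_def)
  have "inv w \<circ> v = inv w \<circ> (v \<circ> \<sigma>) \<circ> inv \<sigma>"
    using bij(3) by (simp add: comp_assoc bij_is_surj surj_iff[THEN iffD1])
  also have "\<dots> = \<rho> \<circ> inv \<sigma>"
    unfolding assms(5) using inv_o_cancel[OF bij_is_inj[OF bij(2)]]
    by (simp flip: comp_assoc)
  finally have e: "inv w \<circ> v = \<rho> \<circ> inv \<sigma>" .
  have "inv w \<circ> v = id"
  proof (rule words_stab_id)
    show "inv w \<circ> v \<in> words" using assms words_comp words_inv by blast
    show "inv w \<circ> v \<in> stab" unfolding e using assms stab_comp stab_inv by blast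
  qed
  then have "\<rho> \<circ> inv \<sigma> \<circ> \<sigma> = \<sigma>" using e by simp
  then show ?thesis using inv_o_cancel[OF bij_is_inj[OF bij(3)]] by (simp add: comp_assoc)
qed


subsection \<open>The Bruhat order\<close>

lemma up_G: "up x y \<Longrightarrow> x \<in> G \<and> y \<in> G"
  by (auto simp: up_def intro: G_comp refl_G)

lemma le_refl [simp]: "le x x"
  by (simp add: le_def)

lemma le_trans: "le x y \<Longrightarrow> le y z \<Longrightarrow> le x z"
  by (simp add: le_def)

lemma up_le: "up x y \<Longrightarrow> le x y"
  by (auto simp: le_def)

lemma le_words:
  assumes "le x y"
  shows "\<exists>w\<in>words. y = w \<circ> x"
  using assms unfolding le_def
proof (induction rule: rtranclp_induct)
  case base
  show ?case by (rule bexI[OF _ id_words]) simp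
next
  case (step y z)
  then obtain w f where "w \<in> words" "y = w \<circ> x" "f \<in> \<Phi>" "z = refl f \<circ> y"
    unfolding up_def by blast
  then have "z = (refl f \<circ> w) \<circ> x" "refl f \<circ> w \<in> words"
    by (auto simp: comp_assoc intro!: words_comp refl_words)
  then show ?case by blast
qed

lemma le_G: "le x y \<Longrightarrow> x \<in> G \<longleftrightarrow> y \<in> G"
  unfolding le_def by (induction rule: rtranclp_induct) (auto dest: up_G)

text \<open>For a root other than \<open>s\<close> and \<open>- s\<close>, composition with
  \<open>refl s\<close> keeps the sign at \<open>p\<close>, so the conjugated reflection is again an
  upward step. The two exceptional roots give the first alternative.\<close>

lemma up_simple_left:
  assumes "up x y" "s \<in> S"
  shows "y = refl s \<circ> x \<or> up (refl s \<circ> x) (refl s \<circ> y)"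
proof -
  note sr = S_root[OF assms(2)]
  obtain f where f: "x \<in> G" "f \<in> \<Phi>" "y = refl f \<circ> x" "0 < f p * f (x p)"
    using assms(1) by (auto simp: up_def)
  show ?thesis
  proof (cases "f = s \<or> f = - s")
    case True
    then show ?thesis using f(3) refl_uminus[OF sr] by auto
  next
    case False
    let ?h = "f \<circ> refl s"
    have "0 < f p * f (refl s p)" using wall_sign[OF assms(2) f(2)] False by simp
    then have "0 < ?h p * ?h ((refl s \<circ> x) p)" using f(4)
      by (auto simp: zero_less_mult_iff refl_refl_apply[OF sr])
    moreover have "refl s \<circ> y = refl ?h \<circ> (refl s \<circ> x)"
    proof -
      have "refl s \<circ> refl f = refl ?h \<circ> refl s"
        using refl_conj_simple[OF assms(2) f(2)] refl_refl[OF sr]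
        by (metis comp_assoc comp_id id_comp)
      then show ?thesis using f(3) by (simp flip: comp_assoc)
    qed
    ultimately show ?thesis
      using f root_comp[OF f(2) refl_G[OF sr]] G_comp[OF refl_G[OF sr] f(1)]
      unfolding up_def by blast
  qed
qed

text \<open>As on the left, but the root to be compared with \<open>s\<close> is
  \<open>f \<circ> x\<close>: multiplication by \<open>refl s\<close> on the right crosses a wall of
  the chamber of \<open>x\<close>.\<close>

lemma up_simple_right:
  assumes "up x y" "s \<in> S"
  shows "y = x \<circ> refl s \<or> up (x \<circ> refl s) (y \<circ> refl s)"
proof -
  note sr = S_root[OF assms(2)]
  obtain f where f: "x \<in> G" "f \<in> \<Phi>" "y = refl f \<circ> x" "0 < f p * f (x p)"
    using assms(1) by (auto simp: up_def)
  note fx = root_comp[OF f(2,1)]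
  show ?thesis
  proof (cases "f \<circ> x = s \<or> f \<circ> x = - s")
    case True
    then have "refl (f \<circ> x) = refl s" using refl_uminus[OF sr] by auto
    then show ?thesis using f(3) refl_conj[OF f(2,1)] by simp
  next
    case False
    then have "0 < (f \<circ> x) p * (f \<circ> x) (refl s p)" using wall_sign[OF assms(2) fx] by simp
    then have "0 < f p * f ((x \<circ> refl s) p)" using f(4) by (auto simp: zero_less_mult_iff)
    then show ?thesis
      using f G_comp[OF f(1) refl_G[OF sr]] unfolding up_def by (auto simp: comp_assoc)
  qed
qed

text \<open>Lifting property in a form free of descents: multiply the chain by \<open>refl s\<close>
  from its beginning, until the first step that is itself multiplication by \<open>refl s\<close>;
  there the new chain joins the old one.\<close>

lemma le_simple_left:
  assumes "le x y" "s \<in> S"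
  shows "le (refl s \<circ> x) y \<or> le (refl s \<circ> x) (refl s \<circ> y)"
  using assms(1) unfolding le_def
proof (induction rule: converse_rtranclp_induct)
  case base
  show ?case by simp
next
  case (step x z)
  then show ?case using up_simple_left[OF step(1) assms(2)]
    by (metis converse_rtranclp_into_rtranclp)
qed

lemma le_simple_left':
  assumes "le x y" "s \<in> S"
  shows "le x (refl s \<circ> y) \<or> le (refl s \<circ> x) (refl s \<circ> y)"
  using assms(1) unfolding le_def
proof (induction rule: rtranclp_induct)
  case base
  show ?case by simp
next
  case (step z y)
  then show ?case using up_simple_left[OF step(2) assms(2)] refl_refl_comp[OF S_root[OF assms(2)]]
    by (metis rtranclp.rtrancl_into_rtrancl)
qed

lemma le_simple_right:
  assumes "le x y" "s \<in> S"
  shows "le (x \<circ> refl s) y \<or> le (x \<circ> refl s) (y \<circ> refl s)"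
  using assms(1) unfolding le_def
proof (induction rule: converse_rtranclp_induct)
  case base
  show ?case by simp
next
  case (step x z)
  then show ?case using up_simple_right[OF step(1) assms(2)]
    by (metis converse_rtranclp_into_rtranclp)
qed

lemma simple_cancel:
  assumes "s \<in> S" "x \<in> G" "y \<in> G" "0 < s (x p)" "le (refl s \<circ> x) (refl s \<circ> y)"
  shows "le x y"
proof -
  note sr = S_root[OF assms(1)]
  have "up x (refl s \<circ> x)"
    using assms(1,2,4) sr S_pos[OF assms(1)] unfolding up_def by auto
  then have "le x (refl s \<circ> x)" by (rule up_le)
  moreover have "le (refl s \<circ> x) y \<or> le x y"
    using le_simple_left'[OF assms(5,1)] by (simp add: refl_refl_comp[OF sr])
  ultimately show ?thesis using le_trans by blast
qed

section \<open>Factorization and cancellation in the order\<close>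

lemma stab_left_up:
  assumes "\<sigma> \<in> stab" "up x y"
  shows "up (\<sigma> \<circ> x) (\<sigma> \<circ> y)"
proof -
  have G: "\<sigma> \<in> G" using assms by (simp add: stab_def)
  have bij: "bij \<sigma>" using G_bij[OF G] .
  obtain f where f: "x \<in> G" "f \<in> \<Phi>" "y = refl f \<circ> x" "0 < f p * f (x p)"
    using assms(2) by (auto simp: up_def)
  let ?h = "f \<circ> inv \<sigma>"
  have h: "?h \<in> \<Phi>" using root_comp[OF f(2) G_inv[OF G]] .
  have hs: "?h \<circ> \<sigma> = f" using bij by (simp add: comp_assoc bij_is_inj)
  have "0 < ?h p * ?h ((\<sigma> \<circ> x) p)"
    using f(4) stab_sign[OF assms(1) h] root_nonzero[OF h] hs bij
    by (auto simp: zero_less_mult_iff bij_is_inj) 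
  moreover have "\<sigma> \<circ> y = refl ?h \<circ> (\<sigma> \<circ> x)"
    using refl_conj[OF h G] hs f(3) by (simp flip: comp_assoc)
  ultimately show ?thesis using h G_comp[OF G f(1)] unfolding up_def by blast
qed

lemma stab_left_le:
  assumes "\<sigma> \<in> stab" "le x y"
  shows "le (\<sigma> \<circ> x) (\<sigma> \<circ> y)"
  using assms(2) unfolding le_def
proof (induction rule: rtranclp_induct)
  case (step y z)
  then show ?case using stab_left_up[OF assms(1)] by (metis rtranclp.rtrancl_into_rtrancl)
qed (rule rtranclp.rtrancl_refl)

lemma stab_cancel:
  assumes "\<sigma> \<in> stab" "le (\<sigma> \<circ> x) (\<sigma> \<circ> y)"
  shows "le x y"
proof -
  have "bij \<sigma>" using assms G_bij by (simp add: stab_def)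
  then show ?thesis using stab_left_le[OF stab_inv[OF assms(1)] assms(2)]
    by (simp flip: comp_assoc add: bij_is_inj)
qed

text \<open>Induction on \<open>u\<close>. When \<open>u\<close> is replaced by
  \<open>refl s \<circ> u\<close>, the lifting property puts \<open>x\<close> or
  \<open>refl s \<circ> x\<close> below the old product; in the second case the letter is put back
  in front of the first factor, and \<open>le_simple_left\<close> keeps that factor below
  \<open>refl s \<circ> u\<close>.\<close>

lemma le_comp_factor:
  assumes "u \<in> G" "le x (u \<circ> v)"
  shows "\<exists>u' v'. le u' u \<and> le v' v \<and> x = u' \<circ> v'"
  using assms
proof (induction arbitrary: x rule: descent_induct)
  case (stab u)
  have bij: "bij u" using stab(1) G_bij by (simp add: stab_def)
  then have x: "x = u \<circ> (inv u \<circ> x)" by (simp flip: comp_assoc add: bij_is_surj surj_iff[THEN iffD1])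
  then have "le (inv u \<circ> x) v" using stab_cancel[OF stab(1)] stab(2) by metis
  then show ?case using x le_refl by blast
next
  case (simple s u)
  note sr = S_root[OF simple(1)]
  have "up u (refl s \<circ> u)"
    using simple(2,3) sr S_pos[OF simple(1)] unfolding up_def by auto
  then have up: "le u (refl s \<circ> u)" by (rule up_le)
  have "le x (u \<circ> v) \<or> le (refl s \<circ> x) (u \<circ> v)"
  proof -
    have "refl s \<circ> (refl s \<circ> u \<circ> v) = u \<circ> v"
      using refl_refl_comp[OF sr, of "u \<circ> v"] by (simp only: comp_assoc)
    then show ?thesis using le_simple_left'[OF simple(5,1)] by metis
  qed
  then show ?case
  proof
    assume "le x (u \<circ> v)"
    then show ?thesis using simple(4) up le_trans by blast
  next
    assume "le (refl s \<circ> x) (u \<circ> v)"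
    then obtain u' v' where u': "le u' u" "le v' v" "refl s \<circ> x = u' \<circ> v'" using simple(4) by blast
    then have "x = (refl s \<circ> u') \<circ> v'" using refl_refl_comp[OF sr, of x] by (simp add: comp_assoc)
    moreover have "le (refl s \<circ> u') (refl s \<circ> u)"
      using le_simple_left[OF u'(1) simple(1)] up le_trans by blast
    ultimately show ?thesis using u'(2) by blast
  qed
qed

text \<open>The last hypothesis says that the length of \<open>g \<circ> x\<close> is the sum of those of \<open>g\<close> and \<open>x\<close>.\<close>

lemma le_cancel:
  assumes "g \<in> G" "x \<in> G" "y \<in> G" "le (g \<circ> x) (g \<circ> y)"
    and "\<And>f. f \<in> \<Phi> \<Longrightarrow> 0 < f p \<Longrightarrow> f (x p) < 0 \<Longrightarrow> 0 < f (inv g p)"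
  shows "le x y"
  using assms(1,4,5)
proof (induction rule: descent_induct)
  case (stab g)
  then show ?case using stab_cancel by blast
next
  case (simple s g)
  note sr = S_root[OF simple(1)] and gG = simple(2)
  have bg: "bij g" by (rule G_bij[OF gG])
  have igp: "h (g (inv g q)) = h q" for h :: "'v \<Rightarrow> real" and q
    using bg by (simp add: bij_is_surj surj_f_inv_f)
  have isg: "inv (refl s \<circ> g) q = inv g (refl s q)" for q
    using o_inv_distrib[OF bg, of "refl s"] o_inv_distrib[of "refl s" g] G_bij[OF refl_G[OF sr]] bg inv_refl[OF sr]
    by simp
  \<comment> \<open>Otherwise \<open>s \<circ> g\<close> would be positive at \<open>p\<close> and
    negative at \<open>x p\<close>, hence by assumption positive at
    \<open>inv (refl s \<circ> g) p\<close>; but its value there is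
    \<open>s (refl s p) = - s p\<close>.\<close>
  have gx: "0 < s (g (x p))"
  proof (rule ccontr)
    assume "\<not> 0 < s (g (x p))"
    then have "s (g (x p)) < 0" using root_G_nonzero[OF sr G_comp[OF gG assms(2)]] by simp
    then have "(s \<circ> g) (x p) < 0" by simp
    moreover have "0 < (s \<circ> g) p" using simple(3) by simp
    ultimately have "0 < (s \<circ> g) (inv (refl s \<circ> g) p)"
      using simple(6)[OF root_comp[OF sr gG]] by blast
    then show False using isg igp[of s] refl_flip[OF sr] S_pos[OF simple(1)]
      by (simp add: isg igp[of s])
  qed
  have "le (refl s \<circ> (g \<circ> x)) (refl s \<circ> (g \<circ> y))"
    using simple(5) by (simp only: comp_assoc)
  then have "le (g \<circ> x) (g \<circ> y)"
    by (rule simple_cancel[OF simple(1) G_comp[OF gG assms(2)] G_comp[OF gG assms(3)], rotated])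
      (simp add: gx)
  then show ?case
  proof (rule simple(4))
    fix f assume f: "f \<in> \<Phi>" "0 < f p" "f (x p) < 0"
    have "0 < f (inv (refl s \<circ> g) p)" by (rule simple(6)[OF f])
    then have pos: "0 < f (inv g (refl s p))" by (simp only: isg)
    \<comment> \<open>The sign condition passes from \<open>refl s \<circ> g\<close> to
      \<open>g\<close>: between \<open>refl s p\<close> and \<open>p\<close> only \<open>s\<close>
      and \<open>- s\<close> change sign, and \<open>f \<circ> inv g = - s\<close> would give
      \<open>f p = - s (g p) < 0\<close>.\<close>
    show "0 < f (inv g p)"
    proof (rule ccontr)
      assume n: "\<not> 0 < f (inv g p)"
      let ?h = "f \<circ> inv g"
      have h: "?h \<in> \<Phi>" using root_comp[OF f(1) G_inv[OF gG]] .
      have "\<not> 0 < ?h p * ?h (refl s p)" using n pos by (simp add: zero_less_mult_iff)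
      then have "?h = s \<or> ?h = - s" using wall_sign_cases[OF simple(1) h] by metis
      then have "?h = - s" using n S_pos[OF simple(1)] by auto
      then have "?h (g p) = - s (g p)" by simp
      then have "f p = - s (g p)" using bg by (simp add: bij_is_inj)
      then show False using f(2) simple(3) by simp
    qed
  qed
qed

text \<open>A right factor \<open>t\<close> becomes the left factor \<open>u t u^-1\<close>, again
  the reflection of a root. By the deletion condition, multiplying by it increases the length
  exactly when its hyperplane does not separate \<open>p\<close> from \<open>u p\<close>.\<close>

lemma bruhat_le_iff:
  assumes "u \<in> words"
  shows "bruhat_le (BijGroup UNIV) (refl ` S) u v \<longleftrightarrow> le u v"
proof -
  have step: "(u \<in> generate (BijGroup UNIV) (refl ` S) \<and>
      (\<exists>t \<in> coxeter_reflections (BijGroup UNIV) (refl ` S). v = u \<otimes>\<^bsub>BijGroup UNIV\<^esub> t) \<and>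
      len u < len v) \<longleftrightarrow> u \<in> words \<and> up u v" for u v
  proof (cases "u \<in> words")
    case False
    then show ?thesis by (simp add: generate_simple)
  next
    case u: True
    note uG = words_G[OF u]
    note ub = G_bij[OF uG]
    have cox: "coxeter_reflections (BijGroup UNIV) (refl ` S) = refl ` \<Phi>"
    proof -
      have e: "w \<otimes>\<^bsub>BijGroup UNIV\<^esub> refl s \<otimes>\<^bsub>BijGroup UNIV\<^esub> m_inv (BijGroup UNIV) w = w \<circ> refl s \<circ> inv w"
        if "w \<in> words" "s \<in> S" for w s
        using G_bij[OF words_G[OF that(1)]] simple_bij that(2)
        by (simp add: mult_BijGroup_UNIV inv_BijGroup_UNIV bij_comp bij_imp_bij_inv)
      have "w \<circ> refl s \<circ> inv w \<in> refl ` \<Phi>" if w: "w \<in> words" and s: "s \<in> S" for w s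
      proof -
        note wG = words_G[OF w]
        have h: "s \<circ> inv w \<in> \<Phi>" using root_comp[OF S_root[OF s] G_inv[OF wG]] .
        have "s \<circ> inv w \<circ> w = s" using G_bij[OF wG] by (simp add: comp_assoc bij_is_inj)
        then have "refl (s \<circ> inv w) = w \<circ> refl s \<circ> inv w"
          using refl_comp_eq[OF h wG] by simp
        then show ?thesis using h by (metis image_eqI)
      qed
      moreover have "coxeter_reflections (BijGroup UNIV) (refl ` S) =
          {w \<circ> refl s \<circ> inv w | w s. w \<in> words \<and> s \<in> S}"
        unfolding coxeter_reflections_def generate_simple using e by (force intro!: Collect_cong)
      ultimately show ?thesis using root_conj by fastforce
    qed
    show ?thesis
    proof
      assume a: "u \<in> generate (BijGroup UNIV) (refl ` S) \<and>
        (\<exists>t \<in> coxeter_reflections (BijGroup UNIV) (refl ` S). v = u \<otimes>\<^bsub>BijGroup UNIV\<^esub> t) \<and> len u < len v"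
      then obtain f where f: "f \<in> \<Phi>" "v = u \<circ> refl f"
        using cox ub G_bij refl_G by (auto simp: mult_BijGroup_UNIV)
      let ?h = "f \<circ> inv u"
      have h: "?h \<in> \<Phi>" using root_comp[OF f(1) G_inv[OF uG]] .
      have "?h \<circ> u = f" using ub by (simp add: comp_assoc bij_is_inj)
      then have v: "v = refl ?h \<circ> u" using refl_conj[OF h uG] f(2) by simp
      have "\<not> ?h p * ?h (u p) < 0" using len_refl_less[OF u h] a v by auto
      then have "0 < ?h p * ?h (u p)"
        using root_nonzero[OF h] root_G_nonzero[OF h uG]
        by (metis linorder_neqE_linordered_idom mult_eq_0_iff)
      then show "u \<in> words \<and> up u v" using u uG h v unfolding up_def by blast
    next
      assume "u \<in> words \<and> up u v"
      then obtain f where f: "f \<in> \<Phi>" "v = refl f \<circ> u" "0 < f p * f (u p)"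
        by (auto simp: up_def)
      have fu: "f \<circ> u \<in> \<Phi>" using root_comp[OF f(1) uG] .
      have "v = u \<otimes>\<^bsub>BijGroup UNIV\<^esub> refl (f \<circ> u)"
        using f(2) refl_conj[OF f(1) uG] ub G_bij[OF refl_G[OF fu]]
        by (simp add: mult_BijGroup_UNIV)
      then show "u \<in> generate (BijGroup UNIV) (refl ` S) \<and>
        (\<exists>t \<in> coxeter_reflections (BijGroup UNIV) (refl ` S). v = u \<otimes>\<^bsub>BijGroup UNIV\<^esub> t) \<and> len u < len v"
        using u fu cox len_less_refl[OF u f(1,3)] f(2) by (auto simp: generate_simple)
    qed
  qed
  have "(\<lambda>u v. u \<in> words \<and> up u v)\<^sup>*\<^sup>* u v \<longleftrightarrow> le u v"
  proof
    show "(\<lambda>u v. u \<in> words \<and> up u v)\<^sup>*\<^sup>* u v \<Longrightarrow> le u v"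
      unfolding le_def by (rule rtranclp_mono[THEN predicate2D, rotated]) auto
    assume "le u v"
    then have "(\<lambda>u v. u \<in> words \<and> up u v)\<^sup>*\<^sup>* u v \<and> v \<in> words" unfolding le_def
    proof (induction rule: rtranclp_induct)
      case (step y z)
      then have "z \<in> words" by (auto simp: up_def intro: words_comp refl_words)
      then show ?case using step by (auto intro: rtranclp.rtrancl_into_rtrancl)
    qed (simp add: assms)
    then show "(\<lambda>u v. u \<in> words \<and> up u v)\<^sup>*\<^sup>* u v" by simp
  qed
  then show ?thesis unfolding bruhat_le_def step .
qed

section \<open>The order on the extended group\<close>

lemma up_stab_right:
  assumes "\<sigma> \<in> stab"
  shows "up x y \<Longrightarrow> up (x \<circ> \<sigma>) (y \<circ> \<sigma>)"
proof -
  assume "up x y"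
  then obtain f where f: "x \<in> G" "f \<in> \<Phi>" "y = refl f \<circ> x" "0 < f p * f (x p)"
    by (auto simp: up_def)
  have "\<sigma> \<in> G" using assms by (simp add: stab_def)
  then show ?thesis
    using f stab_comp_pos[OF assms f(2,1)] G_comp[OF f(1)] unfolding up_def by (auto simp: comp_assoc)
qed

lemma le_stab_right:
  assumes "\<sigma> \<in> stab" "le x y"
  shows "le (x \<circ> \<sigma>) (y \<circ> \<sigma>)"
  using assms(2) unfolding le_def
proof (induction rule: rtranclp_induct)
  case (step y z)
  then show ?case using up_stab_right[OF assms(1)] by (metis rtranclp.rtrancl_into_rtrancl)
qed (rule rtranclp.rtrancl_refl)

text \<open>Steps of \<open>le\<close> are left multiplications by words, so both ends of a chain
  share their factor in \<open>stab\<close>; as right multiplication by \<open>stab\<close>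
  preserves \<open>le\<close>, this factor can be split off.\<close>

lemma bruhat_stab_iff:
  assumes "x \<in> G"
  shows "(\<exists>u\<in>words. \<exists>u'\<in>words. \<exists>\<sigma>\<in>stab. x = u \<circ> \<sigma> \<and> y = u' \<circ> \<sigma> \<and>
      bruhat_le (BijGroup UNIV) (refl ` S) u u') \<longleftrightarrow> le x y" (is "?L \<longleftrightarrow> _")
proof
  assume ?L
  then show "le x y" using bruhat_le_iff le_stab_right by auto
next
  assume le: "le x y"
  obtain u \<sigma> where u: "u \<in> words" "\<sigma> \<in> stab" "x = u \<circ> \<sigma>"
    using word_stab_decomposition[OF assms] .
  obtain w where w: "w \<in> words" "y = w \<circ> x" using le_words[OF le] by blast
  let ?u' = "w \<circ> u"
  have bs: "bij \<sigma>" using u(2) G_bij by (simp add: stab_def)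
  have e: "z \<circ> \<sigma> \<circ> inv \<sigma> = z" for z :: "'v \<Rightarrow> 'v"
    using bs by (simp add: comp_assoc bij_is_surj surj_iff[THEN iffD1])
  have "y = ?u' \<circ> \<sigma>" using w(2) u(3) by (simp add: comp_assoc)
  moreover from this have "le u ?u'"
    using le_stab_right[OF stab_inv[OF u(2)] le] u(3) e by simp
  ultimately show ?L
    using u w words_comp bruhat_le_iff[OF u(1)] by (intro bexI[of _ u] bexI[of _ ?u'] bexI[of _ \<sigma>]) auto
qed

end

section \<open>Root data\<close>

lemma zmul_int_eq: "zmul k (y :: int) = k * y"
proof (induction k rule: int_induct[where k = 0])
  case (step1 i)
  then show ?case by (simp add: zmul_add_left zmul_1 distrib_right)
next
  case (step2 i)
  then show ?case using zmul_add_left[of i "- 1" y] by (simp add: zmul_minus zmul_1 left_diff_distrib)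
qed (simp add: zmul_0)

lemma additive_zmul:
  assumes "Modules.additive f"
  shows "f (zmul k x) = zmul k (f x)"
proof -
  interpret f: Modules.additive f by (rule assms)
  show ?thesis
  proof (induction k rule: int_induct[where k = 0])
    case (step1 i)
    then show ?case by (simp add: zmul_add_left zmul_1 f.add)
  next
    case (step2 i)
    then show ?case using zmul_add_left[of i "- 1" x] zmul_add_left[of i "- 1" "f x"]
      by (simp add: zmul_minus zmul_1 f.diff)
  qed (simp add: zmul_0 f.zero)
qed

section \<open>Reflections on roots and coroots\<close>

context root_datum
begin

lemma pairing_add_left: "pairing (\<xi> + \<zeta>) \<eta> = pairing \<xi> \<eta> + pairing \<zeta> \<eta>"
  using additive_left[of \<eta>] by (simp add: Modules.additive_def)

lemma pairing_add_right: "pairing \<xi> (\<eta> + \<theta>) = pairing \<xi> \<eta> + pairing \<xi> \<theta>"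
  using additive_right[of \<xi>] by (simp add: Modules.additive_def)

lemma pairing_zmul_left: "pairing (zmul k \<xi>) \<eta> = k * pairing \<xi> \<eta>"
  using additive_zmul[OF additive_left[of \<eta>]] by (simp add: zmul_int_eq)

lemma pairing_zmul_right: "pairing \<xi> (zmul k \<eta>) = k * pairing \<xi> \<eta>"
  using additive_zmul[OF additive_right[of \<xi>]] by (simp add: zmul_int_eq)

lemma pairing_minus_left: "pairing (- \<xi>) \<eta> = - pairing \<xi> \<eta>"
  using additive.minus[OF additive_left[of \<eta>]] .

lemma pairing_minus_right: "pairing \<xi> (- \<eta>) = - pairing \<xi> \<eta>"
  using additive.minus[OF additive_right[of \<xi>]] .

lemma pairing_diff_left: "pairing (\<xi> - \<zeta>) \<eta> = pairing \<xi> \<eta> - pairing \<zeta> \<eta>"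
  using additive.diff[OF additive_left[of \<eta>]] .

lemma pairing_diff_right: "pairing \<xi> (\<eta> - \<theta>) = pairing \<xi> \<eta> - pairing \<xi> \<theta>"
  using additive.diff[OF additive_right[of \<xi>]] .

lemma pairing_sum_left: "pairing (sum f A) \<eta> = (\<Sum>a\<in>A. pairing (f a) \<eta>)"
  using additive.sum[OF additive_left[of \<eta>]] .

lemma pairing_sum_right: "pairing \<xi> (sum f A) = (\<Sum>a\<in>A. pairing \<xi> (f a))"
  using additive.sum[OF additive_right[of \<xi>]] .

lemmas pairing_simps = pairing_add_left pairing_add_right pairing_zmul_left pairing_zmul_right
  pairing_minus_left pairing_minus_right pairing_diff_left pairing_diff_right

lemma pairing_eqI: "(\<And>\<eta>. pairing \<xi> \<eta> = pairing \<zeta> \<eta>) \<Longrightarrow> \<xi> = \<zeta>"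
  using bij_betw_imp_inj_on[OF perfect_left] by (metis UNIV_I ext inj_onD)

lemma zmul_eq_zero: "zmul k (\<xi> :: 'c) = 0 \<Longrightarrow> k \<noteq> 0 \<Longrightarrow> \<xi> = 0"
proof (rule pairing_eqI)
  fix \<eta> assume "zmul k \<xi> = 0" "k \<noteq> 0"
  then have "k * pairing \<xi> \<eta> = 0" using pairing_zmul_left[of k \<xi> \<eta>] additive.zero[OF additive_left]
    by simp
  then show "pairing \<xi> \<eta> = pairing 0 \<eta>" using \<open>k \<noteq> 0\<close> additive.zero[OF additive_left] by simp
qed

lemma zmul_inj:
  assumes "(d :: 'c) \<noteq> 0" "zmul j d = zmul k d"
  shows "j = k"
proof -
  have "zmul (j - k) d = 0"
    using assms(2) zmul_add_left[of j "- k" d] by (simp add: zmul_minus)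
  then show ?thesis using zmul_eq_zero assms(1) by fastforce
qed

text \<open>A progression with nonzero difference has distinct terms, the character group being
  torsion-free. This turns finiteness of \<open>R\<close> into triviality of shears that preserve
  \<open>R\<close>.\<close>

lemma arithmetic_progression_zero:
  assumes "\<And>n :: nat. \<xi> + zmul (int n) d \<in> R"
  shows "d = 0"
proof (rule ccontr)
  assume d: "d \<noteq> 0"
  have "inj (\<lambda>n. \<xi> + zmul (int n) d)"
    by (rule injI) (use zmul_inj[OF d] in fastforce)
  moreover have "range (\<lambda>n. \<xi> + zmul (int n) d) \<subseteq> R" using assms by auto
  ultimately show False using finite_R finite_subset finite_imageD infinite_UNIV_nat by blast
qed

definition s_root :: "'c \<Rightarrow> 'c \<Rightarrow> 'c" where
  "s_root \<alpha> \<xi> = \<xi> - zmul (pairing \<xi> (coroot \<alpha>)) \<alpha>"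

definition s_coroot :: "'c \<Rightarrow> 'd \<Rightarrow> 'd" where
  "s_coroot \<alpha> \<eta> = \<eta> - zmul (pairing \<alpha> \<eta>) (coroot \<alpha>)"

lemma s_root_R: "\<alpha> \<in> R \<Longrightarrow> \<beta> \<in> R \<Longrightarrow> s_root \<alpha> \<beta> \<in> R"
  by (simp add: s_root_def reflect_root)

lemma pairing_s_root: "pairing (s_root \<alpha> \<xi>) \<eta> = pairing \<xi> (s_coroot \<alpha> \<eta>)"
  by (simp add: s_root_def s_coroot_def pairing_simps)

lemma s_root_s_root: "\<alpha> \<in> R \<Longrightarrow> s_root \<alpha> (s_root \<alpha> \<xi>) = \<xi>"
  by (rule pairing_eqI) (simp add: s_root_def pairing_simps pairing_coroot algebra_simps)

lemma s_root_self: "\<alpha> \<in> R \<Longrightarrow> s_root \<alpha> \<alpha> = - \<alpha>"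
  by (rule pairing_eqI) (simp add: s_root_def pairing_simps pairing_coroot)

lemma uminus_R: "\<alpha> \<in> R \<Longrightarrow> - \<alpha> \<in> R"
  using s_root_R[of \<alpha> \<alpha>] s_root_self by simp

lemma root_nonzero: "\<alpha> \<in> R \<Longrightarrow> \<alpha> \<noteq> 0"
  using pairing_coroot additive.zero[OF additive_left] by fastforce

text \<open>The product of the two reflections attached to \<open>\<gamma>\<close> is unipotent on the finite set \<open>R\<close>,
  hence trivial there; the same idea applied to the roots \<open>\<gamma>\<close> and \<open>\<epsilon>\<close> shows that they agree.\<close>

lemma coroot_s_root:
  assumes \<alpha>: "\<alpha> \<in> R" and \<beta>: "\<beta> \<in> R"
  shows "coroot (s_root \<alpha> \<beta>) = s_coroot \<alpha> (coroot \<beta>)"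
proof -
  define \<gamma> where "\<gamma> = s_root \<alpha> \<beta>"
  have \<gamma>: "\<gamma> \<in> R" using assms s_root_R by (simp add: \<gamma>_def)
  obtain \<epsilon> where \<epsilon>: "\<epsilon> \<in> R" "coroot \<epsilon> = s_coroot \<alpha> (coroot \<beta>)"
    using reflect_coroot[OF assms] by (auto simp: s_coroot_def)
  have \<gamma>\<epsilon>: "pairing \<gamma> (coroot \<epsilon>) = 2"
    unfolding \<epsilon>(2) pairing_s_root[symmetric] \<gamma>_def s_root_s_root[OF \<alpha>] by (rule pairing_coroot[OF \<beta>])
  have eq: "pairing \<xi> (coroot \<gamma>) = pairing \<xi> (coroot \<epsilon>)" if \<xi>: "\<xi> \<in> R" for \<xi>
  proof -
    define c where "c = pairing \<xi> (coroot \<epsilon>) - pairing \<xi> (coroot \<gamma>)"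
    \<comment> \<open>Conjugating the reflection of \<beta> by that of \<alpha> subtracts
      \<open>pairing \<zeta> (coroot \<epsilon>)\<close> times \<gamma>; following it with the
      reflection of \<gamma> leaves a shear along \<gamma>.\<close>
    have T: "\<zeta> + zmul (pairing \<zeta> (coroot \<epsilon>) - pairing \<zeta> (coroot \<gamma>)) \<gamma> \<in> R" if \<zeta>: "\<zeta> \<in> R" for \<zeta>
    proof -
      have "s_root \<gamma> (s_root \<alpha> (s_root \<beta> (s_root \<alpha> \<zeta>))) =
          \<zeta> + zmul (pairing \<zeta> (coroot \<epsilon>) - pairing \<zeta> (coroot \<gamma>)) \<gamma>"
      proof (rule pairing_eqI)
        fix \<eta>
        have e: "pairing (s_root \<alpha> (s_root \<beta> (s_root \<alpha> \<zeta>))) \<theta> =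
            pairing \<zeta> \<theta> - pairing \<zeta> (coroot \<epsilon>) * pairing \<gamma> \<theta>" for \<theta>
        proof -
          have "pairing (s_root \<alpha> (s_root \<beta> (s_root \<alpha> \<zeta>))) \<theta> =
              pairing (s_root \<alpha> \<zeta>) (s_coroot \<alpha> \<theta>) -
              pairing (s_root \<alpha> \<zeta>) (coroot \<beta>) * pairing \<beta> (s_coroot \<alpha> \<theta>)"
            by (simp add: pairing_s_root[of \<alpha>] s_root_def[of \<beta>] pairing_simps)
          also have "pairing (s_root \<alpha> \<zeta>) (s_coroot \<alpha> \<theta>) = pairing \<zeta> \<theta>"
            by (simp add: pairing_s_root[symmetric] s_root_s_root[OF \<alpha>])
          finally show ?thesis by (simp add: pairing_s_root \<epsilon>(2) \<gamma>_def)
        qed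
        show "pairing (s_root \<gamma> (s_root \<alpha> (s_root \<beta> (s_root \<alpha> \<zeta>)))) \<eta> =
            pairing (\<zeta> + zmul (pairing \<zeta> (coroot \<epsilon>) - pairing \<zeta> (coroot \<gamma>)) \<gamma>) \<eta>"
          unfolding s_root_def[of \<gamma>] pairing_simps e pairing_coroot[OF \<gamma>] by (simp add: algebra_simps)
      qed
      then show ?thesis using s_root_R \<alpha> \<beta> \<gamma> \<zeta> by metis
    qed
    have "\<xi> + zmul (int n) (zmul c \<gamma>) \<in> R" for n
    proof (induction n)
      case (Suc n)
      have "\<xi> + zmul (int (Suc n)) (zmul c \<gamma>) = (\<xi> + zmul (int n) (zmul c \<gamma>)) + zmul c \<gamma>"
        by (simp add: zmul_add_left zmul_1 distrib_right)
      moreover have "pairing (\<xi> + zmul (int n) (zmul c \<gamma>)) (coroot \<epsilon>) -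
          pairing (\<xi> + zmul (int n) (zmul c \<gamma>)) (coroot \<gamma>) = c"
        by (simp add: pairing_simps \<gamma>\<epsilon> pairing_coroot[OF \<gamma>] c_def)
      ultimately show ?case using T[OF Suc] by (simp only:)
    qed (simp add: zmul_0 \<xi>)
    then have "zmul c \<gamma> = 0" by (rule arithmetic_progression_zero)
    then have "c = 0" using zmul_eq_zero[of c \<gamma>] root_nonzero[OF \<gamma>] by blast
    then show ?thesis by (simp add: c_def)
  qed
  have \<epsilon>\<gamma>: "pairing \<epsilon> (coroot \<gamma>) = 2" using eq[OF \<epsilon>(1)] pairing_coroot[OF \<epsilon>(1)] by simp
  \<comment> \<open>All pairings of \<gamma> and \<epsilon> with both coroots equal 2, so on the
    line through \<epsilon> in direction \<open>d\<close> the product of the reflections of \<gamma>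
    and \<epsilon> is the shift by \<open>d\<close>.\<close>
  define d where "d = zmul 2 (\<gamma> - \<epsilon>)"
  have "\<epsilon> + zmul (int n) d \<in> R" for n
  proof (induction n)
    case (Suc n)
    have "s_root \<gamma> (s_root \<epsilon> (\<epsilon> + zmul (int n) d)) = \<epsilon> + zmul (int (Suc n)) d"
      by (rule pairing_eqI)
        (simp add: d_def s_root_def pairing_simps pairing_coroot \<epsilon> \<gamma> \<gamma>\<epsilon> \<epsilon>\<gamma> algebra_simps flip: \<epsilon>(2))
    then show ?case using s_root_R[OF \<gamma> s_root_R[OF \<epsilon>(1) Suc]] by simp
  qed (simp add: zmul_0 \<epsilon>)
  then have "d = 0" by (rule arithmetic_progression_zero)
  then have "\<gamma> = \<epsilon>" using zmul_eq_zero[of 2 "\<gamma> - \<epsilon>"] by (simp add: d_def)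
  then show ?thesis using \<epsilon>(2) by (simp add: \<gamma>_def)
qed

lemma coroot_uminus: "\<alpha> \<in> R \<Longrightarrow> coroot (- \<alpha>) = - coroot \<alpha>"
  using coroot_s_root[of \<alpha> \<alpha>] zmul_add_left[of 1 1 "coroot \<alpha>"]
  by (simp add: s_root_self s_coroot_def pairing_coroot zmul_1)

end

section \<open>Positive roots and a regular dominant cocharacter\<close>

context based_reduced_root_datum
begin

lemma finite_simple: "finite \<Delta>"
  using finite_subset[OF simple_subset finite_R] .

lemma positive_R: "\<alpha> \<in> positive_roots \<Longrightarrow> \<alpha> \<in> R"
  by (simp add: positive_roots_def)

lemma finite_positive: "finite positive_roots"
  using finite_R by (simp add: positive_roots_def)

lemma positive_or_negative: "\<alpha> \<in> R \<Longrightarrow> \<alpha> \<in> positive_roots \<or> - \<alpha> \<in> positive_roots"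
proof -
  assume \<alpha>: "\<alpha> \<in> R"
  obtain f :: "'c \<Rightarrow> nat" where "\<alpha> = (\<Sum>\<beta>\<in>\<Delta>. zmul (int (f \<beta>)) \<beta>) \<or> \<alpha> = - (\<Sum>\<beta>\<in>\<Delta>. zmul (int (f \<beta>)) \<beta>)"
    using simple_base[OF \<alpha>] by blast
  then have "\<alpha> = (\<Sum>\<beta>\<in>\<Delta>. zmul (int (f \<beta>)) \<beta>) \<or> - \<alpha> = (\<Sum>\<beta>\<in>\<Delta>. zmul (int (f \<beta>)) \<beta>)"
    by (elim disjE) simp_all
  then show ?thesis using \<alpha> uminus_R[OF \<alpha>] unfolding positive_roots_def by blast
qed

lemma simple_coeffs_zero:
  assumes "(\<Sum>\<beta>\<in>\<Delta>. zmul (f \<beta>) \<beta>) = 0" "\<beta> \<in> \<Delta>"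
  shows "f \<beta> = 0"
  using int_module.independentD[OF simple_independent finite_simple order_refl assms] .

lemma simple_positive: "\<alpha> \<in> \<Delta> \<Longrightarrow> \<alpha> \<in> positive_roots"
proof -
  assume \<alpha>: "\<alpha> \<in> \<Delta>"
  have "(\<Sum>\<beta>\<in>\<Delta>. zmul (int (if \<beta> = \<alpha> then 1 else 0)) \<beta>) = (\<Sum>\<beta>\<in>\<Delta>. if \<beta> = \<alpha> then \<alpha> else 0)"
    by (rule sum.cong) (auto simp: zmul_1 zmul_0)
  also have "\<dots> = \<alpha>" using \<alpha> finite_simple by simp
  finally have "\<alpha> = (\<Sum>\<beta>\<in>\<Delta>. zmul (int (if \<beta> = \<alpha> then 1 else 0)) \<beta>)" ..
  then show ?thesis using \<alpha> simple_subset unfolding positive_roots_def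
    by (intro CollectI conjI exI[of _ "\<lambda>\<beta>. if \<beta> = \<alpha> then 1 else 0"]) auto
qed

lemma positive_not_negative: "\<alpha> \<in> positive_roots \<Longrightarrow> - \<alpha> \<notin> positive_roots"
proof
  assume "\<alpha> \<in> positive_roots" "- \<alpha> \<in> positive_roots"
  then obtain f g :: "'c \<Rightarrow> nat" where fg: "\<alpha> = (\<Sum>\<beta>\<in>\<Delta>. zmul (int (f \<beta>)) \<beta>)"
      "- \<alpha> = (\<Sum>\<beta>\<in>\<Delta>. zmul (int (g \<beta>)) \<beta>)" and \<alpha>: "\<alpha> \<in> R"
    by (auto simp: positive_roots_def)
  have "(\<Sum>\<beta>\<in>\<Delta>. zmul (int (f \<beta>) + int (g \<beta>)) \<beta>) = \<alpha> + - \<alpha>"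
    unfolding zmul_add_left sum.distrib using fg by simp
  then have "int (f \<beta>) + int (g \<beta>) = 0" if "\<beta> \<in> \<Delta>" for \<beta>
    using simple_coeffs_zero[of "\<lambda>\<beta>. int (f \<beta>) + int (g \<beta>)"] that by simp
  then have "int (f \<beta>) = 0" if "\<beta> \<in> \<Delta>" for \<beta> using that by fastforce
  then have "\<alpha> = 0" unfolding fg(1) by (intro sum.neutral) (simp add: zmul_0)
  then show False using root_nonzero[OF \<alpha>] by simp
qed

text \<open>The reflection changes only the coefficient at \<alpha>, so if the image were negative,
  \<beta> would be a multiple of \<alpha>; reducedness excludes this.\<close>

lemma s_root_simple_positive:
  assumes \<alpha>: "\<alpha> \<in> \<Delta>" and \<beta>: "\<beta> \<in> positive_roots" "\<beta> \<noteq> \<alpha>"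
  shows "s_root \<alpha> \<beta> \<in> positive_roots - {\<alpha>}"
proof -
  have \<alpha>R: "\<alpha> \<in> R" and \<beta>R: "\<beta> \<in> R" using \<alpha> \<beta> simple_subset positive_R by auto
  have ne: "s_root \<alpha> \<beta> \<noteq> \<alpha>"
    using s_root_s_root[OF \<alpha>R, of \<beta>] s_root_self[OF \<alpha>R] positive_not_negative[OF simple_positive[OF \<alpha>]] \<beta>
    by auto
  moreover have "s_root \<alpha> \<beta> \<in> positive_roots"
  proof (rule ccontr)
    assume "s_root \<alpha> \<beta> \<notin> positive_roots"
    then have "- s_root \<alpha> \<beta> \<in> positive_roots"
      using positive_or_negative s_root_R[OF \<alpha>R \<beta>R] by blast
    then obtain f g :: "'c \<Rightarrow> nat" where f: "\<beta> = (\<Sum>\<gamma>\<in>\<Delta>. zmul (int (f \<gamma>)) \<gamma>)"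
      and g: "- s_root \<alpha> \<beta> = (\<Sum>\<gamma>\<in>\<Delta>. zmul (int (g \<gamma>)) \<gamma>)"
      using \<beta>(1) by (auto simp: positive_roots_def)
    define m where "m = pairing \<beta> (coroot \<alpha>)"
    have single: "(\<Sum>\<gamma>\<in>\<Delta>. zmul (if \<gamma> = \<alpha> then k else 0) \<gamma>) = zmul k \<alpha>" for k
    proof -
      have "(\<Sum>\<gamma>\<in>\<Delta>. zmul (if \<gamma> = \<alpha> then k else 0) \<gamma>) = (\<Sum>\<gamma>\<in>\<Delta>. if \<gamma> = \<alpha> then zmul k \<alpha> else 0)"
        by (rule sum.cong) (auto simp: zmul_0)
      then show ?thesis using \<alpha> finite_simple by simp
    qed
    have "(\<Sum>\<gamma>\<in>\<Delta>. zmul (int (f \<gamma>) + int (g \<gamma>) + (if \<gamma> = \<alpha> then - m else 0)) \<gamma>) =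
        \<beta> + - s_root \<alpha> \<beta> + zmul (- m) \<alpha>"
      unfolding zmul_add_left sum.distrib single f[symmetric] g[symmetric] ..
    also have "\<dots> = 0" by (simp add: s_root_def m_def zmul_minus)
    finally have z: "int (f \<gamma>) + int (g \<gamma>) + (if \<gamma> = \<alpha> then - m else 0) = 0" if "\<gamma> \<in> \<Delta>" for \<gamma>
      using simple_coeffs_zero[of "\<lambda>\<gamma>. int (f \<gamma>) + int (g \<gamma>) + (if \<gamma> = \<alpha> then - m else 0)"] that by simp
    have "f \<gamma> = 0" if "\<gamma> \<in> \<Delta>" "\<gamma> \<noteq> \<alpha>" for \<gamma> using z[OF that(1)] that(2) by simp
    then have "(\<Sum>\<gamma>\<in>\<Delta>. zmul (int (f \<gamma>)) \<gamma>) = (\<Sum>\<gamma>\<in>\<Delta>. zmul (if \<gamma> = \<alpha> then int (f \<alpha>) else 0) \<gamma>)"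
      by (intro sum.cong) auto
    then have \<beta>f: "\<beta> = zmul (int (f \<alpha>)) \<alpha>" using f single by simp
    then have "f \<alpha> \<noteq> 0" using root_nonzero[OF \<beta>R] by (metis of_nat_0 zmul_0)
    then have "\<alpha> = \<beta> \<or> \<alpha> = - \<beta>"
      using reduced[OF \<beta>R \<alpha>R, of 1 "int (f \<alpha>)"] \<beta>f by (simp add: zmul_1)
    then show False using \<beta>(2) positive_not_negative[OF simple_positive[OF \<alpha>]] \<beta>(1) by auto
  qed
  ultimately show ?thesis by simp
qed

text \<open>The sum is left undivided so that it lies in the cocharacter lattice; it serves as an
  integral vector in the open dominant chamber.\<close>

definition two_rho :: 'd where
  "two_rho = (\<Sum>\<beta>\<in>positive_roots. coroot \<beta>)"

text \<open>The reflection of \<alpha> permutes the positive roots other than \<alpha>, so the sum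
  of their coroots is fixed by it and pairs to 0 with \<alpha>; only \<open>coroot \<alpha>\<close>
  contributes.\<close>

lemma pairing_simple_two_rho:
  assumes \<alpha>: "\<alpha> \<in> \<Delta>"
  shows "pairing \<alpha> two_rho = 2"
proof -
  have \<alpha>R: "\<alpha> \<in> R" using \<alpha> simple_subset by auto
  let ?P = "positive_roots - {\<alpha>}"
  have bij: "bij_betw (s_root \<alpha>) ?P ?P"
    by (rule bij_betw_byWitness[where f' = "s_root \<alpha>"])
      (use s_root_s_root[OF \<alpha>R] s_root_simple_positive[OF \<alpha>] in auto)
  have split: "two_rho = coroot \<alpha> + sum coroot ?P"
    unfolding two_rho_def by (rule sum.remove[OF finite_positive simple_positive[OF \<alpha>]])
  have "s_coroot \<alpha> (sum coroot ?P) = (\<Sum>\<beta>\<in>?P. s_coroot \<alpha> (coroot \<beta>))"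
    by (simp add: s_coroot_def sum_subtractf pairing_sum_right int_module.scale_sum_left)
  also have "\<dots> = (\<Sum>\<beta>\<in>?P. coroot (s_root \<alpha> \<beta>))"
    by (rule sum.cong) (auto simp: coroot_s_root[OF \<alpha>R positive_R])
  also have "\<dots> = sum coroot ?P" by (rule sum.reindex_bij_betw[OF bij])
  finally have "pairing \<alpha> (s_coroot \<alpha> (sum coroot ?P)) = pairing \<alpha> (sum coroot ?P)" by simp
  then have "pairing \<alpha> (sum coroot ?P) = 0"
    by (simp add: s_coroot_def pairing_simps pairing_coroot[OF \<alpha>R])
  then show ?thesis by (simp add: split pairing_add_right pairing_coroot[OF \<alpha>R])
qed

lemma positive_pairing_nonneg:
  assumes \<beta>: "\<beta> \<in> positive_roots" and "\<And>\<alpha>. \<alpha> \<in> \<Delta> \<Longrightarrow> 0 \<le> pairing \<alpha> \<eta>"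
  shows "0 \<le> pairing \<beta> \<eta>"
proof -
  obtain f :: "'c \<Rightarrow> nat" where f: "\<beta> = (\<Sum>\<gamma>\<in>\<Delta>. zmul (int (f \<gamma>)) \<gamma>)"
    using \<beta> by (auto simp: positive_roots_def)
  show ?thesis unfolding f pairing_sum_left pairing_zmul_left using assms(2) by (intro sum_nonneg) auto
qed

lemma pairing_positive_two_rho:
  assumes \<beta>: "\<beta> \<in> positive_roots"
  shows "0 < pairing \<beta> two_rho"
proof -
  obtain f :: "'c \<Rightarrow> nat" where f: "\<beta> = (\<Sum>\<gamma>\<in>\<Delta>. zmul (int (f \<gamma>)) \<gamma>)"
    using \<beta> by (auto simp: positive_roots_def)
  have "\<exists>\<gamma>\<in>\<Delta>. f \<gamma> \<noteq> 0"
  proof (rule ccontr)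
    assume "\<not> (\<exists>\<gamma>\<in>\<Delta>. f \<gamma> \<noteq> 0)"
    then have "\<beta> = 0" unfolding f by (intro sum.neutral) (auto simp: zmul_0)
    then show False using root_nonzero[OF positive_R[OF \<beta>]] by simp
  qed
  then obtain \<gamma> where \<gamma>: "\<gamma> \<in> \<Delta>" "0 < f \<gamma>" by auto
  have "0 < (\<Sum>\<gamma>\<in>\<Delta>. int (f \<gamma>) * pairing \<gamma> two_rho)"
    by (rule sum_pos2[OF finite_simple \<gamma>(1)])
      (use \<gamma> pairing_simple_two_rho in auto)
  then show ?thesis by (subst f) (simp add: pairing_sum_left pairing_zmul_left)
qed

end

section \<open>Linear functionals on finite-dimensional normed spaces\<close>

text \<open>Comparison of the given norm with the sum of absolute coordinates \<open>N\<close>: on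
  the set where \<open>N\<close> is 1 the norm attains a positive minimum \<open>m\<close>, and this
  bounds every linear functional.\<close>

lemma finite_dimensional_linear_continuous:
  fixes f :: "'v::real_normed_vector \<Rightarrow> real"
  assumes fin: "finite B" and indep: "independent B" and span: "span B = (UNIV :: 'v set)"
    and lin: "linear f"
  shows "continuous_on S f"
proof -
  define T :: "('v \<Rightarrow> real) \<Rightarrow> 'v" where "T c = (\<Sum>b\<in>B. c b *\<^sub>R b)" for c
  \<comment> \<open>Coordinates are functions on all of the vector type. Forcing them to vanish off
    \<open>B\<close> makes \<open>K\<close> a product of compact sets, hence compact in the product
    topology.\<close>
  define K where "K = (\<Pi>\<^sub>E b\<in>UNIV. if b \<in> B then {-1..1} else {0::real})"
  define N :: "('v \<Rightarrow> real) \<Rightarrow> real" where "N c = (\<Sum>b\<in>B. \<bar>c b\<bar>)" for c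
  have surj: "\<exists>c. (\<forall>b. b \<notin> B \<longrightarrow> c b = 0) \<and> x = T c" for x
  proof -
    have "x \<in> range (\<lambda>u. \<Sum>b\<in>B. u b *\<^sub>R b)" using span span_finite[OF fin] by blast
    then obtain u where u: "x = (\<Sum>b\<in>B. u b *\<^sub>R b)" by blast
    have "T (\<lambda>b. if b \<in> B then u b else 0) = (\<Sum>b\<in>B. u b *\<^sub>R b)"
      unfolding T_def by (rule sum.cong) simp_all
    then show ?thesis using u by (intro exI[of _ "\<lambda>b. if b \<in> B then u b else 0"]) simp
  qed
  have "compactin (product_topology (\<lambda>_. euclidean) UNIV) K"
    unfolding K_def by (subst compactin_PiE) auto
  then have "compact K" by (simp add: euclidean_product_topology)
  moreover have "closed {c. N c = 1}"
    unfolding N_def by (intro closed_Collect_eq continuous_intros) auto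
  ultimately have cpt: "compact (K \<inter> {c. N c = 1})" by blast
  have contT: "continuous_on (K \<inter> {c. N c = 1}) (\<lambda>c. norm (T c))"
    unfolding T_def by (intro continuous_intros continuous_on_subset[OF continuous_on_product_coordinates]) auto
  have T0: "T c = 0 \<Longrightarrow> N c = 0" for c
    using independentD[OF indep fin order_refl, of c] by (auto simp: T_def N_def)
  obtain m where m: "0 < m" "\<And>c. (\<forall>b. b \<notin> B \<longrightarrow> c b = 0) \<Longrightarrow> N c = 1 \<Longrightarrow> m \<le> norm (T c)"
  proof (cases "K \<inter> {c. N c = 1} = {}")
    case False
    obtain c0 where c0: "c0 \<in> K \<inter> {c. N c = 1}" "\<forall>c\<in>K \<inter> {c. N c = 1}. norm (T c0) \<le> norm (T c)"
      using continuous_attains_inf[OF cpt False contT] by blast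
    have inK: "c \<in> K" if "\<forall>b. b \<notin> B \<longrightarrow> c b = 0" "N c = 1" for c
    proof -
      have "\<bar>c b\<bar> \<le> 1" if "b \<in> B" for b
        using member_le_sum[OF that _ fin, of "\<lambda>b. \<bar>c b\<bar>"] \<open>N c = 1\<close> by (simp add: N_def)
      then show ?thesis using that(1) by (fastforce simp: K_def abs_le_iff)
    qed
    show ?thesis
      by (rule that[of "norm (T c0)"]) (use c0 T0[of c0] inK in auto)
  next
    \<comment> \<open>The unit sphere is empty when \<open>V = 0\<close>; any positive
      \<open>m\<close> serves then.\<close>
    case True
    have "\<not> (N c = 1)" if "\<forall>b. b \<notin> B \<longrightarrow> c b = 0" for c
    proof
      assume n: "N c = 1"
      have "\<bar>c b\<bar> \<le> 1" if "b \<in> B" for b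
        using member_le_sum[OF that _ fin, of "\<lambda>b. \<bar>c b\<bar>"] n by (simp add: N_def)
      then have "c \<in> K" using that by (fastforce simp: K_def abs_le_iff)
      then show False using True n by auto
    qed
    then show ?thesis by (intro that[of 1]) auto
  qed
  define M where "M = (\<Sum>b\<in>B. \<bar>f b\<bar>)"
  have M: "0 \<le> M" by (simp add: M_def sum_nonneg)
  have bound: "norm (f x) \<le> norm x * (M / m)" for x
  proof -
    obtain c where c: "\<forall>b. b \<notin> B \<longrightarrow> c b = 0" "x = T c" using surj by blast
    have N0: "0 \<le> N c" by (simp add: N_def sum_nonneg)
    have 1: "N c * m \<le> norm (T c)"
    proof (cases "N c = 0")
      case False
      then have pos: "0 < N c" using N0 by simp
      let ?d = "\<lambda>b. c b / N c"
      have "N ?d = N c / N c"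
        unfolding N_def sum_divide_distrib using pos by (simp add: N_def)
      then have "m \<le> norm (T ?d)" using m(2)[of ?d] c(1) False by simp
      also have "T ?d = (1 / N c) *\<^sub>R T c" by (simp add: T_def scaleR_sum_right)
      also have "norm \<dots> = norm (T c) / N c" using pos by simp
      finally show ?thesis using pos by (simp add: field_simps)
    qed simp
    have "f x = (\<Sum>b\<in>B. c b * f b)"
      unfolding c(2) T_def by (simp add: linear_sum[OF lin] linear_scale[OF lin])
    also have "\<bar>\<dots>\<bar> \<le> (\<Sum>b\<in>B. \<bar>c b\<bar> * M)"
    proof (rule order_trans[OF sum_abs], rule sum_mono)
      fix b assume "b \<in> B"
      then have "\<bar>f b\<bar> \<le> M" unfolding M_def by (intro member_le_sum) (auto simp: fin)
      then show "\<bar>c b * f b\<bar> \<le> \<bar>c b\<bar> * M" by (simp add: abs_mult mult_left_mono)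
    qed
    also have "\<dots> = N c * M" by (simp add: N_def sum_distrib_right)
    also have "\<dots> \<le> (norm x / m) * M"
      using 1 m(1) M c(2) by (intro mult_right_mono) (simp_all add: field_simps)
    finally show ?thesis by simp
  qed
  have "bounded_linear f"
    by (rule bounded_linear_intro[of f "M / m"])
      (use bound linear_add[OF lin] linear_scale[OF lin] in auto)
  then show ?thesis by (rule linear_continuous_on)
qed


section \<open>Affine roots and their reflections\<close>

context affine_root_datum
begin

lemma \<iota>_simps:
  "\<iota> (x + y) = \<iota> x + \<iota> y" "\<iota> (x - y) = \<iota> x - \<iota> y" "\<iota> (- x) = - \<iota> x" "\<iota> 0 = 0"
  using additive.add[OF additive_\<iota>] additive.diff[OF additive_\<iota>] additive.minus[OF additive_\<iota>]
    additive.zero[OF additive_\<iota>] by auto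

lemma zmul_real_vector: "zmul k (x :: 'v) = of_int k *\<^sub>R x"
proof (induction k rule: int_induct[where k = 0])
  case (step1 i)
  then show ?case by (simp add: zmul_add_left zmul_1 scaleR_add_left)
next
  case (step2 i)
  then show ?case using zmul_add_left[of i "- 1" x]
    by (simp add: zmul_minus zmul_1 scaleR_diff_left)
qed (simp add: zmul_0)

lemma \<iota>_zmul: "\<iota> (zmul k \<eta>) = of_int k *\<^sub>R \<iota> \<eta>"
  using additive_zmul[OF additive_\<iota>] by (simp add: zmul_real_vector)

lemma linear_eqI:
  fixes f g :: "'v \<Rightarrow> 'w::real_vector"
  assumes "linear f" "linear g" "\<And>\<eta>. f (\<iota> \<eta>) = g (\<iota> \<eta>)"
  shows "f x = g x"
proof -
  obtain B where B: "span (\<iota> ` B) = UNIV" using extends_scalars by blast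
  show ?thesis by (rule linear_eq_on_span[of f g "\<iota> ` B"]) (use assms B in auto)
qed

lemmas linear_pairing_V = pairing_V(1)
lemmas pairing_V_\<iota> = pairing_V(2)

lemmas pairing_V_simps =
  linear_add[OF linear_pairing_V] linear_diff[OF linear_pairing_V] linear_neg[OF linear_pairing_V]
  linear_scale[OF linear_pairing_V] linear_0[OF linear_pairing_V] pairing_V_\<iota>

lemma pairing_V_minus: "pairing_V (- \<xi>) x = - pairing_V \<xi> x"
  by (rule linear_eqI[OF linear_pairing_V])
    (auto intro: linear_compose_neg linear_pairing_V simp: pairing_V_\<iota> pairing_minus_left)

lemma continuous_pairing_V: "continuous_on S (pairing_V \<xi>)"
proof -
  obtain B where B: "is_zbasis B" "independent (\<iota> ` B)" "span (\<iota> ` B) = UNIV"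
    using extends_scalars by blast
  then show ?thesis
    using finite_dimensional_linear_continuous[OF _ B(2,3) linear_pairing_V] by (simp add: is_zbasis_def)
qed

lemma linear_reflection: "linear (affine_reflection \<alpha> 0)"
  by (rule linearI) (simp_all add: affine_reflection_def pairing_V_simps algebra_simps scaleR_add_left)

lemma pairing_V_reflection:
  "pairing_V \<xi> (affine_reflection \<alpha> 0 x) = pairing_V (s_root \<alpha> \<xi>) x"
  by (rule linear_eqI[OF linear_compose[OF linear_reflection linear_pairing_V, unfolded o_def] linear_pairing_V])
    (simp add: affine_reflection_def pairing_V_simps s_root_def pairing_simps)

lemma reflection_\<iota>: "affine_reflection \<alpha> 0 (\<iota> \<eta>) = \<iota> (s_coroot \<alpha> \<eta>)"
  by (simp add: affine_reflection_def s_coroot_def \<iota>_simps \<iota>_zmul pairing_V_\<iota>)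

definition aff :: "'c \<Rightarrow> int \<Rightarrow> 'v \<Rightarrow> real" where
  "aff \<alpha> k x = pairing_V \<alpha> x + of_int k"

definition affine_roots :: "('v \<Rightarrow> real) set" where
  "affine_roots = {aff \<alpha> k | \<alpha> k. \<alpha> \<in> R}"

text \<open>\<open>reflection_system\<close> indexes reflections by functions; the coroot is
  recovered from the gradient of \<open>f\<close>, which \<open>aff_inj\<close> shows to be
  unique.\<close>

definition root_refl :: "('v \<Rightarrow> real) \<Rightarrow> 'v \<Rightarrow> 'v" where
  "root_refl f x = x - f x *\<^sub>R \<iota> (coroot (THE \<alpha>. \<exists>k. f = aff \<alpha> k))"

lemma affine_rootsE:
  assumes "f \<in> affine_roots"
  obtains \<alpha> k where "\<alpha> \<in> R" "f = aff \<alpha> k"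
  using assms by (auto simp: affine_roots_def)

lemma aff_in_affine_roots: "\<alpha> \<in> R \<Longrightarrow> aff \<alpha> k \<in> affine_roots"
  by (auto simp: affine_roots_def)

lemma aff_inj: "aff \<alpha> k = aff \<beta> l \<longleftrightarrow> \<alpha> = \<beta> \<and> k = l"
proof
  assume e: "aff \<alpha> k = aff \<beta> l"
  then have e: "pairing_V \<alpha> x + of_int k = pairing_V \<beta> x + of_int l" for x
    by (metis aff_def)
  have kl: "k = l" using e[of 0] by (simp add: pairing_V_simps)
  have "\<alpha> = \<beta>"
  proof (rule pairing_eqI)
    fix \<eta>
    have "real_of_int (pairing \<alpha> \<eta>) = of_int (pairing \<beta> \<eta>)" using e[of "\<iota> \<eta>"] kl by (simp add: pairing_V_\<iota>)
    then show "pairing \<alpha> \<eta> = pairing \<beta> \<eta>" by (simp only: of_int_eq_iff)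
  qed
  then show "\<alpha> = \<beta> \<and> k = l" using kl by simp
qed simp

lemma root_refl_aff: "root_refl (aff \<alpha> k) = affine_reflection \<alpha> k"
proof -
  have "(THE \<beta>. \<exists>l. aff \<alpha> k = aff \<beta> l) = \<alpha>" by (rule the_equality) (auto simp: aff_inj)
  then show ?thesis by (auto simp: root_refl_def affine_reflection_def aff_def)
qed

lemma uminus_aff: "- aff \<alpha> k = aff (- \<alpha>) (- k)"
  by (auto simp: aff_def pairing_V_minus)

lemma affine_reflection_uminus: "\<alpha> \<in> R \<Longrightarrow> affine_reflection (- \<alpha>) (- k) = affine_reflection \<alpha> k"
  by (rule ext) (simp add: affine_reflection_def pairing_V_minus coroot_uminus \<iota>_simps algebra_simps)

lemma aff_affine_reflection: "\<alpha> \<in> R \<Longrightarrow> aff \<alpha> k (affine_reflection \<alpha> k x) = - aff \<alpha> k x"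
  by (simp add: aff_def affine_reflection_def pairing_V_simps pairing_coroot)

lemma affine_reflection_aff: "affine_reflection \<alpha> k x = x - aff \<alpha> k x *\<^sub>R \<iota> (coroot \<alpha>)"
  by (simp add: affine_reflection_def aff_def)

lemma affine_reflection_involution:
  assumes "\<alpha> \<in> R"
  shows "affine_reflection \<alpha> k \<circ> affine_reflection \<alpha> k = id"
proof
  fix x
  have "affine_reflection \<alpha> k (affine_reflection \<alpha> k x) =
      affine_reflection \<alpha> k x + aff \<alpha> k x *\<^sub>R \<iota> (coroot \<alpha>)"
    by (simp only: affine_reflection_aff[of \<alpha> k "affine_reflection \<alpha> k x"] aff_affine_reflection[OF assms]) simp
  then show "(affine_reflection \<alpha> k \<circ> affine_reflection \<alpha> k) x = id x" by (simp add: affine_reflection_aff)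
qed

lemma bij_affine_reflection: "\<alpha> \<in> R \<Longrightarrow> bij (affine_reflection \<alpha> k)"
  using affine_reflection_involution o_bij by blast

lemma inv_affine_reflection: "\<alpha> \<in> R \<Longrightarrow> inv (affine_reflection \<alpha> k) = affine_reflection \<alpha> k"
  using affine_reflection_involution by (intro inv_unique_comp)

lemma aff_convex: "aff \<alpha> k (x + t *\<^sub>R (y - x)) = (1 - t) * aff \<alpha> k x + t * aff \<alpha> k y"
  by (simp add: aff_def pairing_V_simps algebra_simps)

lemma affine_root_convex:
  assumes "f \<in> affine_roots"
  shows "f (x + t *\<^sub>R (y - x)) = (1 - t) * f x + t * f y"
  using assms by (auto elim!: affine_rootsE simp: aff_convex)

lemma continuous_affine_root: "f \<in> affine_roots \<Longrightarrow> continuous_on S f"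
  by (auto elim!: affine_rootsE simp: aff_def[abs_def] intro!: continuous_intros continuous_pairing_V)

lemma affine_root_uminus: "f \<in> affine_roots \<Longrightarrow> - f \<in> affine_roots"
  using uminus_R by (auto elim!: affine_rootsE simp: uminus_aff aff_in_affine_roots)

lemma affine_hyperplane_affine_root:
  assumes "f \<in> affine_roots"
  shows "affine {x. f x = 0}"
proof -
  obtain \<alpha> k where f: "f = aff \<alpha> k" using assms by (rule affine_rootsE)
  have "f (u *\<^sub>R x + v *\<^sub>R y) = u * f x + v * f y" if "u + v = 1" for u v x y
  proof -
    have "of_int k = (u + v) * real_of_int k" using that by simp
    then show ?thesis by (simp only: f aff_def pairing_V_simps) (simp add: algebra_simps)
  qed
  then show ?thesis by (auto simp: affine_def)
qed


subsection \<open>The extended affine Weyl group\<close>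

text \<open>All properties are carried through the generation of \<open>W\<close> together. The root
  \<beta> is \<alpha> composed with \<open>w\<close>; that \<open>w\<close> matches the coroots too
  is what makes conjugates of reflections reflections.\<close>

lemma W_prop:
  assumes "w \<in> W"
  shows W_linear: "linear w"
    and W_bij: "bij w"
    and W_\<iota>: "\<exists>\<eta>'. w (\<iota> \<eta>) = \<iota> \<eta>'"
    and W_root: "\<alpha> \<in> R \<Longrightarrow> \<exists>\<beta>\<in>R. (\<forall>x. pairing_V \<alpha> (w x) = pairing_V \<beta> x) \<and> w (\<iota> (coroot \<beta>)) = \<iota> (coroot \<alpha>)"
proof -
  let ?H = "{w. linear w \<and> bij w \<and> (\<forall>\<eta>. \<exists>\<eta>'. w (\<iota> \<eta>) = \<iota> \<eta>') \<and> (\<forall>\<alpha>\<in>R. \<exists>\<beta>\<in>R.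
      (\<forall>x. pairing_V \<alpha> (w x) = pairing_V \<beta> x) \<and> w (\<iota> (coroot \<beta>)) = \<iota> (coroot \<alpha>))}"
  have refl: "affine_reflection \<alpha> 0 \<in> ?H" if \<alpha>: "\<alpha> \<in> R" for \<alpha>
  proof -
    have "\<exists>\<beta>\<in>R. (\<forall>x. pairing_V \<gamma> (affine_reflection \<alpha> 0 x) = pairing_V \<beta> x) \<and>
        affine_reflection \<alpha> 0 (\<iota> (coroot \<beta>)) = \<iota> (coroot \<gamma>)" if \<gamma>: "\<gamma> \<in> R" for \<gamma>
      using s_root_R[OF \<alpha> \<gamma>] pairing_V_reflection[of \<gamma> \<alpha>] reflection_\<iota>
        coroot_s_root[OF \<alpha> s_root_R[OF \<alpha> \<gamma>]] s_root_s_root[OF \<alpha>]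
      by (intro bexI[of _ "s_root \<alpha> \<gamma>"]) auto
    then show ?thesis using linear_reflection bij_affine_reflection[OF \<alpha>] reflection_\<iota> by blast
  qed
  have comp: "f \<circ> g \<in> ?H" if f: "f \<in> ?H" and g: "g \<in> ?H" for f g
  proof -
    have "\<exists>\<beta>\<in>R. (\<forall>x. pairing_V \<alpha> ((f \<circ> g) x) = pairing_V \<beta> x) \<and> (f \<circ> g) (\<iota> (coroot \<beta>)) = \<iota> (coroot \<alpha>)"
      if \<alpha>: "\<alpha> \<in> R" for \<alpha>
    proof -
      obtain \<beta> where \<beta>: "\<beta> \<in> R" "\<forall>x. pairing_V \<alpha> (f x) = pairing_V \<beta> x" "f (\<iota> (coroot \<beta>)) = \<iota> (coroot \<alpha>)"
        using f \<alpha> by blast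
      obtain \<gamma> where "\<gamma> \<in> R" "\<forall>x. pairing_V \<beta> (g x) = pairing_V \<gamma> x" "g (\<iota> (coroot \<gamma>)) = \<iota> (coroot \<beta>)"
        using g \<beta>(1) by blast
      then show ?thesis using \<beta> by (intro bexI[of _ \<gamma>]) auto
    qed
    moreover have "\<exists>\<eta>'. (f \<circ> g) (\<iota> \<eta>) = \<iota> \<eta>'" for \<eta>
    proof -
      obtain \<eta>1 where "g (\<iota> \<eta>) = \<iota> \<eta>1" using g by blast
      moreover obtain \<eta>2 where "f (\<iota> \<eta>1) = \<iota> \<eta>2" using f by blast
      ultimately show ?thesis by auto
    qed
    moreover have "linear (f \<circ> g)" "bij (f \<circ> g)" using f g by (blast intro: linear_compose bij_comp)+
    ultimately show ?thesis by blast
  qed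
  have "W \<subseteq> ?H" unfolding W_def
  proof (rule generate_BijGroup_subset)
    show "id \<in> ?H" using linear_id by auto
    show "f \<circ> g \<in> ?H" if "f \<in> ?H" "g \<in> ?H" for f g by (rule comp[OF that])
    fix f assume "f \<in> {affine_reflection \<alpha> 0 |\<alpha>. \<alpha> \<in> R}"
    then obtain \<alpha> where f: "\<alpha> \<in> R" "f = affine_reflection \<alpha> 0" by blast
    show "bij f" unfolding f(2) by (rule bij_affine_reflection[OF f(1)])
    show "f \<in> ?H" unfolding f(2) by (rule refl[OF f(1)])
    show "inv f \<in> ?H" unfolding f(2) inv_affine_reflection[OF f(1)] by (rule refl[OF f(1)])
  qed
  then have "w \<in> ?H" using assms by blast
  then show "linear w" "bij w" "\<exists>\<eta>'. w (\<iota> \<eta>) = \<iota> \<eta>'"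
    "\<alpha> \<in> R \<Longrightarrow> \<exists>\<beta>\<in>R. (\<forall>x. pairing_V \<alpha> (w x) = pairing_V \<beta> x) \<and> w (\<iota> (coroot \<beta>)) = \<iota> (coroot \<alpha>)"
    by auto
qed

lemma W_id: "id \<in> W"
  using generate.one[of Bij_V] unfolding W_def by simp

lemma W_comp: "v \<in> W \<Longrightarrow> w \<in> W \<Longrightarrow> v \<circ> w \<in> W"
  unfolding W_def by (rule generate_BijGroup_comp) (auto intro: bij_affine_reflection)

lemma W_inv: "w \<in> W \<Longrightarrow> inv w \<in> W"
  unfolding W_def by (rule generate_BijGroup_inv) (auto intro: bij_affine_reflection)

lemma W_refl: "\<alpha> \<in> R \<Longrightarrow> affine_reflection \<alpha> 0 \<in> W"
  unfolding W_def by (rule generate.incl) auto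

lemma translation_comp: "translation u \<circ> translation v = translation (u + v)"
  by (auto simp: translation_def add.assoc)

lemma translation_0: "translation 0 = id"
  by (auto simp: translation_def)

lemma linear_translation: "linear w \<Longrightarrow> w \<circ> translation v = translation (w v) \<circ> w"
  by (auto simp: translation_def linear_add)

lemma bij_translation: "bij (translation v)"
  by (rule o_bij[of "translation (- v)"]) (simp_all add: translation_comp translation_0)

lemma inv_translation: "inv (translation v) = translation (- v)"
  by (rule inv_unique_comp) (simp_all add: translation_comp translation_0)

lemma W_extE:
  assumes "g \<in> W_ext"
  obtains \<eta> w where "w \<in> W" "g = translation (\<iota> \<eta>) \<circ> w"
  using assms by (auto simp: W_ext_def)

lemma W_extI: "w \<in> W \<Longrightarrow> translation (\<iota> \<eta>) \<circ> w \<in> W_ext"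
  by (auto simp: W_ext_def)

lemma W_ext_bij: "g \<in> W_ext \<Longrightarrow> bij g"
  by (auto elim!: W_extE intro: bij_comp W_bij bij_translation)

lemma W_ext_translation: "translation (\<iota> \<eta>) \<in> W_ext"
  using W_extI[OF W_id] by simp

lemma W_W_ext: "w \<in> W \<Longrightarrow> w \<in> W_ext"
  using W_extI[of w 0] by (simp add: \<iota>_simps translation_0)

lemma W_ext_comp:
  assumes "g \<in> W_ext" "h \<in> W_ext"
  shows "g \<circ> h \<in> W_ext"
proof -
  obtain \<eta> v where g: "v \<in> W" "g = translation (\<iota> \<eta>) \<circ> v" using assms(1) by (rule W_extE)
  obtain \<theta> w where h: "w \<in> W" "h = translation (\<iota> \<theta>) \<circ> w" using assms(2) by (rule W_extE)
  obtain \<theta>' where \<theta>': "v (\<iota> \<theta>) = \<iota> \<theta>'" using W_\<iota>[OF g(1)] by blast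
  have "g \<circ> h = translation (\<iota> (\<eta> + \<theta>')) \<circ> (v \<circ> w)"
    using linear_add[OF W_linear[OF g(1)]] by (auto simp: g h \<theta>' \<iota>_simps translation_def)
  then show ?thesis using W_extI W_comp g h by simp
qed

lemma W_ext_inv:
  assumes "g \<in> W_ext"
  shows "inv g \<in> W_ext"
proof -
  obtain \<eta> v where g: "v \<in> W" "g = translation (\<iota> \<eta>) \<circ> v" using assms by (rule W_extE)
  have "inv g = inv v \<circ> translation (\<iota> (- \<eta>))"
    unfolding g(2) using o_inv_distrib[OF bij_translation W_bij[OF g(1)]]
    by (simp add: inv_translation \<iota>_simps)
  then show ?thesis using W_ext_comp W_W_ext[OF W_inv[OF g(1)]] W_ext_translation by simp
qed

lemma affine_reflection_decompose:
  "affine_reflection \<alpha> k = translation (\<iota> (zmul (- k) (coroot \<alpha>))) \<circ> affine_reflection \<alpha> 0"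
  by (rule ext) (simp add: affine_reflection_def translation_def \<iota>_zmul zmul_minus \<iota>_simps scaleR_add_left)

lemma affine_reflection_W_ext: "\<alpha> \<in> R \<Longrightarrow> affine_reflection \<alpha> k \<in> W_ext"
  using W_extI[OF W_refl] by (simp only: affine_reflection_decompose[of \<alpha> k])

lemma aff_W_ext:
  assumes g: "g \<in> W_ext" and \<alpha>: "\<alpha> \<in> R"
  obtains \<beta> l where "\<beta> \<in> R" "aff \<alpha> k \<circ> g = aff \<beta> l"
    "\<And>x c. g (x - c *\<^sub>R \<iota> (coroot \<beta>)) = g x - c *\<^sub>R \<iota> (coroot \<alpha>)"
proof -
  obtain \<eta> w where w: "w \<in> W" "g = translation (\<iota> \<eta>) \<circ> w" using g by (rule W_extE)
  obtain \<beta> where \<beta>: "\<beta> \<in> R" "\<forall>x. pairing_V \<alpha> (w x) = pairing_V \<beta> x" "w (\<iota> (coroot \<beta>)) = \<iota> (coroot \<alpha>)"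
    using W_root[OF w(1) \<alpha>] by blast
  note lin = W_linear[OF w(1)]
  show ?thesis
  proof (rule that[OF \<beta>(1)])
    show "aff \<alpha> k \<circ> g = aff \<beta> (k + pairing \<alpha> \<eta>)"
      by (auto simp: aff_def w(2) translation_def pairing_V_simps \<beta>(2))
    show "g (x - c *\<^sub>R \<iota> (coroot \<beta>)) = g x - c *\<^sub>R \<iota> (coroot \<alpha>)" for x c
      by (simp add: w(2) translation_def linear_diff[OF lin] linear_scale[OF lin] \<beta>(3))
  qed
qed

lemma affine_root_comp: "f \<in> affine_roots \<Longrightarrow> g \<in> W_ext \<Longrightarrow> f \<circ> g \<in> affine_roots"
  by (elim affine_rootsE) (metis aff_W_ext aff_in_affine_roots)

lemma root_refl_conj:
  assumes "f \<in> affine_roots" "g \<in> W_ext"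
  shows "g \<circ> root_refl (f \<circ> g) = root_refl f \<circ> g"
proof -
  obtain \<alpha> k where f: "\<alpha> \<in> R" "f = aff \<alpha> k" using assms(1) by (rule affine_rootsE)
  obtain \<beta> l where \<beta>: "\<beta> \<in> R" "aff \<alpha> k \<circ> g = aff \<beta> l"
      "\<And>x c. g (x - c *\<^sub>R \<iota> (coroot \<beta>)) = g x - c *\<^sub>R \<iota> (coroot \<alpha>)"
    using aff_W_ext[OF assms(2) f(1)] by metis
  have "aff \<beta> l x = aff \<alpha> k (g x)" for x using \<beta>(2) by (metis comp_apply)
  then show ?thesis
    by (auto simp: f(2) \<beta>(2) root_refl_aff affine_reflection_def \<beta>(3) simp flip: aff_def)
qed


subsection \<open>The base alcove and its walls\<close>

text \<open>Negative, because the base alcove lies in the antidominant chamber. The denominator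
  exceeds the pairing of \<open>two_rho\<close> with each positive root, so the values fall in the
  open interval from -1 to 0; the summand 1 also keeps it nonzero when there are no roots.\<close>

definition base_point :: 'v where
  "base_point = - (1 / (1 + (\<Sum>\<beta>\<in>positive_roots. real_of_int (pairing \<beta> two_rho)))) *\<^sub>R \<iota> two_rho"

lemma base_point_alcove: "base_point \<in> base_alcove"
proof -
  define m where "m = 1 + (\<Sum>\<beta>\<in>positive_roots. real_of_int (pairing \<beta> two_rho))"
  have "- 1 < pairing_V \<alpha> base_point \<and> pairing_V \<alpha> base_point < 0" if \<alpha>: "\<alpha> \<in> positive_roots" for \<alpha>
  proof -
    have pos: "0 < real_of_int (pairing \<alpha> two_rho)" using pairing_positive_two_rho[OF \<alpha>] by simp
    have "real_of_int (pairing \<alpha> two_rho) \<le> (\<Sum>\<beta>\<in>positive_roots. real_of_int (pairing \<beta> two_rho))"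
      by (rule member_le_sum[OF \<alpha>]) (auto simp: finite_positive intro: less_imp_le pairing_positive_two_rho)
    then have "real_of_int (pairing \<alpha> two_rho) < m" by (simp add: m_def)
    moreover have "pairing_V \<alpha> base_point = - (real_of_int (pairing \<alpha> two_rho) / m)"
      by (simp add: base_point_def pairing_V_simps m_def)
    ultimately show ?thesis using pos by simp
  qed
  then show ?thesis by (simp add: base_alcove_def)
qed

lemma base_alcove_nonzero:
  assumes "x \<in> base_alcove" "\<alpha> \<in> positive_roots"
  shows "aff \<alpha> k x < 0 \<longleftrightarrow> k \<le> 0" "0 < aff \<alpha> k x \<longleftrightarrow> 0 < k"
proof -
  have x: "- 1 < pairing_V \<alpha> x" "pairing_V \<alpha> x < 0" using assms by (auto simp: base_alcove_def)
  have "real_of_int k \<le> 0 \<or> 1 \<le> real_of_int k" by (cases "k \<le> 0") auto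
  then show "aff \<alpha> k x < 0 \<longleftrightarrow> k \<le> 0" "0 < aff \<alpha> k x \<longleftrightarrow> 0 < k" using x by (auto simp: aff_def)
qed

lemma base_alcove_same_side:
  assumes "x \<in> base_alcove" "y \<in> base_alcove" "f \<in> affine_roots"
  shows "0 < f x * f y"
proof -
  obtain \<alpha> k where f: "\<alpha> \<in> R" "f = aff \<alpha> k" using assms(3) by (rule affine_rootsE)
  have *: "0 < aff \<beta> l x * aff \<beta> l y" if "\<beta> \<in> positive_roots" for \<beta> l
    using base_alcove_nonzero[OF assms(1) that, of l] base_alcove_nonzero[OF assms(2) that, of l]
    by (cases "l \<le> 0") (auto simp: zero_less_mult_iff)
  show ?thesis
  proof (cases "\<alpha> \<in> positive_roots")
    case False
    then have "- \<alpha> \<in> positive_roots" using positive_or_negative f(1) by blast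
    then have "0 < (- f) x * (- f) y" unfolding f(2) uminus_aff by (rule *)
    then show ?thesis by simp
  qed (use * f in simp)
qed

lemma affine_root_base_point: "f \<in> affine_roots \<Longrightarrow> f base_point \<noteq> 0"
  using base_alcove_same_side[OF base_point_alcove base_point_alcove, of f] by auto

text \<open>The defining inequalities of the alcove, as affine roots positive on it. The list may be
  redundant, so the walls have to be extracted from it.\<close>

definition alcove_roots :: "('v \<Rightarrow> real) set" where
  "alcove_roots = (\<lambda>\<alpha>. aff (- \<alpha>) 0) ` positive_roots \<union> (\<lambda>\<alpha>. aff \<alpha> 1) ` positive_roots"

lemma finite_alcove_roots: "finite alcove_roots"
  by (simp add: alcove_roots_def finite_positive)

lemma alcove_roots_affine: "f \<in> alcove_roots \<Longrightarrow> f \<in> affine_roots"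
  using positive_R uminus_R aff_in_affine_roots unfolding alcove_roots_def by blast

lemma base_alcove_eq: "base_alcove = {x. \<forall>f\<in>alcove_roots. 0 < f x}"
  by (fastforce simp: base_alcove_def alcove_roots_def ball_Un aff_def pairing_V_minus)

lemma base_alcoveI:
  assumes "\<And>f. f \<in> affine_roots \<Longrightarrow> 0 < f base_point \<Longrightarrow> 0 < f x"
  shows "x \<in> base_alcove"
  unfolding base_alcove_eq
  using assms alcove_roots_affine base_point_alcove unfolding base_alcove_eq by blast

definition wall_roots :: "('v \<Rightarrow> real) set" where
  "wall_roots = {f \<in> affine_roots. 0 < f base_point \<and>
     affine hull ({x. f x = 0} \<inter> closure base_alcove) = {x. f x = 0}}"

lemma S_aff_eq: "S_aff = root_refl ` wall_roots"
proof
  show "S_aff \<subseteq> root_refl ` wall_roots"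
  proof
    fix r assume "r \<in> S_aff"
    then obtain \<alpha> k where r: "r = affine_reflection \<alpha> k" "\<alpha> \<in> R"
      "affine hull (affine_hyperplane \<alpha> k \<inter> closure base_alcove) = affine_hyperplane \<alpha> k"
      by (auto simp: S_aff_def)
    have h: "affine_hyperplane \<alpha> k = {x. aff \<alpha> k x = 0}" "affine_hyperplane \<alpha> k = {x. aff (- \<alpha>) (- k) x = 0}"
      by (auto simp: affine_hyperplane_def aff_def pairing_V_minus)
    show "r \<in> root_refl ` wall_roots"
    proof (cases "0 < aff \<alpha> k base_point")
      case True
      then have "aff \<alpha> k \<in> wall_roots" using r h aff_in_affine_roots by (auto simp: wall_roots_def)
      then show ?thesis using r root_refl_aff by (metis imageI)
    next
      case False
      then have "0 < aff (- \<alpha>) (- k) base_point"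
        using affine_root_base_point[OF aff_in_affine_roots[OF r(2)], of k]
        by (simp flip: uminus_aff)
      then have "aff (- \<alpha>) (- k) \<in> wall_roots"
        using r h aff_in_affine_roots uminus_R by (auto simp: wall_roots_def)
      then show ?thesis using r root_refl_aff affine_reflection_uminus by (metis imageI)
    qed
  qed
  show "root_refl ` wall_roots \<subseteq> S_aff"
  proof clarify
    fix f assume f: "f \<in> wall_roots"
    then obtain \<alpha> k where \<alpha>: "\<alpha> \<in> R" "f = aff \<alpha> k" by (auto simp: wall_roots_def elim: affine_rootsE)
    have "affine_hyperplane \<alpha> k = {x. f x = 0}" by (auto simp: affine_hyperplane_def aff_def \<alpha>(2))
    then have "affine hull (affine_hyperplane \<alpha> k \<inter> closure base_alcove) = affine_hyperplane \<alpha> k"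
      using f by (simp add: wall_roots_def)
    then show "root_refl f \<in> S_aff" using \<alpha> unfolding S_aff_def \<alpha>(2) root_refl_aff by blast
  qed
qed

text \<open>The midpoint of \<open>x\<close> and its mirror image under \<open>s\<close> lies on the
  hyperplane of \<open>s\<close>, hence on that of \<open>f\<close>; this gives
  \<open>2 f = c s\<close> with an integer \<open>c\<close>, and reducedness leaves only the two
  signs.\<close>

lemma hyperplane_subset:
  assumes f: "f \<in> affine_roots" and s: "s \<in> affine_roots"
    and sub: "{x. s x = 0} \<subseteq> {x. f x = 0}"
  shows "f = s \<or> f = - s"
proof -
  obtain \<alpha> k where \<alpha>: "\<alpha> \<in> R" "f = aff \<alpha> k" using f by (rule affine_rootsE)
  obtain \<beta> l where \<beta>: "\<beta> \<in> R" "s = aff \<beta> l" using s by (rule affine_rootsE)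
  define c where "c = pairing \<alpha> (coroot \<beta>)"
  have e: "2 * (pairing_V \<alpha> x + of_int k) = of_int c * (pairing_V \<beta> x + of_int l)" for x
  proof -
    let ?y = "x - (s x / 2) *\<^sub>R \<iota> (coroot \<beta>)"
    have "s ?y = 0" by (simp add: \<beta>(2) aff_def pairing_V_simps pairing_coroot[OF \<beta>(1)] field_simps)
    then have "f ?y = 0" using sub by auto
    then show ?thesis by (simp add: \<alpha>(2) \<beta>(2) aff_def pairing_V_simps c_def field_simps)
  qed
  have "2 * real_of_int k = of_int c * of_int l" using e[of 0] by (simp add: pairing_V_simps)
  then have kl: "2 * k = c * l" by (metis of_int_eq_iff of_int_mult of_int_numeral)
  have "zmul 2 \<alpha> = zmul c \<beta>"
  proof (rule pairing_eqI)
    fix \<eta>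
    have "real_of_int (2 * (pairing \<alpha> \<eta> + k)) = real_of_int (c * (pairing \<beta> \<eta> + l))"
      using e[of "\<iota> \<eta>"] by (simp add: pairing_V_\<iota>)
    then have "2 * (pairing \<alpha> \<eta> + k) = c * (pairing \<beta> \<eta> + l)" by (simp only: of_int_eq_iff)
    then show "pairing (zmul 2 \<alpha>) \<eta> = pairing (zmul c \<beta>) \<eta>"
      using kl by (simp add: pairing_zmul_left algebra_simps)
  qed
  moreover from this have "c \<noteq> 0" using zmul_eq_zero[of 2 \<alpha>] root_nonzero[OF \<alpha>(1)] by (auto simp: zmul_0)
  ultimately have "\<beta> = \<alpha> \<or> \<beta> = - \<alpha>" using reduced[OF \<alpha>(1) \<beta>(1)] by blast
  then show ?thesis
  proof
    assume "\<beta> = \<alpha>"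
    then have "c = 2" using pairing_coroot[OF \<alpha>(1)] by (simp add: c_def)
    then show ?thesis using kl \<alpha>(2) \<beta>(2) \<open>\<beta> = \<alpha>\<close> by simp
  next
    assume b: "\<beta> = - \<alpha>"
    then have "c = - 2" using pairing_coroot[OF \<alpha>(1)] coroot_uminus[OF \<alpha>(1)]
      by (simp add: c_def pairing_minus_right)
    then show ?thesis using kl \<alpha>(2) \<beta>(2) b by (simp add: uminus_aff)
  qed
qed

lemma closure_alcove_side:
  assumes "q \<in> closure base_alcove" "f \<in> affine_roots"
  shows "0 \<le> f q * f base_point"
proof -
  have "closed {x. 0 \<le> f x * f base_point}"
    by (intro closed_Collect_le continuous_intros continuous_affine_root[OF assms(2)])
  moreover have "base_alcove \<subseteq> {x. 0 \<le> f x * f base_point}"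
    using base_alcove_same_side[OF _ base_point_alcove assms(2)] by (auto intro: less_imp_le)
  ultimately show ?thesis using closure_minimal assms(1) by blast
qed

text \<open>A point of the wall that lies on no other given hyperplane is in the closure of both chambers.\<close>

lemma wall_root_only_separating:
  assumes s: "s \<in> wall_roots" and f: "f \<in> affine_roots"
    and sep: "f base_point * f (root_refl s base_point) < 0"
  shows "f = s \<or> f = - s"
proof (rule ccontr)
  assume n: "\<not> (f = s \<or> f = - s)"
  have sr: "s \<in> affine_roots" using s by (simp add: wall_roots_def)
  obtain \<beta> l where \<beta>: "\<beta> \<in> R" "s = aff \<beta> l" using sr by (rule affine_rootsE)
  have "\<not> {x. s x = 0} \<inter> closure base_alcove \<subseteq> {x. f x = 0}"
  proof
    assume "{x. s x = 0} \<inter> closure base_alcove \<subseteq> {x. f x = 0}"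
    then have "affine hull ({x. s x = 0} \<inter> closure base_alcove) \<subseteq> {x. f x = 0}"
      by (rule hull_minimal) (rule affine_hyperplane_affine_root[OF f])
    then have "{x. s x = 0} \<subseteq> {x. f x = 0}" using s unfolding wall_roots_def by blast
    then show False using hyperplane_subset[OF f sr] n by blast
  qed
  then obtain q where q: "s q = 0" "q \<in> closure base_alcove" "f q \<noteq> 0" by blast
  have G: "root_refl s \<in> W_ext" using affine_reflection_W_ext \<beta> by (simp add: root_refl_aff)
  have "root_refl s q = q" using q(1) by (simp add: root_refl_def)
  then have "0 \<le> f q * f (root_refl s base_point)"
    using closure_alcove_side[OF q(2) affine_root_comp[OF f G]] by simp
  moreover have "0 \<le> f q * f base_point" by (rule closure_alcove_side[OF q(2) f])
  ultimately show False using q(3) sep by (auto simp: zero_le_mult_iff mult_less_0_iff)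
qed

text \<open>In a list of inequalities of least size that still cuts out the alcove, each member is a
  wall: dropping \<open>f\<close> admits a point \<open>z\<close> beyond its hyperplane, and the
  segment from \<open>base_point\<close> to \<open>z\<close> meets that hyperplane where all other
  inequalities are strict.\<close>

lemma alcove_ex_wall_separating:
  assumes q: "q \<notin> base_alcove"
  shows "\<exists>s\<in>wall_roots. s q \<le> 0"
proof -
  let ?p = base_point
  let ?P = "\<lambda>M. {x. \<forall>f\<in>M. 0 < f x} = base_alcove"
  let ?Q = "\<lambda>M. M \<subseteq> alcove_roots \<and> ?P M"
  have "?Q alcove_roots" using base_alcove_eq by simp
  then obtain M where M: "?Q M" and min: "\<And>M'. ?Q M' \<Longrightarrow> card M \<le> card M'"
    using ex_has_least_nat[of ?Q alcove_roots card] by blast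
  have finM: "finite M" using M finite_alcove_roots finite_subset by blast
  obtain f where f: "f \<in> M" "\<not> 0 < f q" using q M by blast
  have MR: "h \<in> affine_roots" if "h \<in> M" for h using M that alcove_roots_affine by blast
  note fr = MR[OF f(1)]
  have ppos: "0 < h ?p" if "h \<in> M" for h using base_point_alcove M that by blast
  have "\<not> ?Q (M - {f})" using min[of "M - {f}"] card_Diff1_less[OF finM f(1)] by linarith
  then obtain z where z: "\<forall>h\<in>M - {f}. 0 < h z" "\<not> 0 < f z"
    using M by blast
  \<comment> \<open>The parameter at which the segment from \<open>base_point\<close> to
    \<open>z\<close> meets the hyperplane of \<open>f\<close>.\<close>
  define t where "t = f ?p / (f ?p - f z)"
  have t: "0 < t" "t \<le> 1" using ppos[OF f(1)] z(2) by (auto simp: t_def field_simps)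
  define y where "y = ?p + t *\<^sub>R (z - ?p)"
  have fy: "f y = 0" unfolding y_def affine_root_convex[OF fr]
    using ppos[OF f(1)] z(2) by (simp add: t_def field_simps)
  have hy: "0 < h y" if h: "h \<in> M - {f}" for h
  proof -
    have "0 < h z" "0 < h ?p" using z(1) h ppos by auto
    then have "0 \<le> (1 - t) * h ?p" "0 < t * h z" using t by auto
    moreover have "h y = (1 - t) * h ?p + t * h z"
      using affine_root_convex[OF MR] h unfolding y_def by blast
    ultimately show ?thesis by linarith
  qed
  \<comment> \<open>Such a point is approached from within the alcove along the segment towards
    \<open>base_point\<close>.\<close>
  have cl: "x \<in> closure base_alcove" if x: "f x = 0" "\<forall>h\<in>M - {f}. 0 < h x" for x
  proof -
    have in_alcove: "x + e *\<^sub>R (?p - x) \<in> base_alcove" if e: "0 < e" "e \<le> 1" for e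
    proof -
      have "0 < h (x + e *\<^sub>R (?p - x))" if h: "h \<in> M" for h
      proof -
        have "0 \<le> h x" using x h by (cases "h = f") (auto intro: less_imp_le)
        then have "0 \<le> (1 - e) * h x" "0 < e * h ?p" using e ppos[OF h] by auto
        then show ?thesis unfolding affine_root_convex[OF MR[OF h]] by linarith
      qed
      then show ?thesis using M by blast
    qed
    have "((\<lambda>n. x + inverse (real (Suc n)) *\<^sub>R (?p - x)) \<longlongrightarrow> x + 0 *\<^sub>R (?p - x)) sequentially"
      by (intro tendsto_intros LIMSEQ_inverse_real_of_nat)
    moreover have "x + inverse (real (Suc n)) *\<^sub>R (?p - x) \<in> base_alcove" for n
      by (rule in_alcove) (auto simp: field_simps)
    ultimately show ?thesis unfolding closure_sequential by (intro exI[of _ "\<lambda>n. x + inverse (real (Suc n)) *\<^sub>R (?p - x)"]) simp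
  qed
  have "affine hull ({x. f x = 0} \<inter> closure base_alcove) = {x. f x = 0}"
  proof
    show "affine hull ({x. f x = 0} \<inter> closure base_alcove) \<subseteq> {x. f x = 0}"
      by (rule hull_minimal) (use affine_hyperplane_affine_root[OF fr] in auto)
    show "{x. f x = 0} \<subseteq> affine hull ({x. f x = 0} \<inter> closure base_alcove)"
    proof
      fix x assume x: "x \<in> {x. f x = 0}"
      \<comment> \<open>A short step from \<open>y\<close> towards \<open>x\<close> keeps the other
        inequalities strict. Both \<open>y\<close> and the new point then lie in the closure, and
        \<open>x\<close> is an affine combination of them.\<close>
      have "\<forall>\<^sub>F e in at_right (0::real). \<forall>h\<in>M - {f}. 0 < h (y + e *\<^sub>R (x - y))"
      proof (rule eventually_ball_finite)
        show "finite (M - {f})" using finM by simp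
        show "\<forall>h\<in>M - {f}. \<forall>\<^sub>F e in at_right 0. 0 < h (y + e *\<^sub>R (x - y))"
        proof
          fix h assume h: "h \<in> M - {f}"
          have "((\<lambda>e. (1 - e) * h y + e * h x) \<longlongrightarrow> (1 - 0) * h y + 0 * h x) (at_right 0)"
            by (intro tendsto_intros)
          then have "((\<lambda>e. h (y + e *\<^sub>R (x - y))) \<longlongrightarrow> h y) (at_right 0)"
            using affine_root_convex[OF MR] h by simp
          then show "\<forall>\<^sub>F e in at_right 0. 0 < h (y + e *\<^sub>R (x - y))"
            using hy[OF h] by (rule order_tendstoD)
        qed
      qed
      moreover have "\<forall>\<^sub>F e in at_right (0::real). 0 < e" by (rule eventually_at_right_less)
      ultimately have "\<forall>\<^sub>F e in at_right (0::real). 0 < e \<and> (\<forall>h\<in>M - {f}. 0 < h (y + e *\<^sub>R (x - y)))"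
        by eventually_elim simp
      then obtain e where e: "0 < e" "\<forall>h\<in>M - {f}. 0 < h (y + e *\<^sub>R (x - y))"
        using eventually_happens trivial_limit_at_right_real by blast
      let ?A = "{x. f x = 0} \<inter> closure base_alcove"
      let ?u = "y + e *\<^sub>R (x - y)"
      have "f ?u = 0" unfolding affine_root_convex[OF fr] using fy x by simp
      then have "?u \<in> affine hull ?A" using cl e(2) by (intro hull_inc) auto
      moreover have "y \<in> affine hull ?A" using cl fy hy by (intro hull_inc) auto
      ultimately have "(1 / e) *\<^sub>R ?u + (1 - 1 / e) *\<^sub>R y \<in> affine hull ?A"
        by (intro mem_affine[OF affine_affine_hull]) auto
      moreover have "(1 / e) *\<^sub>R ?u + (1 - 1 / e) *\<^sub>R y = x"
        using e(1) by (simp add: algebra_simps)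
      ultimately show "x \<in> affine hull ?A" by simp
    qed
  qed
  then have "f \<in> wall_roots" using fr ppos[OF f(1)] by (simp add: wall_roots_def)
  then show ?thesis using f(2) by (intro bexI[of _ f]) auto
qed

lemma finite_separating_roots:
  "finite {f \<in> affine_roots. 0 < f x \<and> f y < 0}"
proof (rule finite_subset)
  show "{f \<in> affine_roots. 0 < f x \<and> f y < 0} \<subseteq>
      (\<Union>\<alpha>\<in>R. aff \<alpha> ` {\<lfloor>- pairing_V \<alpha> x\<rfloor>..\<lceil>- pairing_V \<alpha> y\<rceil>})"
  proof clarify
    fix f assume f: "f \<in> affine_roots" "0 < f x" "f y < 0"
    then obtain \<alpha> k where \<alpha>: "\<alpha> \<in> R" "f = aff \<alpha> k" by (auto elim: affine_rootsE)
    have "- pairing_V \<alpha> x < of_int k" "of_int k < - pairing_V \<alpha> y"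
      using f \<alpha>(2) by (auto simp: aff_def)
    then have "k \<in> {\<lfloor>- pairing_V \<alpha> x\<rfloor>..\<lceil>- pairing_V \<alpha> y\<rceil>}" by (auto; linarith)
    then show "f \<in> (\<Union>\<alpha>\<in>R. aff \<alpha> ` {\<lfloor>- pairing_V \<alpha> x\<rfloor>..\<lceil>- pairing_V \<alpha> y\<rceil>})" using \<alpha> by blast
  qed
  show "finite (\<Union>\<alpha>\<in>R. aff \<alpha> ` {\<lfloor>- pairing_V \<alpha> x\<rfloor>..\<lceil>- pairing_V \<alpha> y\<rceil>})" using finite_R by simp
qed

sublocale rs: reflection_system W_ext affine_roots root_refl wall_roots base_point
proof
  show "\<exists>s\<in>wall_roots. s (g base_point) < 0"
    if "g \<in> W_ext" "f \<in> affine_roots" "0 < f base_point" "f (g base_point) < 0" for g f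
  proof -
    have "g base_point \<notin> base_alcove"
      using base_alcove_same_side[OF base_point_alcove _ that(2), of "g base_point"] that(3,4)
      by (auto simp: zero_less_mult_iff)
    then obtain s where s: "s \<in> wall_roots" "s (g base_point) \<le> 0"
      using alcove_ex_wall_separating by blast
    then have "s (g base_point) \<noteq> 0"
      using affine_root_base_point[OF affine_root_comp[OF _ that(1)], of s] by (simp add: wall_roots_def)
    then show ?thesis using s by (intro bexI[of _ s]) auto
  qed
  show "root_refl f \<in> W_ext" if "f \<in> affine_roots" for f
    using that by (auto elim!: affine_rootsE simp: root_refl_aff affine_reflection_W_ext)
  show "root_refl f \<circ> root_refl f = id" if "f \<in> affine_roots" for f
    using that by (elim affine_rootsE) (simp only: root_refl_aff affine_reflection_involution)
  show "root_refl (- f) = root_refl f" if "f \<in> affine_roots" for f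
    using that by (elim affine_rootsE) (simp only: root_refl_aff uminus_aff affine_reflection_uminus)
  show "f (root_refl f x) = - f x" if "f \<in> affine_roots" for f x
    using that by (elim affine_rootsE) (simp only: root_refl_aff aff_affine_reflection)
  show "f = s \<or> f = - s"
    if "s \<in> wall_roots" "f \<in> affine_roots" "f base_point * f (root_refl s base_point) < 0" for s f
    using wall_root_only_separating that by blast
  show "id \<in> W_ext" using W_W_ext[OF W_id] .
qed (use W_ext_bij W_ext_comp W_ext_inv affine_root_comp affine_root_uminus root_refl_conj
    affine_root_base_point finite_separating_roots in \<open>auto simp: wall_roots_def\<close>)

section \<open>Identification of the groups, the order and the admissible sets\<close>

lemma \<Omega>_eq: "\<Omega> = rs.stab"
proof
  show "\<Omega> \<subseteq> rs.stab"
  proof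
    fix g assume g: "g \<in> \<Omega>"
    then have "g base_point \<in> base_alcove" using base_point_alcove by (auto simp: \<Omega>_def)
    then show "g \<in> rs.stab"
      using g base_alcove_same_side[OF base_point_alcove] 
      by (fastforce simp: rs.stab_def \<Omega>_def zero_less_mult_iff)
  qed
  have sub: "g ` base_alcove \<subseteq> base_alcove" if g: "g \<in> rs.stab" for g
  proof clarify
    fix x assume x: "x \<in> base_alcove"
    have gW: "g \<in> W_ext" using g by (simp add: rs.stab_def)
    show "g x \<in> base_alcove"
    proof (rule base_alcoveI)
      fix f assume f: "f \<in> affine_roots" "0 < f base_point"
      then have "0 < f (g base_point)" using rs.stab_sign[OF g] by blast
      then show "0 < f (g x)"
        using base_alcove_same_side[OF base_point_alcove x affine_root_comp[OF f(1) gW]]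
        by (simp add: zero_less_mult_iff)
    qed
  qed
  show "rs.stab \<subseteq> \<Omega>"
  proof
    fix g assume g: "g \<in> rs.stab"
    have gW: "g \<in> W_ext" using g by (simp add: rs.stab_def)
    have "base_alcove = g ` (inv g ` base_alcove)"
      using W_ext_bij[OF gW] by (simp add: bij_is_surj image_f_inv_f)
    also have "\<dots> \<subseteq> g ` base_alcove" using sub[OF rs.stab_inv[OF g]] by blast
    finally show "g \<in> \<Omega>" using sub[OF g] gW by (auto simp: \<Omega>_def)
  qed
qed

lemma W_aff_eq: "W_aff = rs.words"
proof -
  have "{affine_reflection \<alpha> k | \<alpha> k. \<alpha> \<in> R} = root_refl ` affine_roots"
    by (auto simp: affine_roots_def root_refl_aff image_iff) (metis root_refl_aff)+
  then show ?thesis unfolding W_aff_def by (simp add: rs.generate_refl)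
qed

lemma bruhat_ext_iff: "bruhat_ext x y \<longleftrightarrow> x \<in> W_ext \<and> rs.le x y"
proof -
  have "x \<in> W_ext" if "bruhat_ext x y"
    using that rs.words_G rs.G_comp by (auto simp: bruhat_ext_def W_aff_eq \<Omega>_eq rs.stab_def)
  moreover have "bruhat_ext x y \<longleftrightarrow> rs.le x y" if "x \<in> W_ext"
    using rs.bruhat_stab_iff[OF that, of y]
    unfolding bruhat_ext_def W_aff_eq \<Omega>_eq S_aff_eq by blast
  ultimately show ?thesis by blast
qed

definition orbit :: "'d \<Rightarrow> 'v set" where
  "orbit \<mu> = {w (\<iota> \<mu>) | w. w \<in> W}"

lemma orbit_\<iota>: "v \<in> orbit \<mu> \<Longrightarrow> \<exists>\<eta>. v = \<iota> \<eta>"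
  using W_\<iota> by (auto simp: orbit_def)

lemma orbit_W: "v \<in> orbit \<mu> \<Longrightarrow> w \<in> W \<Longrightarrow> w v \<in> orbit \<mu>"
  unfolding orbit_def using W_comp by (auto; metis comp_apply)

lemma orbit_self: "\<iota> \<mu> \<in> orbit \<mu>"
  using W_id by (auto simp: orbit_def intro!: exI[of _ id])

lemma translation_orbit: "v \<in> orbit \<mu> \<Longrightarrow> translation v \<in> W_ext"
  using orbit_\<iota> W_ext_translation by metis

lemma W_words: "w \<in> W \<Longrightarrow> w \<in> rs.words"
proof -
  have "W \<subseteq> W_aff"
    unfolding W_def W_aff_def by (rule group.mono_generate[OF group_BijGroup]) auto
  then show "w \<in> W \<Longrightarrow> w \<in> rs.words" by (auto simp: W_aff_eq)
qed

text \<open>Conjugation by \<sigma> carries the reflection of \<open>f\<close> to that of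
  \<open>f \<circ> inv \<sigma>\<close>, so it permutes the generating reflections.\<close>

lemma stab_normalizes_words:
  assumes "\<sigma> \<in> rs.stab" "w \<in> rs.words"
  shows "\<exists>w'\<in>rs.words. \<sigma> \<circ> w = w' \<circ> \<sigma>"
proof -
  have sG: "\<sigma> \<in> W_ext" using assms(1) by (simp add: rs.stab_def)
  have "rs.words \<subseteq> {w. w \<in> rs.words \<and> (\<exists>w'\<in>rs.words. \<sigma> \<circ> w = w' \<circ> \<sigma>)}" (is "_ \<subseteq> ?H")
  proof -
    have refl: "root_refl f \<in> ?H" if f: "f \<in> affine_roots" for f
    proof -
      let ?h = "f \<circ> inv \<sigma>"
      have h: "?h \<in> affine_roots" using affine_root_comp[OF f W_ext_inv[OF sG]] .
      have "?h \<circ> \<sigma> = f" using W_ext_bij[OF sG] by (simp add: comp_assoc bij_is_inj)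
      then have "\<sigma> \<circ> root_refl f = root_refl ?h \<circ> \<sigma>" using root_refl_conj[OF h sG] by simp
      then show ?thesis using rs.refl_words f h by blast
    qed
    have "generate Bij_V (root_refl ` affine_roots) \<subseteq> ?H"
    proof (rule generate_BijGroup_subset)
      have "\<sigma> \<circ> id = id \<circ> \<sigma>" by simp
      then show "id \<in> ?H" using rs.id_words by blast
      show "f \<circ> g \<in> ?H" if fg: "f \<in> ?H" "g \<in> ?H" for f g
      proof -
        obtain f' where f': "f' \<in> rs.words" "\<sigma> \<circ> f = f' \<circ> \<sigma>" using fg by blast
        obtain g' where g': "g' \<in> rs.words" "\<sigma> \<circ> g = g' \<circ> \<sigma>" using fg by blast
        have "\<sigma> \<circ> (f \<circ> g) = (f' \<circ> g') \<circ> \<sigma>" using f'(2) g'(2) by (metis comp_assoc)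
        then show ?thesis using fg f' g' rs.words_comp by blast
      qed
      show "f \<in> ?H" if "f \<in> root_refl ` affine_roots" for f using refl that by blast
      show "inv f \<in> ?H" if "f \<in> root_refl ` affine_roots" for f
      proof -
        obtain h where h: "h \<in> affine_roots" "f = root_refl h" using \<open>f \<in> root_refl ` affine_roots\<close> by blast
        show ?thesis unfolding h(2) rs.inv_refl[OF h(1)] by (rule refl[OF h(1)])
      qed
      show "bij f" if "f \<in> root_refl ` affine_roots" for f using that rs.refl_G rs.G_bij by blast
    qed
    then show ?thesis by (simp only: rs.generate_refl)
  qed
  then show ?thesis using assms(2) by blast
qed

text \<open>The coset of \<open>\<tau> \<mu>\<close> contains every translation from the orbit,
  since these are conjugates of one another under \<open>W\<close>, which consists of words, and
  \<open>stab\<close> normalizes the words. Elements comparable under \<open>rs.le\<close> lie in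
  the same coset.\<close>

lemma Adm_eq: "Adm \<mu> = {x. \<exists>v\<in>orbit \<mu>. rs.le x (translation v)}"
proof -
  obtain u \<sigma> where u: "u \<in> rs.words" "\<sigma> \<in> rs.stab" "translation (\<iota> \<mu>) = u \<circ> \<sigma>"
    using rs.word_stab_decomposition[OF W_ext_translation] .
  have coset: "W_aff #>\<^bsub>Bij_V\<^esub> \<rho> = (\<lambda>f. f \<circ> \<rho>) ` rs.words" if "\<rho> \<in> rs.stab" for \<rho>
    unfolding W_aff_eq
    by (rule r_coset_BijGroup_UNIV) (use that rs.words_G rs.G_bij in \<open>auto simp: rs.stab_def\<close>)
  have \<tau>: "\<tau> \<mu> = \<sigma>"
    unfolding \<tau>_def
  proof (rule the_equality)
    show "\<sigma> \<in> \<Omega> \<and> translation (\<iota> \<mu>) \<in> W_aff #>\<^bsub>Bij_V\<^esub> \<sigma>" using u coset by (auto simp: \<Omega>_eq)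
    show "\<rho> = \<sigma>" if mem: "\<rho> \<in> \<Omega> \<and> translation (\<iota> \<mu>) \<in> W_aff #>\<^bsub>Bij_V\<^esub> \<rho>" for \<rho>
    proof -
      have \<rho>: "\<rho> \<in> rs.stab" using mem by (simp add: \<Omega>_eq)
      then obtain v where "v \<in> rs.words" "translation (\<iota> \<mu>) = v \<circ> \<rho>"
        using mem unfolding coset[OF \<rho>] by blast
      then show ?thesis using rs.decomposition_unique[OF _ u(1) \<rho> u(2)] u(3) by metis
    qed
  qed
  have in_coset: "x \<in> W_aff #>\<^bsub>Bij_V\<^esub> \<tau> \<mu>" if w: "w \<in> W" and le: "rs.le x (translation (w (\<iota> \<mu>)))" for x w
  proof -
    have lin: "linear w" "bij w" using W_linear[OF w] W_bij[OF w] by auto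
    have "translation (w (\<iota> \<mu>)) = translation (w (\<iota> \<mu>)) \<circ> w \<circ> inv w"
      using lin(2) by (simp add: comp_assoc bij_is_surj surj_iff[THEN iffD1])
    also have "\<dots> = w \<circ> (u \<circ> \<sigma>) \<circ> inv w" by (simp only: linear_translation[OF lin(1), symmetric] u(3))
    finally have t: "translation (w (\<iota> \<mu>)) = w \<circ> u \<circ> (\<sigma> \<circ> inv w)" by (simp add: comp_assoc)
    obtain w' where w': "w' \<in> rs.words" "\<sigma> \<circ> inv w = w' \<circ> \<sigma>"
      using stab_normalizes_words[OF u(2) W_words[OF W_inv[OF w]]] by blast
    have t: "translation (w (\<iota> \<mu>)) = (w \<circ> u \<circ> w') \<circ> \<sigma>" unfolding t w'(2) by (simp add: comp_assoc)
    obtain a where a: "a \<in> rs.words" "translation (w (\<iota> \<mu>)) = a \<circ> x" using rs.le_words[OF le] by blast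
    have "x = inv a \<circ> (a \<circ> x)"
      using rs.G_bij[OF rs.words_G[OF a(1)]] by (simp flip: comp_assoc add: bij_is_inj)
    also have "\<dots> = (inv a \<circ> (w \<circ> u \<circ> w')) \<circ> \<sigma>" using a(2) t by (simp add: comp_assoc)
    finally have "x = (inv a \<circ> (w \<circ> u \<circ> w')) \<circ> \<sigma>" .
    moreover have "inv a \<circ> (w \<circ> u \<circ> w') \<in> rs.words"
      using a(1) w' u(1) W_words[OF w] rs.words_comp rs.words_inv by simp
    ultimately show ?thesis unfolding \<tau> coset[OF u(2)] by blast
  qed
  have "rs.le x (translation v) \<Longrightarrow> v \<in> orbit \<mu> \<Longrightarrow> x \<in> W_ext" for x v
    using rs.le_G translation_orbit by blast
  then show ?thesis using in_coset unfolding Adm_def bruhat_ext_iff orbit_def by blast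
qed

lemma Adm_W_ext: "x \<in> Adm \<mu> \<Longrightarrow> x \<in> W_ext"
  using rs.le_G translation_orbit by (auto simp: Adm_eq)


section \<open>The semi-infinite orders\<close>

definition regular :: "'v \<Rightarrow> bool" where
  "regular v \<longleftrightarrow> (\<forall>\<alpha>\<in>R. pairing_V \<alpha> v \<noteq> 0)"

text \<open>The step of \<open>rs.up\<close> with \<open>base_point\<close> replaced, as the point
  of comparison, by the point at infinity in direction \<open>- v\<close>: every reflection is
  oriented towards \<open>v\<close>.\<close>

definition semi_up :: "'v \<Rightarrow> ('v \<Rightarrow> 'v) \<Rightarrow> ('v \<Rightarrow> 'v) \<Rightarrow> bool" where
  "semi_up v x y \<longleftrightarrow> x \<in> W_ext \<and> (\<exists>\<alpha>\<in>R. \<exists>k. y = affine_reflection \<alpha> k \<circ> x \<and>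
     0 < pairing_V \<alpha> v \<and> aff \<alpha> k (x base_point) < 0)"

definition semi_le :: "'v \<Rightarrow> ('v \<Rightarrow> 'v) \<Rightarrow> ('v \<Rightarrow> 'v) \<Rightarrow> bool" where
  "semi_le v = (semi_up v)\<^sup>*\<^sup>*"

lemma semi_le_refl: "semi_le v x x"
  by (simp add: semi_le_def)

lemma semi_le_trans: "semi_le v x y \<Longrightarrow> semi_le v y z \<Longrightarrow> semi_le v x z"
  by (simp add: semi_le_def)

lemma semi_up_le: "semi_up v x y \<Longrightarrow> semi_le v x y"
  by (auto simp: semi_le_def)

lemma affine_reflection_translation:
  "affine_reflection \<alpha> k \<circ> translation v = translation (affine_reflection \<alpha> 0 v) \<circ> affine_reflection \<alpha> k"
proof
  fix x
  show "(affine_reflection \<alpha> k \<circ> translation v) x = (translation (affine_reflection \<alpha> 0 v) \<circ> affine_reflection \<alpha> k) x"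
    by (simp add: affine_reflection_def translation_def pairing_V_simps scaleR_add_left)
qed

lemma regular_W: "regular v \<Longrightarrow> w \<in> W \<Longrightarrow> regular (w v)"
  unfolding regular_def using W_root by metis

lemma semi_up_left:
  assumes w: "w \<in> W" and up: "semi_up v x y"
  shows "semi_up (w v) (translation (\<iota> \<eta>) \<circ> w \<circ> x) (translation (\<iota> \<eta>) \<circ> w \<circ> y)"
proof -
  define g where "g = translation (\<iota> \<eta>) \<circ> w"
  have g: "g \<in> W_ext" using W_extI[OF w] by (simp add: g_def)
  note bg = W_ext_bij[OF g]
  obtain \<alpha> k where x: "x \<in> W_ext" "\<alpha> \<in> R" "y = affine_reflection \<alpha> k \<circ> x" "0 < pairing_V \<alpha> v"
      "aff \<alpha> k (x base_point) < 0"
    using up by (auto simp: semi_up_def)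
  obtain \<beta> l where \<beta>: "\<beta> \<in> R" "aff \<alpha> k \<circ> inv g = aff \<beta> l"
    using aff_W_ext[OF W_ext_inv[OF g] x(2)] by metis
  have \<beta>': "aff \<beta> l u = aff \<alpha> k (inv g u)" for u using \<beta>(2) by (metis comp_apply)
  have \<beta>g: "aff \<beta> l \<circ> g = aff \<alpha> k" using bg by (auto simp: \<beta>' bij_is_inj)
  \<comment> \<open>The gradient of the new root at \<open>w v\<close> is read off as a difference
    of values at \<open>w v\<close> and at 0, for which the preimages under the affine map
    \<open>g\<close> are compared.\<close>
  have "g (v + inv g 0) = w v + g (inv g 0)"
    using linear_add[OF W_linear[OF w]] by (simp add: g_def translation_def)
  then have "g (v + inv g 0) = w v" using bg by (simp add: bij_is_surj surj_f_inv_f)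
  then have "inv g (w v) = v + inv g 0" using bg by (metis bij_inv_eq_iff)
  then have "pairing_V \<beta> (w v) = pairing_V \<alpha> v"
    using \<beta>'[of "w v"] \<beta>'[of 0] by (simp add: aff_def pairing_V_simps)
  moreover have "g \<circ> y = affine_reflection \<beta> l \<circ> (g \<circ> x)"
    using root_refl_conj[OF aff_in_affine_roots[OF \<beta>(1)] g, of l] \<beta>g x(3)
    by (simp add: root_refl_aff flip: comp_assoc)
  moreover have "aff \<beta> l ((g \<circ> x) base_point) < 0"
    using x(5) bg by (simp add: \<beta>' bij_is_inj)
  ultimately show ?thesis
    using W_ext_comp[OF g x(1)] \<beta>(1) x(4) unfolding semi_up_def g_def[symmetric]
    by (intro conjI bexI[of _ \<beta>] exI[of _ l]) simp_all
qed

lemma semi_le_left: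
  assumes w: "w \<in> W" and le: "semi_le v x y"
  shows "semi_le (w v) (translation (\<iota> \<eta>) \<circ> w \<circ> x) (translation (\<iota> \<eta>) \<circ> w \<circ> y)"
  using le unfolding semi_le_def
proof (induction rule: rtranclp_induct)
  case (step y z)
  then show ?case using semi_up_left[OF w step(2), of \<eta>] by (metis rtranclp.rtrancl_into_rtrancl)
qed (rule rtranclp.rtrancl_refl)

lemma semi_le_translation_left:
  "semi_le v x y \<Longrightarrow> semi_le v (translation (\<iota> \<eta>) \<circ> x) (translation (\<iota> \<eta>) \<circ> y)"
  using semi_le_left[OF W_id, of v x y \<eta>] by (simp add: comp_assoc)

text \<open>The translation by \<open>\<alpha>\<^sup>\<or>\<close> is the product of the reflections in two consecutive hyperplanes
  parallel to \<open>\<alpha> = 0\<close>; the base point minus \<open>\<alpha>\<^sup>\<or>\<close> lies below the first of them.\<close>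

lemma semi_le_coroot_translation:
  assumes \<alpha>: "\<alpha> \<in> R" and v: "0 < pairing_V \<alpha> v"
  shows "semi_le v (translation (\<iota> (- coroot \<alpha>))) id"
proof -
  \<comment> \<open>With this \<open>k\<close> the value of \<alpha> + \<open>k\<close> at
    \<open>base_point\<close> lies strictly between 1 and 2, so both reflections below start from
    the negative side of their hyperplanes.\<close>
  define k where "k = \<lceil>1 - pairing_V \<alpha> base_point\<rceil>"
  let ?t = "translation (\<iota> (- coroot \<alpha>))"
  have "aff \<alpha> (k - 1) base_point \<noteq> 0" using affine_root_base_point[OF aff_in_affine_roots[OF \<alpha>]] .
  then have k: "1 - pairing_V \<alpha> base_point < of_int k" "of_int k < 2 - pairing_V \<alpha> base_point"
    unfolding k_def by (auto simp: aff_def) linarith+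
  have at: "pairing_V \<alpha> (?t base_point) = pairing_V \<alpha> base_point - 2"
    by (simp add: translation_def pairing_V_simps pairing_minus_right pairing_coroot[OF \<alpha>])
  have tG: "?t \<in> W_ext" by (rule W_ext_translation)
  have 1: "semi_up v ?t (affine_reflection \<alpha> k \<circ> ?t)"
    unfolding semi_up_def using tG \<alpha> v k at by (intro conjI bexI[of _ \<alpha>] exI[of _ k]) (auto simp: aff_def)
  have "aff \<alpha> (k - 1) ((affine_reflection \<alpha> k \<circ> ?t) base_point) < 0"
    using aff_affine_reflection[OF \<alpha>, of k "?t base_point"] k(1) at by (simp add: aff_def)
  then have 2: "semi_up v (affine_reflection \<alpha> k \<circ> ?t) (affine_reflection \<alpha> (k - 1) \<circ> (affine_reflection \<alpha> k \<circ> ?t))"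
    unfolding semi_up_def using W_ext_comp[OF affine_reflection_W_ext[OF \<alpha>] tG] \<alpha> v by blast
  have "affine_reflection \<alpha> (k - 1) (affine_reflection \<alpha> k y) = y + \<iota> (coroot \<alpha>)" for y
  proof -
    have "aff \<alpha> (k - 1) (affine_reflection \<alpha> k y) = - aff \<alpha> k y - 1"
      using aff_affine_reflection[OF \<alpha>, of k y] by (simp add: aff_def)
    then show ?thesis
      by (simp add: affine_reflection_aff[of \<alpha> "k - 1"]) (simp add: affine_reflection_aff algebra_simps)
  qed
  then have "affine_reflection \<alpha> (k - 1) \<circ> (affine_reflection \<alpha> k \<circ> ?t) = id"
    by (auto simp: translation_def \<iota>_simps)
  then show ?thesis using semi_le_trans[OF semi_up_le[OF 1] semi_up_le[OF 2]] by simp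
qed

lemma semi_le_coroot_multiple:
  assumes \<alpha>: "\<alpha> \<in> R" and v: "0 < pairing_V \<alpha> v"
  shows "semi_le v (translation (\<iota> (\<eta> - zmul (int n) (coroot \<alpha>)))) (translation (\<iota> \<eta>))"
proof (induction n)
  case 0
  show ?case by (simp add: zmul_0 semi_le_refl)
next
  case (Suc n)
  let ?\<theta> = "\<eta> - zmul (int n) (coroot \<alpha>)"
  have "semi_le v (translation (\<iota> ?\<theta>) \<circ> translation (\<iota> (- coroot \<alpha>))) (translation (\<iota> ?\<theta>) \<circ> id)"
    by (rule semi_le_translation_left[OF semi_le_coroot_translation[OF assms]])
  then have "semi_le v (translation (\<iota> (?\<theta> + - coroot \<alpha>))) (translation (\<iota> ?\<theta>))"
    by (simp only: translation_comp comp_id \<iota>_simps(1)[symmetric])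
  moreover have "?\<theta> + - coroot \<alpha> = \<eta> - zmul (int (Suc n)) (coroot \<alpha>)"
    by (simp add: zmul_add_left zmul_1 algebra_simps)
  ultimately show ?case using semi_le_trans[OF _ Suc] by (simp only:)
qed


subsection \<open>Dominant representatives\<close>

lemma pairing_V_positive_nonneg:
  assumes \<beta>: "\<beta> \<in> positive_roots" and nonneg: "\<And>\<alpha>. \<alpha> \<in> \<Delta> \<Longrightarrow> 0 \<le> pairing_V \<alpha> x"
  shows "0 \<le> pairing_V \<beta> x"
proof -
  obtain f :: "'c \<Rightarrow> nat" where f: "\<beta> = (\<Sum>\<gamma>\<in>\<Delta>. zmul (int (f \<gamma>)) \<gamma>)"
    using \<beta> by (auto simp: positive_roots_def)
  have lin: "linear (\<lambda>x. \<Sum>\<gamma>\<in>\<Delta>. real (f \<gamma>) * pairing_V \<gamma> x)"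
    by (rule linearI) (simp_all add: pairing_V_simps sum.distrib sum_distrib_left algebra_simps)
  have "pairing_V \<beta> x = (\<Sum>\<gamma>\<in>\<Delta>. real (f \<gamma>) * pairing_V \<gamma> x)"
    by (rule linear_eqI[OF linear_pairing_V lin])
      (simp add: pairing_V_\<iota> f pairing_sum_left pairing_zmul_left)
  then show ?thesis using nonneg by (simp add: sum_nonneg)
qed

text \<open>For regular \<open>x\<close> this is the length of the element of \<open>W\<close> that
  brings \<open>x\<close> into the dominant chamber.\<close>

definition neg_count :: "'v \<Rightarrow> nat" where
  "neg_count x = card {\<beta> \<in> positive_roots. pairing_V \<beta> x < 0}"

lemma neg_count_reflection:
  assumes \<alpha>: "\<alpha> \<in> \<Delta>" and neg: "pairing_V \<alpha> x < 0"
  shows "neg_count (affine_reflection \<alpha> 0 x) < neg_count x"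
proof -
  have \<alpha>R: "\<alpha> \<in> R" using \<alpha> simple_subset by auto
  let ?A = "{\<beta> \<in> positive_roots. pairing_V \<beta> (affine_reflection \<alpha> 0 x) < 0}"
  let ?B = "{\<beta> \<in> positive_roots. pairing_V \<beta> x < 0}"
  have "inj_on (s_root \<alpha>) ?A" by (rule inj_on_inverseI[of _ "s_root \<alpha>"]) (rule s_root_s_root[OF \<alpha>R])
  moreover have "s_root \<alpha> ` ?A \<subseteq> ?B - {\<alpha>}"
  proof clarify
    fix \<beta> assume \<beta>: "\<beta> \<in> positive_roots" "pairing_V \<beta> (affine_reflection \<alpha> 0 x) < 0"
    have "\<beta> \<noteq> \<alpha>" using \<beta>(2) neg by (auto simp: pairing_V_reflection s_root_self[OF \<alpha>R] pairing_V_minus)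
    then show "s_root \<alpha> \<beta> \<in> ?B - {\<alpha>}"
      using s_root_simple_positive[OF \<alpha> \<beta>(1)] \<beta>(2) by (simp add: pairing_V_reflection)
  qed
  moreover have fin: "finite ?B" using finite_positive by simp
  ultimately have "card ?A \<le> card (?B - {\<alpha>})" by (intro card_inj_on_le) auto
  also have "\<dots> < card ?B"
    by (rule card_Diff1_less[OF fin]) (use \<alpha> neg simple_positive in auto)
  finally show ?thesis by (simp add: neg_count_def)
qed

lemma regular_dominant_or_neg:
  assumes "regular x"
  shows "(\<forall>\<beta>\<in>positive_roots. 0 < pairing_V \<beta> x) \<or> (\<exists>\<alpha>\<in>\<Delta>. pairing_V \<alpha> x < 0)"
proof (rule disjCI)
  assume "\<not> (\<exists>\<alpha>\<in>\<Delta>. pairing_V \<alpha> x < 0)"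
  then have "0 \<le> pairing_V \<beta> x" if "\<beta> \<in> positive_roots" for \<beta>
    using pairing_V_positive_nonneg[OF that, of x] by (meson not_le)
  then show "\<forall>\<beta>\<in>positive_roots. 0 < pairing_V \<beta> x"
    using assms positive_R unfolding regular_def by (metis order_le_less)
qed

lemma regular_conjugate_dominant:
  assumes "regular v"
  shows "\<exists>w\<in>W. \<forall>\<beta>\<in>positive_roots. 0 < pairing_V \<beta> (w v)"
  using assms
proof (induction "neg_count v" arbitrary: v rule: less_induct)
  case less
  show ?case
  proof (cases "\<exists>\<alpha>\<in>\<Delta>. pairing_V \<alpha> v < 0")
    case True
    then obtain \<alpha> where \<alpha>: "\<alpha> \<in> \<Delta>" "pairing_V \<alpha> v < 0" by blast
    have sW: "affine_reflection \<alpha> 0 \<in> W" using \<alpha>(1) simple_subset W_refl by auto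
    obtain w where w: "w \<in> W" "\<forall>\<beta>\<in>positive_roots. 0 < pairing_V \<beta> (w (affine_reflection \<alpha> 0 v))"
      using less.hyps[OF neg_count_reflection[OF \<alpha>] regular_W[OF less.prems sW]] by blast
    then show ?thesis using W_comp[OF w(1) sW] by (intro bexI[of _ "w \<circ> affine_reflection \<alpha> 0"]) auto
  next
    case False
    then show ?thesis using regular_dominant_or_neg[OF less.prems] W_id by (intro bexI[of _ id]) auto
  qed
qed

text \<open>Composition with \<open>u\<close> takes positive roots to positive roots, so
  \<open>u\<close> maps \<open>base_point\<close> into the base alcove and lies in
  \<open>stab\<close>; a word with this property is trivial.\<close>

lemma W_id_of_dominant:
  assumes u: "u \<in> W" and v: "\<forall>\<beta>\<in>positive_roots. 0 < pairing_V \<beta> v"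
    and uv: "\<forall>\<beta>\<in>positive_roots. 0 < pairing_V \<beta> (u v)"
  shows "u = id"
proof (rule rs.words_stab_id[OF W_words[OF u]])
  have "u base_point \<in> base_alcove"
    unfolding base_alcove_def mem_Collect_eq
  proof
    fix \<alpha> assume \<alpha>: "\<alpha> \<in> positive_roots"
    obtain \<beta> where \<beta>: "\<beta> \<in> R" "\<forall>x. pairing_V \<alpha> (u x) = pairing_V \<beta> x"
      using W_root[OF u positive_R[OF \<alpha>]] by blast
    have "0 < pairing_V \<beta> v" using uv \<alpha> \<beta>(2) by metis
    then have "- \<beta> \<notin> positive_roots" using v pairing_V_minus[of \<beta> v] by fastforce
    then have "\<beta> \<in> positive_roots" using positive_or_negative[OF \<beta>(1)] by blast
    then show "- 1 < pairing_V \<alpha> (u base_point) \<and> pairing_V \<alpha> (u base_point) < 0"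
      using base_point_alcove \<beta>(2) by (simp add: base_alcove_def)
  qed
  then show "u \<in> rs.stab"
    using base_alcove_same_side[OF base_point_alcove] W_W_ext[OF u]
    by (fastforce simp: rs.stab_def zero_less_mult_iff)
qed

definition dominant :: "'d \<Rightarrow> bool" where
  "dominant \<mu> \<longleftrightarrow> (\<forall>\<beta>\<in>positive_roots. 0 \<le> pairing \<beta> \<mu>)"

text \<open>If a simple root \<alpha> is negative on \<open>u (w v)\<close>, then \<alpha> composed
  with \<open>u\<close> is a negative root, so by dominance its reflection adds a nonnegative
  multiple of \<open>coroot \<alpha>\<close> to \<open>u (\<iota> \<mu>)\<close>. Pulled back by
  \<open>w\<close>, this coroot belongs to a root positive on \<open>v\<close>, so the translation
  goes up.\<close>

lemma semi_le_orbit_aux: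
  assumes \<mu>: "dominant \<mu>" and w: "w \<in> W" and v: "regular v"
    and wv: "\<forall>\<beta>\<in>positive_roots. 0 < pairing_V \<beta> (w v)" and u: "u \<in> W"
  shows "semi_le v (translation (inv w (u (\<iota> \<mu>)))) (translation (inv w (\<iota> \<mu>)))"
  using u
proof (induction "neg_count (u (w v))" arbitrary: u rule: less_induct)
  case less
  note u = less.prems
  have reg: "regular (u (w v))" using regular_W v w u by blast
  show ?case
  proof (cases "\<exists>\<alpha>\<in>\<Delta>. pairing_V \<alpha> (u (w v)) < 0")
    case False
    then have "u = id" using W_id_of_dominant[OF u wv] regular_dominant_or_neg[OF reg] by blast
    then show ?thesis by (simp add: semi_le_refl)
  next
    case True
    then obtain \<alpha> where \<alpha>: "\<alpha> \<in> \<Delta>" "pairing_V \<alpha> (u (w v)) < 0" by blast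
    have \<alpha>R: "\<alpha> \<in> R" using \<alpha>(1) simple_subset by auto
    let ?s = "affine_reflection \<alpha> 0"
    have su: "?s \<circ> u \<in> W" using W_comp[OF W_refl[OF \<alpha>R] u] .
    have IH: "semi_le v (translation (inv w (?s (u (\<iota> \<mu>))))) (translation (inv w (\<iota> \<mu>)))"
      using less.hyps[OF _ su] neg_count_reflection[OF \<alpha>] by simp
    obtain \<eta> where \<eta>: "u (\<iota> \<mu>) = \<iota> \<eta>" using W_\<iota>[OF u] by blast
    obtain \<beta> where \<beta>: "\<beta> \<in> R" "\<forall>x. pairing_V \<alpha> (u x) = pairing_V \<beta> x" using W_root[OF u \<alpha>R] by blast
    have "pairing_V \<beta> (w v) < 0" using \<alpha>(2) \<beta>(2) by simp
    then have "\<beta> \<notin> positive_roots" using wv by fastforce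
    then have "- \<beta> \<in> positive_roots" using positive_or_negative[OF \<beta>(1)] by blast
    then have "0 \<le> pairing (- \<beta>) \<mu>" using \<mu> by (simp add: dominant_def)
    moreover have "real_of_int (pairing \<alpha> \<eta>) = real_of_int (pairing \<beta> \<mu>)"
      using \<beta>(2) \<eta> pairing_V_\<iota> by metis
    ultimately have "pairing \<alpha> \<eta> \<le> 0" by (simp add: pairing_minus_left)
    then obtain n where n: "pairing \<alpha> \<eta> = - int n" by (metis minus_minus nonneg_int_cases neg_0_le_iff_le)
    obtain \<gamma> where \<gamma>: "\<gamma> \<in> R" "\<forall>x. pairing_V \<alpha> (w x) = pairing_V \<gamma> x" "w (\<iota> (coroot \<gamma>)) = \<iota> (coroot \<alpha>)"
      using W_root[OF w \<alpha>R] by blast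
    have \<gamma>v: "0 < pairing_V \<gamma> v" using \<gamma>(2) wv simple_positive[OF \<alpha>(1)] by metis
    obtain \<theta> where \<theta>: "inv w (\<iota> \<eta>) = \<iota> \<theta>" using W_\<iota>[OF W_inv[OF w]] by blast
    have "inv w (\<iota> (coroot \<alpha>)) = \<iota> (coroot \<gamma>)"
      using \<gamma>(3) W_bij[OF w] by (metis bij_inv_eq_iff)
    then have "inv w (?s (u (\<iota> \<mu>))) = \<iota> (\<theta> + zmul (int n) (coroot \<gamma>))"
      using W_linear[OF W_inv[OF w]]
      by (simp add: \<eta> reflection_\<iota> s_coroot_def n \<iota>_simps \<iota>_zmul linear_add linear_scale linear_diff linear_neg \<theta> zmul_minus)
    moreover have "semi_le v (translation (\<iota> (\<theta> + zmul (int n) (coroot \<gamma>) - zmul (int n) (coroot \<gamma>))))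
        (translation (\<iota> (\<theta> + zmul (int n) (coroot \<gamma>))))"
      by (rule semi_le_coroot_multiple[OF \<gamma>(1) \<gamma>v])
    ultimately have "semi_le v (translation (inv w (u (\<iota> \<mu>)))) (translation (inv w (?s (u (\<iota> \<mu>)))))"
      by (simp add: \<eta> \<theta>)
    then show ?thesis using IH semi_le_trans by blast
  qed
qed

text \<open>The quantifier over \<mu> stands inside that over \<open>w\<close>: one \<open>w\<close>
  gives the greatest translation in every dominant orbit.\<close>

lemma semi_le_orbit:
  assumes v: "regular v"
  shows "\<exists>w\<in>W. \<forall>\<mu>. dominant \<mu> \<longrightarrow> (\<forall>x\<in>orbit \<mu>. semi_le v (translation x) (translation (w (\<iota> \<mu>))))"
proof -
  obtain w where w: "w \<in> W" "\<forall>\<beta>\<in>positive_roots. 0 < pairing_V \<beta> (w v)"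
    using regular_conjugate_dominant[OF v] by blast
  have "semi_le v (translation x) (translation (inv w (\<iota> \<mu>)))" if \<mu>: "dominant \<mu>" and x: "x \<in> orbit \<mu>" for \<mu> x
  proof -
    obtain u where u: "u \<in> W" "x = u (\<iota> \<mu>)" using x by (auto simp: orbit_def)
    show ?thesis
      using semi_le_orbit_aux[OF \<mu> w(1) v w(2) W_comp[OF w(1) u(1)]] W_bij[OF w(1)] u(2)
      by (simp add: bij_is_inj)
  qed
  then show ?thesis using W_inv[OF w(1)] by blast
qed


section \<open>Admissible sets\<close>

text \<open>The set that Haines and Ngo call strongly permissible.\<close>

definition Perm :: "'d \<Rightarrow> ('v \<Rightarrow> 'v) set" where
  "Perm \<mu> = {x \<in> W_ext. \<forall>v. regular v \<longrightarrow> (\<exists>l\<in>orbit \<mu>. semi_le v x (translation l))}"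

text \<open>Orient the root so that it is positive on \<open>v\<close>. If \<open>x p\<close> is on
  the negative side, the given reflection is already a step from \<open>x\<close> up to
  \<open>y\<close>. Otherwise \<open>p\<close> is on the positive side: the bound for
  \<open>y\<close> at the reflected direction is reflected back to \<open>t r\<close>, with
  \<open>t\<close> an orbit translation and \<open>r\<close> the affine reflection, and
  \<open>r\<close> is below the identity because \<open>r p\<close> is on the negative side.\<close>

lemma Perm_up_closed:
  assumes up: "rs.up x y" and y: "y \<in> Perm \<mu>"
  shows "x \<in> Perm \<mu>"
proof -
  have xG: "x \<in> W_ext" using rs.up_G[OF up] by simp
  have "\<exists>l\<in>orbit \<mu>. semi_le v x (translation l)" if v: "regular v" for v
  proof -
    obtain f where f: "f \<in> affine_roots" "y = root_refl f \<circ> x" "0 < f base_point * f (x base_point)"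
      using up by (auto simp: rs.up_def)
    obtain \<alpha> k where \<alpha>: "\<alpha> \<in> R" "y = affine_reflection \<alpha> k \<circ> x"
        "0 < aff \<alpha> k base_point * aff \<alpha> k (x base_point)" "0 < pairing_V \<alpha> v"
    proof -
      obtain \<beta> l where \<beta>: "\<beta> \<in> R" "f = aff \<beta> l" using f(1) by (rule affine_rootsE)
      show thesis
      proof (cases "0 < pairing_V \<beta> v")
        case True
        then show thesis using that \<beta> f by (simp add: root_refl_aff)
      next
        case False
        then have "0 < pairing_V (- \<beta>) v" using v \<beta>(1) by (simp add: regular_def pairing_V_minus order_less_le)
        moreover have "aff (- \<beta>) (- l) z = - f z" for z by (simp add: \<beta>(2) flip: uminus_aff)
        ultimately show thesis
          using that[of "- \<beta>" "- l"] uminus_R[OF \<beta>(1)] f \<beta>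
          by (simp add: affine_reflection_uminus root_refl_aff)
      qed
    qed
    let ?s = "affine_reflection \<alpha> 0" and ?r = "affine_reflection \<alpha> k"
    show ?thesis
    proof (cases "aff \<alpha> k (x base_point) < 0")
      case True
      then have "semi_le v x y" using xG \<alpha> by (intro semi_up_le) (auto simp: semi_up_def)
      then show ?thesis using y v semi_le_trans unfolding Perm_def by blast
    next
      case False
      then have p: "0 < aff \<alpha> k base_point" using \<alpha>(3) by (auto simp: zero_less_mult_iff)
      have sW: "?s \<in> W" using W_refl[OF \<alpha>(1)] .
      obtain l where l: "l \<in> orbit \<mu>" "semi_le (?s v) y (translation l)"
        using y regular_W[OF v sW] unfolding Perm_def by blast
      have "semi_le (?s (?s v)) (?r \<circ> y) (?r \<circ> translation l)"
        using semi_le_left[OF sW l(2)] by (simp only: affine_reflection_decompose[of \<alpha> k])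
      moreover have "?s (?s v) = v" using affine_reflection_involution[OF \<alpha>(1), of 0] by (metis comp_apply id_apply)
      moreover have "?r \<circ> y = x"
        unfolding \<alpha>(2) using affine_reflection_involution[OF \<alpha>(1), of k] by (simp flip: comp_assoc)
      ultimately have 1: "semi_le v x (translation (?s l) \<circ> ?r)"
        by (simp add: affine_reflection_translation)
      have sl: "?s l \<in> orbit \<mu>" using orbit_W[OF l(1) sW] .
      then obtain \<eta> where \<eta>: "?s l = \<iota> \<eta>" using orbit_\<iota> by blast
      have "aff \<alpha> k (?r base_point) < 0" using aff_affine_reflection[OF \<alpha>(1), of k base_point] p by simp
      then have "semi_up v ?r (?r \<circ> ?r)"
        unfolding semi_up_def using affine_reflection_W_ext[OF \<alpha>(1)] \<alpha>(1,4) by blast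
      then have "semi_le v ?r id" using affine_reflection_involution[OF \<alpha>(1), of k] semi_up_le by metis
      then have "semi_le v (translation (?s l) \<circ> ?r) (translation (?s l))"
        using semi_le_translation_left[of v ?r id \<eta>] \<eta> by simp
      then show ?thesis using 1 sl semi_le_trans by blast
    qed
  qed
  then show ?thesis using xG by (simp add: Perm_def)
qed

lemma Adm_subset_Perm: "Adm \<mu> \<subseteq> Perm \<mu>"
proof
  fix x assume "x \<in> Adm \<mu>"
  then obtain l where l: "l \<in> orbit \<mu>" "rs.le x (translation l)" by (auto simp: Adm_eq)
  have "translation l \<in> Perm \<mu>"
    using l(1) translation_orbit semi_le_refl unfolding Perm_def by blast
  with l(2) show "x \<in> Perm \<mu>" unfolding rs.le_def
    by (induction rule: converse_rtranclp_induct) (use Perm_up_closed in blast)+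
qed

text \<open>Only left multiplication respects the orders. With \<open>u\<close> the linear part of
  \<open>x\<close>, the hypothesis on \<open>y\<close> is used at \<open>inv u v\<close>, and the
  resulting translation is moved to the left of \<open>x\<close> by \<open>u\<close>. After
  \<open>x\<close> is bounded, commuting the translations allows the other one to be raised as
  well.\<close>

lemma Perm_comp:
  assumes \<mu>: "dominant \<mu>" and \<nu>: "dominant \<nu>" and x: "x \<in> Perm \<mu>" and y: "y \<in> Perm \<nu>"
  shows "x \<circ> y \<in> Perm (\<mu> + \<nu>)"
proof -
  have G: "x \<in> W_ext" "y \<in> W_ext" using x y by (auto simp: Perm_def)
  obtain \<eta> u where u: "u \<in> W" "x = translation (\<iota> \<eta>) \<circ> u" using G(1) by (rule W_extE)
  have "\<exists>l\<in>orbit (\<mu> + \<nu>). semi_le v (x \<circ> y) (translation l)" if v: "regular v" for v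
  proof -
    have uv: "u (inv u v) = v" using W_bij[OF u(1)] by (simp add: bij_is_surj surj_f_inv_f)
    obtain l' where l': "l' \<in> orbit \<nu>" "semi_le (inv u v) y (translation l')"
      using y regular_W[OF v W_inv[OF u(1)]] unfolding Perm_def by blast
    obtain l where l: "l \<in> orbit \<mu>" "semi_le v x (translation l)"
      using x v unfolding Perm_def by blast
    have ul': "u l' \<in> orbit \<nu>" using orbit_W[OF l'(1) u(1)] .
    then obtain \<theta> where \<theta>: "u l' = \<iota> \<theta>" using orbit_\<iota> by blast
    obtain w where w: "w \<in> W" "\<And>\<mu> x. dominant \<mu> \<Longrightarrow> x \<in> orbit \<mu> \<Longrightarrow> semi_le v (translation x) (translation (w (\<iota> \<mu>)))"
      using semi_le_orbit[OF v] by blast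
    obtain \<kappa> where \<kappa>: "w (\<iota> \<mu>) = \<iota> \<kappa>" using W_\<iota>[OF w(1)] by blast
    have "semi_le v (x \<circ> y) (x \<circ> translation l')"
      using semi_le_left[OF u(1) l'(2), of \<eta>] by (simp only: u(2) uv)
    also have "x \<circ> translation l' = translation (u l') \<circ> x"
      using linear_add[OF W_linear[OF u(1)]] by (auto simp: u(2) translation_def)
    finally have 1: "semi_le v (x \<circ> y) (translation (u l') \<circ> x)" .
    have 2: "semi_le v (translation (u l') \<circ> x) (translation (u l') \<circ> translation (w (\<iota> \<mu>)))"
      using semi_le_translation_left[OF semi_le_trans[OF l(2) w(2)[OF \<mu> l(1)]], of \<theta>] by (simp only: \<theta>)
    have comm: "translation (u l') \<circ> translation (w (\<iota> \<mu>)) = translation (w (\<iota> \<mu>)) \<circ> translation (u l')"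
      by (simp add: translation_comp add.commute)
    have 3: "semi_le v (translation (w (\<iota> \<mu>)) \<circ> translation (u l')) (translation (w (\<iota> \<mu>)) \<circ> translation (w (\<iota> \<nu>)))"
      using semi_le_translation_left[OF w(2)[OF \<nu> ul'], of \<kappa>] by (simp only: \<kappa>)
    have "translation (w (\<iota> \<mu>)) \<circ> translation (w (\<iota> \<nu>)) = translation (w (\<iota> (\<mu> + \<nu>)))"
      using linear_add[OF W_linear[OF w(1)]] by (simp add: translation_comp \<iota>_simps)
    then have "semi_le v (x \<circ> y) (translation (w (\<iota> (\<mu> + \<nu>))))"
      using 1 2 3 comm semi_le_trans by metis
    moreover have "w (\<iota> (\<mu> + \<nu>)) \<in> orbit (\<mu> + \<nu>)" using orbit_W[OF orbit_self w(1)] .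
    ultimately show ?thesis by blast
  qed
  then show ?thesis using W_ext_comp[OF G] by (simp add: Perm_def)
qed

text \<open>A root negative at \<open>base_point\<close> and positive at \<open>q\<close> has a
  gradient positive on \<open>q - base_point\<close>. Adding a small multiple of
  \<open>base_point\<close>, on which no root vanishes, preserves these signs and makes the vector
  regular.\<close>

lemma ex_acute_direction:
  "\<exists>v. regular v \<and> (\<forall>\<alpha>\<in>R. \<forall>k. aff \<alpha> k base_point < 0 \<longrightarrow> 0 < aff \<alpha> k q \<longrightarrow> 0 < pairing_V \<alpha> v)"
proof -
  let ?v = "\<lambda>e. (q - base_point) + e *\<^sub>R base_point"
  have "\<forall>\<^sub>F e in at_right (0::real). \<forall>\<alpha>\<in>R. pairing_V \<alpha> (?v e) \<noteq> 0 \<and>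
      (0 < pairing_V \<alpha> (q - base_point) \<longrightarrow> 0 < pairing_V \<alpha> (?v e))"
  proof (rule eventually_ball_finite[OF finite_R], rule ballI)
    fix \<alpha> assume \<alpha>: "\<alpha> \<in> R"
    let ?d = "pairing_V \<alpha> (q - base_point)"
    have eq: "pairing_V \<alpha> (?v e) = ?d + e * pairing_V \<alpha> base_point" for e by (simp add: pairing_V_simps)
    have "((\<lambda>e. ?d + e * pairing_V \<alpha> base_point) \<longlongrightarrow> ?d + 0 * pairing_V \<alpha> base_point) (at_right 0)"
      by (intro tendsto_intros)
    then have lim: "((\<lambda>e. pairing_V \<alpha> (?v e)) \<longlongrightarrow> ?d) (at_right 0)" using eq by simp
    consider "0 < ?d" | "?d < 0" | "?d = 0" by linarith
    then show "\<forall>\<^sub>F e in at_right 0. pairing_V \<alpha> (?v e) \<noteq> 0 \<and> (0 < ?d \<longrightarrow> 0 < pairing_V \<alpha> (?v e))"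
    proof cases
      case 1
      then show ?thesis using order_tendstoD(1)[OF lim 1] by (auto elim!: eventually_mono)
    next
      case 2
      then show ?thesis using order_tendstoD(2)[OF lim 2] by (auto elim!: eventually_mono)
    next
      case 3
      have "pairing_V \<alpha> base_point \<noteq> 0"
        using affine_root_base_point[OF aff_in_affine_roots[OF \<alpha>, of 0]] by (simp add: aff_def)
      then show ?thesis using eventually_at_right_less[of "0::real"] 3
        by (auto elim!: eventually_mono simp: eq)
    qed
  qed
  then obtain e where e: "\<forall>\<alpha>\<in>R. pairing_V \<alpha> (?v e) \<noteq> 0 \<and>
      (0 < pairing_V \<alpha> (q - base_point) \<longrightarrow> 0 < pairing_V \<alpha> (?v e))"
    using eventually_happens trivial_limit_at_right_real by blast
  have "0 < pairing_V \<alpha> (?v e)" if "\<alpha> \<in> R" "aff \<alpha> k base_point < 0" "0 < aff \<alpha> k q" for \<alpha> k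
  proof -
    have "0 < pairing_V \<alpha> (q - base_point)" using that(2,3) by (simp add: aff_def pairing_V_simps)
    then show ?thesis using e that(1) by blast
  qed
  then show ?thesis using e unfolding regular_def by blast
qed

text \<open>Translating a step by \<eta> shifts its affine root to one that is still negative at the
  moved chamber, and negative at \<open>base_point\<close> once its gradient is large on \<eta>;
  then it is a step of \<open>rs.up\<close>. A finite chain imposes finitely many such bounds,
  collected in \<open>c\<close>.\<close>

lemma semi_le_imp_translated_le:
  assumes "semi_le v x y"
  shows "\<exists>c. \<forall>\<eta>. (\<forall>\<alpha>\<in>R. 0 < pairing_V \<alpha> v \<longrightarrow> c < pairing_V \<alpha> (\<iota> \<eta>)) \<longrightarrow>
    rs.le (translation (\<iota> \<eta>) \<circ> x) (translation (\<iota> \<eta>) \<circ> y)"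
  using assms unfolding semi_le_def
proof (induction rule: rtranclp_induct)
  case base
  show ?case using rs.le_refl by blast
next
  case (step y z)
  obtain c where c: "\<And>\<eta>. \<forall>\<alpha>\<in>R. 0 < pairing_V \<alpha> v \<longrightarrow> c < pairing_V \<alpha> (\<iota> \<eta>) \<Longrightarrow>
      rs.le (translation (\<iota> \<eta>) \<circ> x) (translation (\<iota> \<eta>) \<circ> y)" using step.IH by blast
  obtain \<alpha> k where \<alpha>: "y \<in> W_ext" "\<alpha> \<in> R" "z = affine_reflection \<alpha> k \<circ> y" "0 < pairing_V \<alpha> v"
      "aff \<alpha> k (y base_point) < 0"
    using step(2) unfolding semi_up_def by blast
  show ?case
  proof (intro exI allI impI)
    fix \<eta> assume \<eta>: "\<forall>\<beta>\<in>R. 0 < pairing_V \<beta> v \<longrightarrow> max c (aff \<alpha> k base_point) < pairing_V \<beta> (\<iota> \<eta>)"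
    let ?t = "translation (\<iota> \<eta>)" and ?h = "aff \<alpha> (k - pairing \<alpha> \<eta>)"
    have h: "?h \<in> affine_roots" using aff_in_affine_roots[OF \<alpha>(2)] .
    have ht: "?h \<circ> ?t = aff \<alpha> k" by (auto simp: aff_def translation_def pairing_V_simps)
    have "aff \<alpha> k base_point < pairing_V \<alpha> (\<iota> \<eta>)" using \<eta> \<alpha>(2,4) by auto
    then have 1: "?h base_point < 0" by (simp add: aff_def pairing_V_simps)
    have "(?h \<circ> ?t) (y base_point) < 0" unfolding ht by (rule \<alpha>(5))
    then have 2: "?h ((?t \<circ> y) base_point) < 0" by simp
    have "?t \<circ> z = root_refl ?h \<circ> (?t \<circ> y)"
      using root_refl_conj[OF h W_ext_translation, of \<eta>] unfolding ht root_refl_aff \<alpha>(3) by (metis comp_assoc)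
    then have "rs.up (?t \<circ> y) (?t \<circ> z)"
      unfolding rs.up_def using h mult_neg_neg[OF 1 2] W_ext_comp[OF W_ext_translation \<alpha>(1)] by blast
    moreover have "rs.le (?t \<circ> x) (?t \<circ> y)" using c \<eta> by simp
    ultimately show "rs.le (?t \<circ> x) (?t \<circ> z)" using rs.up_le rs.le_trans by blast
  qed
qed

lemma Perm_subset_Adm: "Perm \<mu> \<subseteq> Adm \<mu>"
proof
  fix x assume x: "x \<in> Perm \<mu>"
  have xG: "x \<in> W_ext" using x by (simp add: Perm_def)
  obtain v where v: "regular v"
      and acute: "\<And>\<alpha> k. \<alpha> \<in> R \<Longrightarrow> aff \<alpha> k base_point < 0 \<Longrightarrow> 0 < aff \<alpha> k (x base_point) \<Longrightarrow> 0 < pairing_V \<alpha> v"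
    using ex_acute_direction[of "x base_point"] by blast
  obtain l where l: "l \<in> orbit \<mu>" "semi_le v x (translation l)" using x v unfolding Perm_def by blast
  obtain c where c: "\<And>\<eta>. \<forall>\<alpha>\<in>R. 0 < pairing_V \<alpha> v \<longrightarrow> c < pairing_V \<alpha> (\<iota> \<eta>) \<Longrightarrow>
      rs.le (translation (\<iota> \<eta>) \<circ> x) (translation (\<iota> \<eta>) \<circ> translation l)"
    using semi_le_imp_translated_le[OF l(2)] by blast
  obtain w where w: "w \<in> W" "\<forall>\<beta>\<in>positive_roots. 0 < pairing_V \<beta> (w v)"
    using regular_conjugate_dominant[OF v] by blast
  \<comment> \<open>An integral vector in the Weyl chamber of \<open>v\<close>; a large multiple of
    it is the translation that goes far enough.\<close>
  obtain \<theta> where \<theta>: "inv w (\<iota> two_rho) = \<iota> \<theta>" using W_\<iota>[OF W_inv[OF w(1)]] by blast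
  have \<theta>1: "1 \<le> pairing \<alpha> \<theta>" if \<alpha>: "\<alpha> \<in> R" "0 < pairing_V \<alpha> v" for \<alpha>
  proof -
    obtain \<beta> where \<beta>: "\<beta> \<in> R" "\<forall>x. pairing_V \<alpha> (inv w x) = pairing_V \<beta> x"
      using W_root[OF W_inv[OF w(1)] \<alpha>(1)] by blast
    have "pairing_V \<beta> (w v) = pairing_V \<alpha> v"
      using \<beta>(2)[rule_format, of "w v"] W_bij[OF w(1)] by (simp add: bij_is_inj)
    then have "0 < pairing_V \<beta> (w v)" using \<alpha>(2) by simp
    then have "- \<beta> \<notin> positive_roots" using w(2) pairing_V_minus[of \<beta> "w v"] by fastforce
    then have "\<beta> \<in> positive_roots" using positive_or_negative[OF \<beta>(1)] by blast
    then have "0 < pairing \<beta> two_rho" by (rule pairing_positive_two_rho)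
    moreover have "real_of_int (pairing \<alpha> \<theta>) = real_of_int (pairing \<beta> two_rho)"
      using \<beta>(2) \<theta> pairing_V_\<iota> by metis
    ultimately show ?thesis by simp
  qed
  \<comment> \<open>The absolute value serves two purposes: exceeding \<open>c\<close> yields the
    Bruhat relation, and positivity makes the lengths add up in the cancellation.\<close>
  define n where "n = nat (\<lceil>\<bar>c\<bar>\<rceil> + 1)"
  have n: "\<bar>c\<bar> < real n" unfolding n_def by linarith
  define \<eta> where "\<eta> = zmul (int n) \<theta>"
  have big: "\<bar>c\<bar> < pairing_V \<alpha> (\<iota> \<eta>)" if "\<alpha> \<in> R" "0 < pairing_V \<alpha> v" for \<alpha>
  proof -
    have "real n * 1 \<le> real n * real_of_int (pairing \<alpha> \<theta>)"
      using \<theta>1[OF that] by (intro mult_left_mono) simp_all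
    then show ?thesis using n by (simp add: \<eta>_def pairing_V_\<iota> pairing_zmul_right)
  qed
  let ?t = "translation (\<iota> \<eta>)"
  have le: "rs.le (?t \<circ> x) (?t \<circ> translation l)"
  proof (rule c, intro ballI impI)
    fix \<alpha> assume "\<alpha> \<in> R" "0 < pairing_V \<alpha> v"
    then show "c < pairing_V \<alpha> (\<iota> \<eta>)" using big[of \<alpha>] by linarith
  qed
  have "rs.le x (translation l)"
  proof (rule rs.le_cancel[OF W_ext_translation xG translation_orbit[OF l(1)] le])
    fix f assume f: "f \<in> affine_roots" "0 < f base_point" "f (x base_point) < 0"
    obtain \<alpha> k where \<alpha>: "\<alpha> \<in> R" "f = aff \<alpha> k" using f(1) by (rule affine_rootsE)
    have "aff (- \<alpha>) (- k) z = - f z" for z by (simp add: \<alpha>(2) flip: uminus_aff)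
    then have "0 < pairing_V (- \<alpha>) v" using acute[OF uminus_R[OF \<alpha>(1)], of "- k"] f(2,3) by simp
    then have "\<bar>c\<bar> < pairing_V (- \<alpha>) (\<iota> \<eta>)" by (rule big[OF uminus_R[OF \<alpha>(1)]])
    then have "pairing_V \<alpha> (\<iota> \<eta>) < 0" by (simp add: pairing_V_minus)
    then show "0 < f (inv ?t base_point)"
      unfolding inv_translation using f(2)
      by (simp add: translation_def \<alpha>(2) aff_def pairing_V_simps)
  qed
  then show "x \<in> Adm \<mu>" using l(1) by (auto simp: Adm_eq)
qed

lemma Adm_add:
  assumes "dominant \<mu>" "dominant \<nu>"
  shows "Adm (\<mu> + \<nu>) = {x \<circ> y | x y. x \<in> Adm \<mu> \<and> y \<in> Adm \<nu>}"
proof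
  show "{x \<circ> y | x y. x \<in> Adm \<mu> \<and> y \<in> Adm \<nu>} \<subseteq> Adm (\<mu> + \<nu>)"
    using Perm_comp[OF assms] Adm_subset_Perm Perm_subset_Adm by blast
  show "Adm (\<mu> + \<nu>) \<subseteq> {x \<circ> y | x y. x \<in> Adm \<mu> \<and> y \<in> Adm \<nu>}"
  proof
    fix x assume "x \<in> Adm (\<mu> + \<nu>)"
    then obtain w where w: "w \<in> W" "rs.le x (translation (w (\<iota> (\<mu> + \<nu>))))" by (auto simp: Adm_eq orbit_def)
    have "translation (w (\<iota> (\<mu> + \<nu>))) = translation (w (\<iota> \<mu>)) \<circ> translation (w (\<iota> \<nu>))"
      using linear_add[OF W_linear[OF w(1)]] by (simp add: translation_comp \<iota>_simps)
    then have le: "rs.le x (translation (w (\<iota> \<mu>)) \<circ> translation (w (\<iota> \<nu>)))" using w(2) by simp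
    have orb: "w (\<iota> \<mu>) \<in> orbit \<mu>" "w (\<iota> \<nu>) \<in> orbit \<nu>" using orbit_W[OF orbit_self w(1)] by auto
    then show "x \<in> {x \<circ> y | x y. x \<in> Adm \<mu> \<and> y \<in> Adm \<nu>}"
      using rs.le_comp_factor[OF translation_orbit[OF orb(1)] le] unfolding Adm_eq by blast
  qed
qed


subsection \<open>Parahoric level\<close>

text \<open>Conjugating a translation by \<open>root_refl s\<close> gives another one from the same
  orbit. Right lifting puts \<open>x s\<close> below \<open>t\<close> or \<open>t s\<close>; in the
  second case left lifting puts \<open>x s\<close> or \<open>s x s\<close> below
  \<open>s t s\<close>.\<close>

lemma Adm_simple_swap:
  assumes x: "x \<in> Adm \<mu>" and s: "s \<in> wall_roots"
  shows "x \<circ> root_refl s \<in> Adm \<mu> \<or> root_refl s \<circ> x \<circ> root_refl s \<in> Adm \<mu>"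
proof -
  obtain l where l: "l \<in> orbit \<mu>" "rs.le x (translation l)" using x by (auto simp: Adm_eq)
  have sr: "s \<in> affine_roots" using rs.S_root[OF s] .
  obtain \<alpha> k where \<alpha>: "\<alpha> \<in> R" "s = aff \<alpha> k" using sr by (rule affine_rootsE)
  have conj: "root_refl s \<circ> (translation l \<circ> root_refl s) = translation (affine_reflection \<alpha> 0 l)"
  proof -
    have "root_refl s \<circ> (translation l \<circ> root_refl s) =
        translation (affine_reflection \<alpha> 0 l) \<circ> (affine_reflection \<alpha> k \<circ> affine_reflection \<alpha> k)"
      by (simp only: \<alpha>(2) root_refl_aff comp_assoc[symmetric] affine_reflection_translation)
    then show ?thesis by (simp add: affine_reflection_involution[OF \<alpha>(1)])
  qed
  have orb: "affine_reflection \<alpha> 0 l \<in> orbit \<mu>" using orbit_W[OF l(1) W_refl[OF \<alpha>(1)]] .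
  from rs.le_simple_right[OF l(2) s] show ?thesis
  proof
    assume "rs.le (x \<circ> root_refl s) (translation l)"
    then show ?thesis using l(1) by (auto simp: Adm_eq)
  next
    assume "rs.le (x \<circ> root_refl s) (translation l \<circ> root_refl s)"
    then show ?thesis using rs.le_simple_left'[OF _ s] orb unfolding conj[symmetric] Adm_eq
      by (metis (mono_tags, lifting) comp_assoc conj mem_Collect_eq)
  qed
qed

text \<open>Letter by letter, a simple reflection to the right of an admissible element is absorbed
  into it or passes to its left.\<close>

lemma Adm_parahoric_swap:
  assumes J: "J \<subseteq> S_aff" and u: "u \<in> generate Bij_V J" and x: "x \<in> Adm \<mu>"
  shows "\<exists>u'\<in>generate Bij_V J. \<exists>x'\<in>Adm \<mu>. x \<circ> u = u' \<circ> x'"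
proof -
  have bij: "bij r" if "r \<in> J" for r using that J rs.simple_bij by (auto simp: S_aff_eq)
  let ?H = "{u \<in> generate Bij_V J. \<forall>x\<in>Adm \<mu>. \<exists>u'\<in>generate Bij_V J. \<exists>x'\<in>Adm \<mu>. x \<circ> u = u' \<circ> x'}"
  have id: "id \<in> generate Bij_V J" using generate.one[of Bij_V J] by simp
  have simple: "r \<in> ?H \<and> inv r = r" if r: "r \<in> J" for r
  proof -
    obtain s where s: "s \<in> wall_roots" "r = root_refl s" using r J by (auto simp: S_aff_eq)
    have rJ: "r \<in> generate Bij_V J" using generate.incl[OF r] .
    have "\<exists>u'\<in>generate Bij_V J. \<exists>x'\<in>Adm \<mu>. x \<circ> r = u' \<circ> x'" if x: "x \<in> Adm \<mu>" for x
      using Adm_simple_swap[OF x s(1)] unfolding s(2)[symmetric]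
    proof
      assume "x \<circ> r \<in> Adm \<mu>"
      then show ?thesis using id by (intro bexI[of _ id] bexI[of _ "x \<circ> r"]) auto
    next
      assume a: "r \<circ> x \<circ> r \<in> Adm \<mu>"
      have "x \<circ> r = r \<circ> (r \<circ> x \<circ> r)"
        using rs.refl_refl_comp[OF rs.S_root[OF s(1)], of "x \<circ> r"] by (simp add: s(2) comp_assoc)
      then show ?thesis using a rJ by blast
    qed
    then show ?thesis using rJ rs.inv_refl[OF rs.S_root[OF s(1)]] s(2) by blast
  qed
  have "generate Bij_V J \<subseteq> ?H"
  proof (rule generate_BijGroup_subset[OF bij])
    have "x \<circ> id = id \<circ> x" for x :: "'v \<Rightarrow> 'v" by simp
    then show "id \<in> ?H" using id by blast
    show "r \<in> ?H" if "r \<in> J" for r using simple[OF that] by blast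
    show "inv r \<in> ?H" if "r \<in> J" for r using simple[OF that] by metis
    show "f \<circ> g \<in> ?H" if f: "f \<in> ?H" and g: "g \<in> ?H" for f g
    proof -
      have "\<exists>u'\<in>generate Bij_V J. \<exists>x'\<in>Adm \<mu>. x \<circ> (f \<circ> g) = u' \<circ> x'" if x: "x \<in> Adm \<mu>" for x
      proof -
        obtain u1 x1 where 1: "u1 \<in> generate Bij_V J" "x1 \<in> Adm \<mu>" "x \<circ> f = u1 \<circ> x1" using f x by blast
        obtain u2 x2 where 2: "u2 \<in> generate Bij_V J" "x2 \<in> Adm \<mu>" "x1 \<circ> g = u2 \<circ> x2" using g 1(2) by blast
        have "x \<circ> (f \<circ> g) = (u1 \<circ> u2) \<circ> x2" using 1(3) 2(3) by (metis comp_assoc)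
        then show ?thesis using generate_BijGroup_comp[OF bij 1(1) 2(1)] 2(2) by blast
      qed
      then show ?thesis using generate_BijGroup_comp[OF bij] f g by blast
    qed
  qed
  then show ?thesis using u x by blast
qed

lemma Adm_J_eq:
  assumes J: "J \<subseteq> S_aff"
  shows "Adm_J J \<mu> = {u \<circ> x \<circ> u' | u x u'. u \<in> generate Bij_V J \<and> x \<in> Adm \<mu> \<and> u' \<in> generate Bij_V J}"
proof -
  have bijJ: "bij r" if "r \<in> J" for r using that J rs.simple_bij by (auto simp: S_aff_eq)
  have bij: "bij u" if "u \<in> generate Bij_V J" for u by (rule bij_generate_BijGroup[OF bijJ that])
  have bijA: "bij x" if "x \<in> Adm \<mu>" for x using Adm_W_ext[OF that] by (rule W_ext_bij)
  have 1: "generate Bij_V J <#>\<^bsub>Bij_V\<^esub> Adm \<mu> = {u \<circ> x | u x. u \<in> generate Bij_V J \<and> x \<in> Adm \<mu>}"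
    by (rule set_mult_BijGroup_UNIV[OF bij bijA])
  have "bij f" if f: "f \<in> {u \<circ> x | u x. u \<in> generate Bij_V J \<and> x \<in> Adm \<mu>}" for f
  proof -
    obtain u x where "f = u \<circ> x" "u \<in> generate Bij_V J" "x \<in> Adm \<mu>" using f by blast
    then show ?thesis using bij_comp[OF bijA bij] by metis
  qed
  then have 2: "{u \<circ> x | u x. u \<in> generate Bij_V J \<and> x \<in> Adm \<mu>} <#>\<^bsub>Bij_V\<^esub> generate Bij_V J =
      {f \<circ> g | f g. f \<in> {u \<circ> x | u x. u \<in> generate Bij_V J \<and> x \<in> Adm \<mu>} \<and> g \<in> generate Bij_V J}"
    by (rule set_mult_BijGroup_UNIV[OF _ bij])
  show ?thesis unfolding Adm_J_def 1 2 by blast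
qed

theorem Adm_J_add:
  assumes J: "J \<subseteq> S_aff" and \<mu>: "dominant \<mu>" and \<nu>: "dominant \<nu>"
  shows "Adm_J J (\<mu> + \<nu>) = Adm_J J \<mu> <#>\<^bsub>Bij_V\<^esub> Adm_J J \<nu>"
proof -
  let ?J = "generate Bij_V J"
  have bijJ: "bij r" if "r \<in> J" for r using that J rs.simple_bij by (auto simp: S_aff_eq)
  have bij: "bij f" if fJ: "f \<in> Adm_J J \<kappa>" for f \<kappa>
  proof -
    obtain u x u' where f: "f = u \<circ> x \<circ> u'" "u \<in> ?J" "x \<in> Adm \<kappa>" "u' \<in> ?J"
      using fJ unfolding Adm_J_eq[OF J] by blast
    then have "bij u" "bij x" "bij u'" using bij_generate_BijGroup[of J] bijJ Adm_W_ext W_ext_bij by blast+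
    then show ?thesis unfolding f(1) by (intro bij_comp)
  qed
  have comp: "f \<circ> g \<in> ?J" if "f \<in> ?J" "g \<in> ?J" for f g
    by (rule generate_BijGroup_comp[OF bijJ that])
  have id: "id \<in> ?J" using generate.one[of Bij_V J] by simp
  have prod: "Adm_J J \<mu> <#>\<^bsub>Bij_V\<^esub> Adm_J J \<nu> = {f \<circ> g | f g. f \<in> Adm_J J \<mu> \<and> g \<in> Adm_J J \<nu>}"
    by (rule set_mult_BijGroup_UNIV) (use bij in auto)
  show ?thesis unfolding prod
  proof
    show "Adm_J J (\<mu> + \<nu>) \<subseteq> {f \<circ> g | f g. f \<in> Adm_J J \<mu> \<and> g \<in> Adm_J J \<nu>}"
    proof
      fix f assume "f \<in> Adm_J J (\<mu> + \<nu>)"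
      then obtain u z u' where f: "f = u \<circ> z \<circ> u'" "u \<in> ?J" "z \<in> Adm (\<mu> + \<nu>)" "u' \<in> ?J"
        unfolding Adm_J_eq[OF J] by blast
      then obtain x y where xy: "z = x \<circ> y" "x \<in> Adm \<mu>" "y \<in> Adm \<nu>" unfolding Adm_add[OF \<mu> \<nu>] by blast
      have "f = (u \<circ> x \<circ> id) \<circ> (id \<circ> y \<circ> u')" using f(1) xy(1) by (simp add: comp_assoc)
      then show "f \<in> {f \<circ> g | f g. f \<in> Adm_J J \<mu> \<and> g \<in> Adm_J J \<nu>}"
        unfolding Adm_J_eq[OF J] using f xy id by blast
    qed
    show "{f \<circ> g | f g. f \<in> Adm_J J \<mu> \<and> g \<in> Adm_J J \<nu>} \<subseteq> Adm_J J (\<mu> + \<nu>)"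
    proof clarify
      fix f g assume "f \<in> Adm_J J \<mu>" "g \<in> Adm_J J \<nu>"
      then obtain u x u' v y v' where f: "f = u \<circ> x \<circ> u'" "u \<in> ?J" "x \<in> Adm \<mu>" "u' \<in> ?J"
        and g: "g = v \<circ> y \<circ> v'" "v \<in> ?J" "y \<in> Adm \<nu>" "v' \<in> ?J"
        unfolding Adm_J_eq[OF J] by blast
      obtain a x' where a: "a \<in> ?J" "x' \<in> Adm \<mu>" "x \<circ> (u' \<circ> v) = a \<circ> x'"
        using Adm_parahoric_swap[OF J comp[OF f(4) g(2)] f(3)] by blast
      have "f \<circ> g = u \<circ> (x \<circ> (u' \<circ> v)) \<circ> y \<circ> v'" by (simp add: f(1) g(1) comp_assoc)
      also have "\<dots> = (u \<circ> a) \<circ> (x' \<circ> y) \<circ> v'" by (simp add: a(3) comp_assoc)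
      finally have "f \<circ> g = (u \<circ> a) \<circ> (x' \<circ> y) \<circ> v'" .
      moreover have "x' \<circ> y \<in> Adm (\<mu> + \<nu>)" unfolding Adm_add[OF \<mu> \<nu>] using a(2) g(3) by blast
      ultimately show "f \<circ> g \<in> Adm_J J (\<mu> + \<nu>)"
        unfolding Adm_J_eq[OF J] using comp[OF f(2) a(1)] g(4) by blast
    qed
  qed
qed

lemma dominant_closure:
  assumes "\<iota> \<mu> \<in> closure dominant_chamber"
  shows "dominant \<mu>"
proof -
  have "0 \<le> pairing \<alpha> \<mu>" if "\<alpha> \<in> \<Delta>" for \<alpha>
  proof -
    have "closed {x. 0 \<le> pairing_V \<alpha> x}"
      by (intro closed_Collect_le continuous_intros continuous_pairing_V)
    moreover have "dominant_chamber \<subseteq> {x. 0 \<le> pairing_V \<alpha> x}"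
      using that by (auto simp: dominant_chamber_def intro: less_imp_le)
    ultimately have "\<iota> \<mu> \<in> {x. 0 \<le> pairing_V \<alpha> x}" using closure_minimal assms by blast
    then show ?thesis by (simp add: pairing_V_\<iota>)
  qed
  then show ?thesis unfolding dominant_def using positive_pairing_nonneg by blast
qed

end

theorem theorem1p4:
  fixes pairing :: "'c::ab_group_add \<Rightarrow> 'd::ab_group_add \<Rightarrow> int"
    and R :: "'c set"
    and coroot :: "'c \<Rightarrow> 'd"
    and \<Delta> :: "'c set"
    and \<iota> :: "'d \<Rightarrow> 'v::real_normed_vector"
    and \<mu> \<nu> :: 'd
    and J :: "('v \<Rightarrow> 'v) set"
  assumes "affine_root_datum pairing R coroot \<Delta> \<iota>"
    and "\<iota> \<mu> \<in> closure (affine_root_datum.dominant_chamber pairing \<Delta> \<iota>)"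
    and "\<iota> \<nu> \<in> closure (affine_root_datum.dominant_chamber pairing \<Delta> \<iota>)"
    and "J \<subseteq> affine_root_datum.S_aff pairing R coroot \<Delta> \<iota>"
  shows "affine_root_datum.Adm_J pairing R coroot \<Delta> \<iota> J (\<mu> + \<nu>) =
         affine_root_datum.Adm_J pairing R coroot \<Delta> \<iota> J \<mu>
           <#>\<^bsub>BijGroup UNIV\<^esub>
         affine_root_datum.Adm_J pairing R coroot \<Delta> \<iota> J \<nu>"
proof -
  interpret affine_root_datum pairing R coroot \<Delta> \<iota> by (rule assms(1))
  show ?thesis using Adm_J_add[OF assms(4) dominant_closure[OF assms(2)] dominant_closure[OF assms(3)]] .
qed

end
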